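(* Let $\mathbf M,\mathbf N,\mathbf P$ be bicomplete categories, let $\mathcal L$ be a class of maps of $\mathbf N$, and let $I,J$ be sets of maps of $\mathbf N$. Suppose given adjunctions $F_1:\mathbf M\rightleftarrows\mathbf N:U_1$ and $F_2:\mathbf N\rightleftarrows\mathbf P:U_2$ ($F_i$ left adjoint to $U_i$), and put $F_0=F_2F_1$ and $U_0=U_1U_2$. Assume: (A) $\mathbf M$ admits the structure of a cofibrantly generated model category with weak equivalences $\mathcal W_{\mathbf M}$, generating cofibrations $I_0$ and generating acyclic cofibrations $J_0$. (B) $\mathbf P$ admits the structure of a cofibrantly generated model category with weak equivalences $\mathcal W_{\mathbf P}$, generating cofibrations $F_0I_0\cup F_2I$ and generating acyclic cofibrations $F_0J_0\cup F_2J$. (C) The subcategory $\mathcal W_{\mathbf N}=(U_1^{-1}\mathcal W_{\mathbf M})\cap\mathcal L$ has the two out of three property and is closed under retracts. (D) The domains of $F_1I_0\cup I$ are small relative to $(F_1I_0\cup I)\text{-cell}$. (E) The domains of $F_1J_0\cup J$ are small relative to $(F_1J_0\cup J)\text{-cell}$. (F) $\mathrm{RLP}(I)=\mathcal L\cap \mathrm{RLP}(J)$. (G) $F_2^{-1}(\mathcal W_{\mathbf P})\subset\mathcal W_{\mathbf N}$. Then $\mathbf N$ admits the structure of a cofibrantly generated model category, with weak equivalences $\mathcal W_{\mathbf N}=(U_1^{-1}\mathcal W_{\mathbf M})\cap\mathcal L$, generating cofibrations $F_1I_0\cup I$, and generating acyclic cofibrations $F_1J_0\cup J$.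
   Context: For a class $\mathcal K$ of maps in a category, $\mathrm{RLP}(\mathcal K)$ denotes the class of maps having the right lifting property with respect to every map in $\mathcal K$. $\mathcal K\text{-cell}$ is the class of transfinite compositions of pushouts of elements of $\mathcal K$. For a functor $F:\mathbf A\to\mathbf B$ and a class $\mathcal K$ of maps in $\mathbf B$, $F^{-1}(\mathcal K)$ is the class of all maps $f$ of $\mathbf A$ with $F(f)\in\mathcal K$; for a class $\mathcal K$ of maps in $\mathbf A$, $F\mathcal K=\{F(k):k\in\mathcal K\}$. "Small relative to a class of maps" is in the usual sense (Hovey, Model categories, Def. 2.1.3). A model category is cofibrantly generated, with set $I$ of generating cofibrations and set $J$ of generating acyclic cofibrations, if the domains of $I$ are small relative to $I\text{-cell}$, the domains of $J$ are small relative to $J\text{-cell}$, the class of fibrations is $\mathrm{RLP}(J)$, and the class of acyclic fibrations is $\mathrm{RLP}(I)$. *)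

theory Defs
  imports Main
begin

unbundle cardinal_syntax

section \<open>Size\<close>

text \<open>
  HOL has no set/class distinction, so ``small'' is taken relative to a Grothendieck universe,
  presented by its cardinal: an uncountable strongly inaccessible cardinal \<open>\<U>\<close> on a type \<open>'u\<close>.
  A collection is a set (is small) if it has fewer than \<open>\<U>\<close> elements; arbitrary HOL sets play the
  role of classes.
\<close>

definition universe :: "'u rel \<Rightarrow> bool" where
  "universe \<U> \<longleftrightarrow> Card_order \<U> \<and> natLeq <o \<U> \<and> regularCard \<U> \<and>
     (\<forall>A :: 'u set. |A| <o \<U> \<longrightarrow> |Pow A| <o \<U>)"

definition small :: "'u rel \<Rightarrow> 'x set \<Rightarrow> bool" where
  "small \<U> S \<longleftrightarrow> |S| <o \<U>"


section \<open>Categories, functors, adjunctions\<close>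

record ('o, 'a) cat =
  Obj :: "'o set"
  Arr :: "'a set"
  Dom :: "'a \<Rightarrow> 'o"
  Cod :: "'a \<Rightarrow> 'o"
  Ident :: "'o \<Rightarrow> 'a"
  Comp :: "'a \<Rightarrow> 'a \<Rightarrow> 'a" (infixr "\<cdot>\<index>" 70)

definition hom :: "('o, 'a) cat \<Rightarrow> 'o \<Rightarrow> 'o \<Rightarrow> 'a set" where
  "hom C x y = {f \<in> Arr C. Dom C f = x \<and> Cod C f = y}"

locale category =
  fixes C :: "('o, 'a) cat" (structure)
  assumes Dom_Obj: "f \<in> Arr C \<Longrightarrow> Dom C f \<in> Obj C"
    and Cod_Obj: "f \<in> Arr C \<Longrightarrow> Cod C f \<in> Obj C"
    and Ident_hom: "x \<in> Obj C \<Longrightarrow> Ident C x \<in> hom C x x"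
    and Comp_hom: "f \<in> hom C x y \<Longrightarrow> g \<in> hom C y z \<Longrightarrow> g \<cdot> f \<in> hom C x z"
    and Comp_Ident: "f \<in> hom C x y \<Longrightarrow> f \<cdot> Ident C x = f"
    and Ident_Comp: "f \<in> hom C x y \<Longrightarrow> Ident C y \<cdot> f = f"
    and Comp_assoc: "f \<in> hom C w x \<Longrightarrow> g \<in> hom C x y \<Longrightarrow> h \<in> hom C y z \<Longrightarrow>
      (h \<cdot> g) \<cdot> f = h \<cdot> (g \<cdot> f)"

definition locally_small :: "'u rel \<Rightarrow> ('o, 'a) cat \<Rightarrow> bool" where
  "locally_small \<U> C \<longleftrightarrow> (\<forall>x \<in> Obj C. \<forall>y \<in> Obj C. small \<U> (hom C x y))"

definition small_category :: "'u rel \<Rightarrow> ('o, 'a) cat \<Rightarrow> bool" where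
  "small_category \<U> C \<longleftrightarrow> category C \<and> small \<U> (Obj C) \<and> small \<U> (Arr C)"

record ('o, 'a, 'p, 'b) func =
  OMap :: "'o \<Rightarrow> 'p"
  AMap :: "'a \<Rightarrow> 'b"

locale is_functor =
  A: category A + B: category B
  for A :: "('o, 'a) cat" and B :: "('p, 'b) cat" and F :: "('o, 'a, 'p, 'b) func" +
  assumes OMap_Obj: "x \<in> Obj A \<Longrightarrow> OMap F x \<in> Obj B"
    and AMap_hom: "f \<in> hom A x y \<Longrightarrow> AMap F f \<in> hom B (OMap F x) (OMap F y)"
    and AMap_Ident: "x \<in> Obj A \<Longrightarrow> AMap F (Ident A x) = Ident B (OMap F x)"
    and AMap_Comp: "f \<in> hom A x y \<Longrightarrow> g \<in> hom A y z \<Longrightarrow>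
      AMap F (g \<cdot>\<^bsub>A\<^esub> f) = AMap F g \<cdot>\<^bsub>B\<^esub> AMap F f"

definition func_comp ::
  "('p, 'b, 'q, 'c) func \<Rightarrow> ('o, 'a, 'p, 'b) func \<Rightarrow> ('o, 'a, 'q, 'c) func" (infixl "\<circ>\<^sub>F" 55)
  where "G \<circ>\<^sub>F F = \<lparr>OMap = OMap G \<circ> OMap F, AMap = AMap G \<circ> AMap F\<rparr>"

text \<open>\<open>\<phi> x y\<close> is the natural bijection from \<open>B(F x, y)\<close> to \<open>A(x, R y)\<close>.\<close>

locale adjunction =
  L: is_functor A B F + R: is_functor B A R
  for A :: "('o, 'a) cat" and B :: "('p, 'b) cat"
    and F :: "('o, 'a, 'p, 'b) func" and R :: "('p, 'b, 'o, 'a) func"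
    and \<phi> :: "'o \<Rightarrow> 'p \<Rightarrow> 'b \<Rightarrow> 'a" +
  assumes bij: "x \<in> Obj A \<Longrightarrow> y \<in> Obj B \<Longrightarrow>
      bij_betw (\<phi> x y) (hom B (OMap F x) y) (hom A x (OMap R y))"
    and natural: "h \<in> hom A x' x \<Longrightarrow> g \<in> hom B (OMap F x) y \<Longrightarrow> k \<in> hom B y y' \<Longrightarrow>
      \<phi> x' y' (k \<cdot>\<^bsub>B\<^esub> g \<cdot>\<^bsub>B\<^esub> AMap F h) = AMap R k \<cdot>\<^bsub>A\<^esub> \<phi> x y g \<cdot>\<^bsub>A\<^esub> h"

definition func_vimage ::
  "('o, 'a) cat \<Rightarrow> ('o, 'a, 'p, 'b) func \<Rightarrow> 'b set \<Rightarrow> 'a set" where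
  "func_vimage A F K = {f \<in> Arr A. AMap F f \<in> K}"

definition func_image :: "('o, 'a, 'p, 'b) func \<Rightarrow> 'a set \<Rightarrow> 'b set" where
  "func_image F K = AMap F ` K"


section \<open>Limits and colimits\<close>

definition is_cocone ::
  "('i, 'j) cat \<Rightarrow> ('o, 'a) cat \<Rightarrow> ('i, 'j, 'o, 'a) func \<Rightarrow> 'o \<Rightarrow> ('i \<Rightarrow> 'a) \<Rightarrow> bool" where
  "is_cocone D C X c \<iota> \<longleftrightarrow> c \<in> Obj C \<and> (\<forall>i \<in> Obj D. \<iota> i \<in> hom C (OMap X i) c) \<and>
     (\<forall>d \<in> Arr D. \<iota> (Cod D d) \<cdot>\<^bsub>C\<^esub> AMap X d = \<iota> (Dom D d))"

definition is_colimit ::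
  "('i, 'j) cat \<Rightarrow> ('o, 'a) cat \<Rightarrow> ('i, 'j, 'o, 'a) func \<Rightarrow> 'o \<Rightarrow> ('i \<Rightarrow> 'a) \<Rightarrow> bool" where
  "is_colimit D C X c \<iota> \<longleftrightarrow> is_cocone D C X c \<iota> \<and>
     (\<forall>c' \<iota>'. is_cocone D C X c' \<iota>' \<longrightarrow>
        (\<exists>!h. h \<in> hom C c c' \<and> (\<forall>i \<in> Obj D. h \<cdot>\<^bsub>C\<^esub> \<iota> i = \<iota>' i)))"

definition is_cone ::
  "('i, 'j) cat \<Rightarrow> ('o, 'a) cat \<Rightarrow> ('i, 'j, 'o, 'a) func \<Rightarrow> 'o \<Rightarrow> ('i \<Rightarrow> 'a) \<Rightarrow> bool" where
  "is_cone D C X c \<pi> \<longleftrightarrow> c \<in> Obj C \<and> (\<forall>i \<in> Obj D. \<pi> i \<in> hom C c (OMap X i)) \<and>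
     (\<forall>d \<in> Arr D. AMap X d \<cdot>\<^bsub>C\<^esub> \<pi> (Dom D d) = \<pi> (Cod D d))"

definition is_limit ::
  "('i, 'j) cat \<Rightarrow> ('o, 'a) cat \<Rightarrow> ('i, 'j, 'o, 'a) func \<Rightarrow> 'o \<Rightarrow> ('i \<Rightarrow> 'a) \<Rightarrow> bool" where
  "is_limit D C X c \<pi> \<longleftrightarrow> is_cone D C X c \<pi> \<and>
     (\<forall>c' \<pi>'. is_cone D C X c' \<pi>' \<longrightarrow>
        (\<exists>!h. h \<in> hom C c' c \<and> (\<forall>i \<in> Obj D. \<pi> i \<cdot>\<^bsub>C\<^esub> h = \<pi>' i)))"

text \<open>
  Shapes may be restricted to categories whose objects and arrows are elements of \<open>'u\<close>, since
  every small category is isomorphic to such a one.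
\<close>

definition bicomplete :: "'u rel \<Rightarrow> ('o, 'a) cat \<Rightarrow> bool" where
  "bicomplete \<U> C \<longleftrightarrow> category C \<and> locally_small \<U> C \<and>
     (\<forall>(D :: ('u, 'u) cat) X. small_category \<U> D \<longrightarrow> is_functor D C X \<longrightarrow>
        (\<exists>c \<pi>. is_limit D C X c \<pi>) \<and> (\<exists>c \<iota>. is_colimit D C X c \<iota>))"

text \<open>\<open>g\<close> is the pushout of \<open>i\<close> along \<open>u\<close>, and \<open>v\<close> the other leg: \<open>g \<cdot> u = v \<cdot> i\<close>.\<close>

definition is_pushout :: "('o, 'a) cat \<Rightarrow> 'a \<Rightarrow> 'a \<Rightarrow> 'a \<Rightarrow> 'a \<Rightarrow> bool" where
  "is_pushout C i u g v \<longleftrightarrow>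
     i \<in> Arr C \<and> u \<in> hom C (Dom C i) (Dom C g) \<and> g \<in> Arr C \<and> v \<in> hom C (Cod C i) (Cod C g) \<and>
     g \<cdot>\<^bsub>C\<^esub> u = v \<cdot>\<^bsub>C\<^esub> i \<and>
     (\<forall>z. \<forall>s \<in> hom C (Dom C g) z. \<forall>t \<in> hom C (Cod C i) z. s \<cdot>\<^bsub>C\<^esub> u = t \<cdot>\<^bsub>C\<^esub> i \<longrightarrow>
        (\<exists>!h. h \<in> hom C (Cod C g) z \<and> h \<cdot>\<^bsub>C\<^esub> g = s \<and> h \<cdot>\<^bsub>C\<^esub> v = t))"

definition pushouts_of :: "('o, 'a) cat \<Rightarrow> 'a set \<Rightarrow> 'a set" where
  "pushouts_of C K = {g. \<exists>i \<in> K. \<exists>u v. is_pushout C i u g v}"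


section \<open>Transfinite compositions and smallness\<close>

text \<open>
  A small ordinal is a small well-order \<open>r\<close> on a subset of \<open>'u\<close>; as a category it has a unique
  arrow \<open>(\<beta>, \<gamma>)\<close> whenever \<open>(\<beta>, \<gamma>) \<in> r\<close>.
\<close>

definition ordinal :: "'u rel \<Rightarrow> 'u rel \<Rightarrow> bool" where
  "ordinal \<U> r \<longleftrightarrow> Well_order r \<and> small \<U> (Field r)"

definition ord_cat :: "'u rel \<Rightarrow> ('u, 'u \<times> 'u) cat" where
  "ord_cat r = \<lparr>Obj = Field r, Arr = r, Dom = fst, Cod = snd, Ident = (\<lambda>\<beta>. (\<beta>, \<beta>)),
     Comp = (\<lambda>e d. (fst d, snd e))\<rparr>"

definition is_zero :: "'u rel \<Rightarrow> 'u \<Rightarrow> bool" where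
  "is_zero r \<beta> \<longleftrightarrow> \<beta> \<in> Field r \<and> underS r \<beta> = {}"

definition is_succ :: "'u rel \<Rightarrow> 'u \<Rightarrow> 'u \<Rightarrow> bool" where
  "is_succ r \<beta> \<beta>' \<longleftrightarrow> \<beta> \<in> underS r \<beta>' \<and> \<not> (\<exists>\<gamma>. \<beta> \<in> underS r \<gamma> \<and> \<gamma> \<in> underS r \<beta>')"

definition is_lim :: "'u rel \<Rightarrow> 'u \<Rightarrow> bool" where
  "is_lim r \<gamma> \<longleftrightarrow> \<gamma> \<in> Field r \<and> \<not> is_zero r \<gamma> \<and> \<not> (\<exists>\<beta>. is_succ r \<beta> \<gamma>)"

text \<open>
  A \<open>\<lambda>\<close>-sequence is a colimit-preserving functor: at every limit ordinal \<open>\<gamma> < \<lambda>\<close>, the object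
  \<open>X\<^sub>\<gamma>\<close> is the colimit of \<open>X\<close> restricted to the ordinals below \<open>\<gamma>\<close>.
\<close>

definition ord_sequence ::
  "('o, 'a) cat \<Rightarrow> 'u rel \<Rightarrow> ('u, 'u \<times> 'u, 'o, 'a) func \<Rightarrow> bool" where
  "ord_sequence C r X \<longleftrightarrow> is_functor (ord_cat r) C X \<and>
     (\<forall>\<gamma>. is_lim r \<gamma> \<longrightarrow>
        is_colimit (ord_cat (Restr r (underS r \<gamma>))) C X (OMap X \<gamma>) (\<lambda>\<beta>. AMap X (\<beta>, \<gamma>)))"

definition sequence_steps_in :: "'u rel \<Rightarrow> ('u, 'u \<times> 'u, 'o, 'a) func \<Rightarrow> 'a set \<Rightarrow> bool" where
  "sequence_steps_in r X K \<longleftrightarrow> (\<forall>\<beta> \<beta>'. is_succ r \<beta> \<beta>' \<longrightarrow> AMap X (\<beta>, \<beta>') \<in> K)"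

definition transfinite_compositions :: "'u rel \<Rightarrow> ('o, 'a) cat \<Rightarrow> 'a set \<Rightarrow> 'a set" where
  "transfinite_compositions \<U> C K =
     {\<iota> \<beta>\<^sub>0 | (r :: 'u rel) X c \<iota> \<beta>\<^sub>0.
        ordinal \<U> r \<and> ord_sequence C r X \<and> sequence_steps_in r X K \<and>
        is_colimit (ord_cat r) C X c \<iota> \<and> is_zero r \<beta>\<^sub>0}"

definition cell :: "'u rel \<Rightarrow> ('o, 'a) cat \<Rightarrow> 'a set \<Rightarrow> 'a set" where
  "cell \<U> C K = transfinite_compositions \<U> C (pushouts_of C K)"

text \<open>
  A \<open>\<kappa>\<close>-filtered ordinal is a limit ordinal in which every subset of cardinality at most \<open>\<kappa>\<close>
  has supremum below it, i.e. is bounded.  The first two conjuncts say that \<open>r\<close> is a (nonzero)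
  limit ordinal.
\<close>

definition filtered_ordinal :: "'u rel \<Rightarrow> 'u rel \<Rightarrow> bool" where
  "filtered_ordinal \<kappa> r \<longleftrightarrow> Field r \<noteq> {} \<and> (\<forall>\<beta> \<in> Field r. \<exists>\<gamma>. \<beta> \<in> underS r \<gamma>) \<and>
     (\<forall>S. S \<subseteq> Field r \<and> |S| \<le>o \<kappa> \<longrightarrow> (\<exists>\<gamma> \<in> Field r. \<forall>\<beta> \<in> S. (\<beta>, \<gamma>) \<in> r))"

text \<open>
  The colimit of the sets \<open>C(a, X\<^sub>\<beta>)\<close>: the quotient of their disjoint union by the equivalence
  relation generated by identifying \<open>f : a \<rightarrow> X\<^sub>\<beta>\<close> with its image in \<open>C(a, X\<^sub>\<gamma>)\<close>.
\<close>

definition hom_sum ::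
  "('o, 'a) cat \<Rightarrow> 'u rel \<Rightarrow> ('u, 'u \<times> 'u, 'o, 'a) func \<Rightarrow> 'o \<Rightarrow> ('u \<times> 'a) set" where
  "hom_sum C r X a = (SIGMA \<beta> : Field r. hom C a (OMap X \<beta>))"

definition hom_rel ::
  "('o, 'a) cat \<Rightarrow> 'u rel \<Rightarrow> ('u, 'u \<times> 'u, 'o, 'a) func \<Rightarrow> 'o \<Rightarrow> ('u \<times> 'a) rel" where
  "hom_rel C r X a =
     {((\<beta>, f), (\<gamma>, AMap X (\<beta>, \<gamma>) \<cdot>\<^bsub>C\<^esub> f)) | \<beta> \<gamma> f. (\<beta>, \<gamma>) \<in> r \<and> f \<in> hom C a (OMap X \<beta>)}"

definition hom_colim ::
  "('o, 'a) cat \<Rightarrow> 'u rel \<Rightarrow> ('u, 'u \<times> 'u, 'o, 'a) func \<Rightarrow> 'o \<Rightarrow> ('u \<times> 'a) set set" where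
  "hom_colim C r X a = hom_sum C r X a // (hom_rel C r X a \<union> (hom_rel C r X a)\<inverse>)\<^sup>*"

text \<open>The canonical map to \<open>C(a, c)\<close>, constant on each class when \<open>\<iota>\<close> is a cocone to \<open>c\<close>.\<close>

definition hom_colim_map ::
  "('o, 'a) cat \<Rightarrow> ('u \<Rightarrow> 'a) \<Rightarrow> ('u \<times> 'a) set \<Rightarrow> 'a" where
  "hom_colim_map C \<iota> E = the_elem ((\<lambda>(\<beta>, f). \<iota> \<beta> \<cdot>\<^bsub>C\<^esub> f) ` E)"

definition cardinal_small_relative ::
  "'u rel \<Rightarrow> ('o, 'a) cat \<Rightarrow> 'u rel \<Rightarrow> 'o \<Rightarrow> 'a set \<Rightarrow> bool" where
  "cardinal_small_relative \<U> C \<kappa> a K \<longleftrightarrow>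
     (\<forall>(r :: 'u rel) X c \<iota>.
        ordinal \<U> r \<and> filtered_ordinal \<kappa> r \<and> ord_sequence C r X \<and> sequence_steps_in r X K \<and>
        is_colimit (ord_cat r) C X c \<iota> \<longrightarrow>
        bij_betw (hom_colim_map C \<iota>) (hom_colim C r X a) (hom C a c))"

definition small_relative :: "'u rel \<Rightarrow> ('o, 'a) cat \<Rightarrow> 'o \<Rightarrow> 'a set \<Rightarrow> bool" where
  "small_relative \<U> C a K \<longleftrightarrow>
     (\<exists>\<kappa> :: 'u rel. Card_order \<kappa> \<and> \<kappa> <o \<U> \<and> cardinal_small_relative \<U> C \<kappa> a K)"

definition domains_small_relative :: "'u rel \<Rightarrow> ('o, 'a) cat \<Rightarrow> 'a set \<Rightarrow> 'a set \<Rightarrow> bool" where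
  "domains_small_relative \<U> C I K \<longleftrightarrow> (\<forall>i \<in> I. small_relative \<U> C (Dom C i) K)"


section \<open>Model categories\<close>

definition has_lift :: "('o, 'a) cat \<Rightarrow> 'a \<Rightarrow> 'a \<Rightarrow> bool" where
  "has_lift C i p \<longleftrightarrow>
     (\<forall>u \<in> hom C (Dom C i) (Dom C p). \<forall>v \<in> hom C (Cod C i) (Cod C p).
        p \<cdot>\<^bsub>C\<^esub> u = v \<cdot>\<^bsub>C\<^esub> i \<longrightarrow>
        (\<exists>h \<in> hom C (Cod C i) (Dom C p). h \<cdot>\<^bsub>C\<^esub> i = u \<and> p \<cdot>\<^bsub>C\<^esub> h = v))"

definition RLP :: "('o, 'a) cat \<Rightarrow> 'a set \<Rightarrow> 'a set" where
  "RLP C K = {p \<in> Arr C. \<forall>i \<in> K. has_lift C i p}"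

definition subcategory :: "('o, 'a) cat \<Rightarrow> 'a set \<Rightarrow> bool" where
  "subcategory C K \<longleftrightarrow> K \<subseteq> Arr C \<and> (\<forall>x \<in> Obj C. Ident C x \<in> K) \<and>
     (\<forall>f \<in> K. \<forall>g \<in> K. Dom C g = Cod C f \<longrightarrow> g \<cdot>\<^bsub>C\<^esub> f \<in> K)"

definition two_out_of_three :: "('o, 'a) cat \<Rightarrow> 'a set \<Rightarrow> bool" where
  "two_out_of_three C K \<longleftrightarrow>
     (\<forall>f \<in> Arr C. \<forall>g \<in> Arr C. Dom C g = Cod C f \<longrightarrow>
        (f \<in> K \<and> g \<in> K \<longrightarrow> g \<cdot>\<^bsub>C\<^esub> f \<in> K) \<and>
        (f \<in> K \<and> g \<cdot>\<^bsub>C\<^esub> f \<in> K \<longrightarrow> g \<in> K) \<and>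
        (g \<in> K \<and> g \<cdot>\<^bsub>C\<^esub> f \<in> K \<longrightarrow> f \<in> K))"

definition is_retract :: "('o, 'a) cat \<Rightarrow> 'a \<Rightarrow> 'a \<Rightarrow> bool" where
  "is_retract C f g \<longleftrightarrow> f \<in> Arr C \<and> g \<in> Arr C \<and>
     (\<exists>s \<in> hom C (Dom C f) (Dom C g). \<exists>r \<in> hom C (Dom C g) (Dom C f).
      \<exists>s' \<in> hom C (Cod C f) (Cod C g). \<exists>r' \<in> hom C (Cod C g) (Cod C f).
        r \<cdot>\<^bsub>C\<^esub> s = Ident C (Dom C f) \<and> r' \<cdot>\<^bsub>C\<^esub> s' = Ident C (Cod C f) \<and>
        g \<cdot>\<^bsub>C\<^esub> s = s' \<cdot>\<^bsub>C\<^esub> f \<and> f \<cdot>\<^bsub>C\<^esub> r = r' \<cdot>\<^bsub>C\<^esub> g)"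

definition retract_closed :: "('o, 'a) cat \<Rightarrow> 'a set \<Rightarrow> bool" where
  "retract_closed C K \<longleftrightarrow> (\<forall>g \<in> K. \<forall>f. is_retract C f g \<longrightarrow> f \<in> K)"

text \<open>
  The category of arrows: \<open>(f, u, v, g)\<close> is the square \<open>g \<cdot> u = v \<cdot> f\<close>, an arrow from \<open>f\<close> to \<open>g\<close>.
\<close>

definition arrow_cat :: "('o, 'a) cat \<Rightarrow> ('a, 'a \<times> 'a \<times> 'a \<times> 'a) cat" where
  "arrow_cat C = \<lparr>
     Obj = Arr C,
     Arr = {(f, u, v, g). f \<in> Arr C \<and> g \<in> Arr C \<and> u \<in> hom C (Dom C f) (Dom C g) \<and>
       v \<in> hom C (Cod C f) (Cod C g) \<and> g \<cdot>\<^bsub>C\<^esub> u = v \<cdot>\<^bsub>C\<^esub> f},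
     Dom = (\<lambda>(f, u, v, g). f),
     Cod = (\<lambda>(f, u, v, g). g),
     Ident = (\<lambda>f. (f, Ident C (Dom C f), Ident C (Cod C f), f)),
     Comp = (\<lambda>(f', u', v', g') (f, u, v, g). (f, u' \<cdot>\<^bsub>C\<^esub> u, v' \<cdot>\<^bsub>C\<^esub> v, g'))\<rparr>"

text \<open>
  A functorial factorization: \<open>f = \<beta> f \<cdot> \<alpha> f\<close>, with the two endofunctors \<open>\<alpha>\<close>, \<open>\<beta>\<close> of the arrow
  category agreeing with a square \<open>(u, v)\<close> on its outer edges and with each other on the middle
  edge \<open>w\<close>.
\<close>

definition functorial_factorization ::
  "('o, 'a) cat \<Rightarrow> ('a, 'a \<times> 'a \<times> 'a \<times> 'a, 'a, 'a \<times> 'a \<times> 'a \<times> 'a) func \<Rightarrow>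
   ('a, 'a \<times> 'a \<times> 'a \<times> 'a, 'a, 'a \<times> 'a \<times> 'a \<times> 'a) func \<Rightarrow> bool" where
  "functorial_factorization C \<alpha> \<beta> \<longleftrightarrow>
     is_functor (arrow_cat C) (arrow_cat C) \<alpha> \<and> is_functor (arrow_cat C) (arrow_cat C) \<beta> \<and>
     (\<forall>f \<in> Arr C. Dom C (OMap \<alpha> f) = Dom C f \<and> Cod C (OMap \<alpha> f) = Dom C (OMap \<beta> f) \<and>
        Cod C (OMap \<beta> f) = Cod C f \<and> OMap \<beta> f \<cdot>\<^bsub>C\<^esub> OMap \<alpha> f = f) \<and>
     (\<forall>f u v g. (f, u, v, g) \<in> Arr (arrow_cat C) \<longrightarrow>
        (\<exists>w. AMap \<alpha> (f, u, v, g) = (OMap \<alpha> f, u, w, OMap \<alpha> g) \<and>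
             AMap \<beta> (f, u, v, g) = (OMap \<beta> f, w, v, OMap \<beta> g)))"

definition model_structure ::
  "('o, 'a) cat \<Rightarrow> 'a set \<Rightarrow> 'a set \<Rightarrow> 'a set \<Rightarrow> bool" where
  "model_structure C W Cof Fib \<longleftrightarrow>
     subcategory C W \<and> subcategory C Cof \<and> subcategory C Fib \<and>
     two_out_of_three C W \<and>
     retract_closed C W \<and> retract_closed C Cof \<and> retract_closed C Fib \<and>
     (\<forall>i \<in> W \<inter> Cof. \<forall>p \<in> Fib. has_lift C i p) \<and>
     (\<forall>i \<in> Cof. \<forall>p \<in> W \<inter> Fib. has_lift C i p) \<and>
     (\<exists>\<alpha> \<beta>. functorial_factorization C \<alpha> \<beta> \<and>
        (\<forall>f \<in> Arr C. OMap \<alpha> f \<in> Cof \<and> OMap \<beta> f \<in> W \<inter> Fib)) \<and>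
     (\<exists>\<gamma> \<delta>. functorial_factorization C \<gamma> \<delta> \<and>
        (\<forall>f \<in> Arr C. OMap \<gamma> f \<in> W \<inter> Cof \<and> OMap \<delta> f \<in> Fib))"

text \<open>
  \<open>C\<close> admits the structure of a cofibrantly generated model category with weak equivalences \<open>W\<close>,
  generating cofibrations \<open>I\<close> and generating acyclic cofibrations \<open>J\<close>.
\<close>

definition cofibrantly_generated ::
  "'u rel \<Rightarrow> ('o, 'a) cat \<Rightarrow> 'a set \<Rightarrow> 'a set \<Rightarrow> 'a set \<Rightarrow> bool" where
  "cofibrantly_generated \<U> C W I J \<longleftrightarrow> bicomplete \<U> C \<and>
     I \<subseteq> Arr C \<and> small \<U> I \<and> J \<subseteq> Arr C \<and> small \<U> J \<and>
     (\<exists>Cof Fib. model_structure C W Cof Fib \<and>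
        domains_small_relative \<U> C I (cell \<U> C I) \<and>
        domains_small_relative \<U> C J (cell \<U> C J) \<and>
        Fib = RLP C J \<and> W \<inter> Fib = RLP C I)"

end

theory Submission
  imports Defs
begin

text \<open>
  Put \<open>I' = F\<^sub>1 I\<^sub>0 \<union> I\<close> and \<open>J' = F\<^sub>1 J\<^sub>0 \<union> J\<close>.  The model structure on \<open>N\<close> has fibrations \<open>RLP J'\<close> and
  cofibrations \<open>LLP (RLP I')\<close>.  By the usual recognition principle (\<open>cofibrantly_generatedI\<close>) two facts
  about these sets suffice.

  First, \<open>RLP I' = W\<^sub>N \<inter> RLP J'\<close>.  Transposing lifting problems along \<open>F\<^sub>1 \<stileturn> U\<^sub>1\<close> shows that \<open>RLP (F\<^sub>1 I\<^sub>0)\<close>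
  consists of the maps \<open>p\<close> for which \<open>U\<^sub>1 p\<close> is an acyclic fibration of \<open>M\<close>, and \<open>RLP (F\<^sub>1 J\<^sub>0)\<close> of those for
  which \<open>U\<^sub>1 p\<close> is a fibration.  Intersecting with \<open>RLP I = L \<inter> RLP J\<close> gives the claim.

  Second, \<open>LLP (RLP J') \<subseteq> W\<^sub>N\<close>.  Transposing along \<open>F\<^sub>2 \<stileturn> U\<^sub>2\<close> shows that \<open>F\<^sub>2\<close> sends \<open>LLP (RLP J')\<close> into
  \<open>LLP (RLP (F\<^sub>2 J'))\<close>.  As \<open>F\<^sub>2 J'\<close> generates the acyclic cofibrations of \<open>P\<close>, the retract argument in \<open>P\<close>
  puts the result into \<open>W\<^sub>P\<close>, and \<open>F\<^sub>2\<close> reflects weak equivalences into \<open>W\<^sub>N\<close>.  Working with \<open>LLP (RLP J')\<close>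
  rather than with relative \<open>J'\<close>-cell complexes means that no pushout or transfinite composition has to be
  carried through \<open>F\<^sub>2\<close>.

  The recognition principle rests on the small object argument in its functorial form
  (\<open>small_object_argument\<close>), which makes up most of the text.  For a map \<open>f : A \<rightarrow> B\<close> it builds a tower of
  objects over \<open>B\<close> under \<open>A\<close> by transfinite recursion.  Every stage is defined by the same universal
  property, without distinguishing zero, successor and limit ordinals: it is presented by generators,
  namely \<open>A\<close>, all earlier stages, and one cell for each square from a map of \<open>K\<close> to the projection of an
  earlier stage.  The relations say that the cells are attached along their squares and that all is
  compatible with the earlier stages.  A map out of a stage is then a compatible family of maps out of
  its generators, so that liftings and maps between towers can be found by recursion and compared on
  generators (\<open>leg_Base_in_LLP\<close>, \<open>ex_tower_map\<close>, \<open>tower_map_unique\<close>).  Smallness enters once: the step from a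
  stage to its successor is a wide pushout, hence a relative cell complex (\<open>wide_pushout_in_cell\<close>), so a map
  from a small domain into a stage of large cofinality factors through an earlier stage, and the cell
  attached there solves its lifting problem (\<open>prj_in_RLP\<close>).

  All ordinals are initial segments of the universe \<open>\<U>\<close> itself, which is a well-order longer than every
  small ordinal.
\<close>

section \<open>Small sets and small ordinals\<close>

lemma small_mono: "small \<U> S \<Longrightarrow> T \<subseteq> S \<Longrightarrow> small \<U> T"
  unfolding small_def using card_of_mono1 ordLeq_ordLess_trans by blast

lemma small_image: "small \<U> S \<Longrightarrow> small \<U> (f ` S)"
  unfolding small_def using card_of_image ordLeq_ordLess_trans by blast

locale size_universe =
  fixes \<U> :: "'u rel"
  assumes universe: "universe \<U>"
begin

lemma Card_order: "Card_order \<U>"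
  and regularCard: "regularCard \<U>"
  using universe by (auto simp: universe_def)

lemma Well_order: "Well_order \<U>"
  using Card_order by (rule card_order_on_well_order_on)

lemma infinite_Field: "infinite (Field \<U>)"
  using universe unfolding universe_def
  by (metis Field_natLeq card_of_ordLeq_infinite card_of_Field_ordIso infinite_UNIV_nat
      natLeq_Card_order ordIso_iff_ordLeq ordIso_ordLeq_trans ordLeq_ordIso_trans ordLess_imp_ordLeq
      ordIso_symmetric)

lemma small_finite: "finite S \<Longrightarrow> small \<U> S"
  unfolding small_def using finite_ordLess_infinite[OF card_of_Well_order[of S] Well_order] infinite_Field
  by (simp add: Field_card_of)

lemma small_Sigma: "small \<U> S \<Longrightarrow> (\<And>s. s \<in> S \<Longrightarrow> small \<U> (T s)) \<Longrightarrow> small \<U> (SIGMA s : S. T s)"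
  unfolding small_def
  by (rule stable_elim[OF regularCard_stable[OF Card_order infinite_Field regularCard]])

lemma small_UN: "small \<U> S \<Longrightarrow> (\<And>s. s \<in> S \<Longrightarrow> small \<U> (T s)) \<Longrightarrow> small \<U> (\<Union>s \<in> S. T s)"
  by (rule small_mono[OF small_image[OF small_Sigma, of S T snd]]) force+

lemma small_Un: "small \<U> S \<Longrightarrow> small \<U> T \<Longrightarrow> small \<U> (S \<union> T)"
  using small_UN[of "{True, False}" "\<lambda>b. if b then S else T"] by (auto simp: small_finite Un_commute)

lemma small_insert: "small \<U> S \<Longrightarrow> small \<U> (insert s S)"
  using small_Un[of "{s}" S] by (simp add: small_finite)

lemma small_underS: "small \<U> (underS \<U> \<beta>)"
  using card_of_underS[OF Card_order] underS_empty[of \<beta> \<U>] small_finite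
  by (cases "\<beta> \<in> Field \<U>") (auto simp: small_def)

lemma small_encoding: "small \<U> S \<Longrightarrow> \<exists>f :: _ \<Rightarrow> 'u. inj_on f S"
  unfolding small_def
  by (metis Card_order card_of_ordLeq card_of_Field_ordIso ordIso_iff_ordLeq ordLess_imp_ordLeq
      ordLeq_transitive ordLess_ordLeq_trans ordIso_symmetric)

lemma underS_trans: "\<alpha> \<in> underS \<U> \<beta> \<Longrightarrow> \<beta> \<in> underS \<U> \<gamma> \<Longrightarrow> \<alpha> \<in> underS \<U> \<gamma>"
  using Well_order unfolding well_order_on_def linear_order_on_def partial_order_on_def preorder_on_def
  underS_def trans_def antisym_def by blast

lemma underS_le_trans: "\<alpha> \<in> underS \<U> \<beta> \<Longrightarrow> (\<beta>, \<gamma>) \<in> \<U> \<Longrightarrow> \<alpha> \<in> underS \<U> \<gamma>"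
  using Well_order unfolding well_order_on_def linear_order_on_def partial_order_on_def preorder_on_def
  underS_def trans_def antisym_def by blast

lemma le_trans: "(\<alpha>, \<beta>) \<in> \<U> \<Longrightarrow> (\<beta>, \<gamma>) \<in> \<U> \<Longrightarrow> (\<alpha>, \<gamma>) \<in> \<U>"
  using Well_order unfolding well_order_on_def linear_order_on_def partial_order_on_def preorder_on_def
  trans_def by blast

lemma le_refl: "\<alpha> \<in> Field \<U> \<Longrightarrow> (\<alpha>, \<alpha>) \<in> \<U>"
  using Well_order unfolding well_order_on_def linear_order_on_def partial_order_on_def preorder_on_def
  refl_on_def by blast

lemma le_antisym: "(\<alpha>, \<beta>) \<in> \<U> \<Longrightarrow> (\<beta>, \<alpha>) \<in> \<U> \<Longrightarrow> \<alpha> = \<beta>"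
  using Well_order unfolding well_order_on_def linear_order_on_def partial_order_on_def antisym_def by blast

lemma le_total: "\<alpha> \<in> Field \<U> \<Longrightarrow> \<beta> \<in> Field \<U> \<Longrightarrow> (\<alpha>, \<beta>) \<in> \<U> \<or> (\<beta>, \<alpha>) \<in> \<U>"
  using Well_order le_refl unfolding well_order_on_def linear_order_on_def total_on_def by metis

lemma underS_le: "\<alpha> \<in> underS \<U> \<beta> \<Longrightarrow> (\<alpha>, \<beta>) \<in> \<U>"
  by (simp add: underS_def)

lemma underS_FieldI: "\<alpha> \<in> underS \<U> \<beta> \<Longrightarrow> \<alpha> \<in> Field \<U>" "\<alpha> \<in> underS \<U> \<beta> \<Longrightarrow> \<beta> \<in> Field \<U>"
  by (auto simp: underS_def Field_def)

lemma le_FieldI: "(\<alpha>, \<beta>) \<in> \<U> \<Longrightarrow> \<alpha> \<in> Field \<U>" "(\<alpha>, \<beta>) \<in> \<U> \<Longrightarrow> \<beta> \<in> Field \<U>"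
  by (auto simp: Field_def)

lemma underS_or_ge: "\<alpha> \<in> Field \<U> \<Longrightarrow> \<beta> \<in> Field \<U> \<Longrightarrow> \<alpha> \<in> underS \<U> \<beta> \<or> (\<beta>, \<alpha>) \<in> \<U>"
  using le_total[of \<alpha> \<beta>] le_refl[of \<alpha>] by (cases "\<alpha> = \<beta>") (auto simp: underS_def)

lemma le_iff: "(\<alpha>, \<beta>) \<in> \<U> \<longleftrightarrow> \<alpha> \<in> underS \<U> \<beta> \<or> \<alpha> = \<beta> \<and> \<beta> \<in> Field \<U>"
  using le_refl[of \<beta>] by (auto simp: underS_def Field_def)

lemma underS_wf: "wf {(\<gamma>, \<beta>). \<gamma> \<in> underS \<U> \<beta>}"
proof -
  have "{(\<gamma>, \<beta>). \<gamma> \<in> underS \<U> \<beta>} = \<U> - Id"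
    by (auto simp: underS_def)
  then show ?thesis
    using Well_order by (simp add: well_order_on_def)
qed

lemma underS_induct [case_names less]:
  assumes "\<And>\<beta>. (\<And>\<gamma>. \<gamma> \<in> underS \<U> \<beta> \<Longrightarrow> Q \<gamma>) \<Longrightarrow> Q \<beta>"
  shows "Q \<beta>"
  using underS_wf by (induction \<beta> rule: wf_induct_rule) (use assms in auto)

lemma ex_zero: "\<exists>\<zeta> \<in> Field \<U>. \<forall>\<beta> \<in> Field \<U>. (\<zeta>, \<beta>) \<in> \<U>"
proof -
  obtain \<zeta> where "\<zeta> \<in> Field \<U>" "\<And>\<beta>. (\<beta>, \<zeta>) \<in> {(\<gamma>, \<beta>). \<gamma> \<in> underS \<U> \<beta>} \<Longrightarrow> \<beta> \<notin> Field \<U>"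
    using wfE_min[OF underS_wf] infinite_Field by (metis ex_in_conv finite.emptyI)
  then show ?thesis
    using underS_or_ge by blast
qed

lemma Field_Restr: "S \<subseteq> Field \<U> \<Longrightarrow> Field (Restr \<U> S) = S"
  using le_refl by (force simp: Field_def)

definition initial_segment :: "'u set \<Rightarrow> bool" where
  "initial_segment S \<longleftrightarrow> S \<subseteq> Field \<U> \<and> (\<forall>\<beta> \<in> S. underS \<U> \<beta> \<subseteq> S)"

lemma initial_segment_underS: "initial_segment (underS \<U> \<beta>)"
  and initial_segment_under: "initial_segment (under \<U> \<beta>)"
  unfolding initial_segment_def
  using underS_trans underS_le_trans[THEN underS_le] underS_FieldI(1) le_FieldI(1) by (auto simp: under_def)

lemma underS_Restr:
  assumes "initial_segment S" "\<beta> \<in> S"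
  shows "underS (Restr \<U> S) \<beta> = underS \<U> \<beta>"
  using assms unfolding initial_segment_def by (auto simp: underS_def)

lemma ordinal_Restr:
  assumes "S \<subseteq> Field \<U>" "small \<U> S"
  shows "ordinal \<U> (Restr \<U> S)"
  unfolding ordinal_def using Well_order_Restr[OF Well_order] Field_Restr[OF assms(1)] assms(2) by metis

text \<open>
  The cardinal of a small set is isomorphic to a proper initial segment of \<open>\<U>\<close>.  This is how a family of
  cells gets an order in which they can be attached.
\<close>

lemma small_enumeration:
  assumes "small \<U> S"
  shows "\<exists>\<tau> \<in> Field \<U>. \<exists>e. bij_betw e (underS \<U> \<tau>) S"
proof -
  obtain \<tau> where \<tau>: "\<tau> \<in> Field \<U>" "|S| =o Restr \<U> (underS \<U> \<tau>)"
    using assms ordLess_iff_ordIso_Restr[OF Well_order card_of_Well_order[of S]] unfolding small_def by blast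
  have "\<exists>e. bij_betw e S (underS \<U> \<tau>)"
    using \<tau>(2) Field_Restr[OF Order_Relation.underS_Field, of \<tau>]
    unfolding ordIso_def iso_def by (auto simp: Field_card_of)
  then show ?thesis
    using \<tau>(1) bij_betw_inv by blast
qed

text \<open>
  Let \<open>\<mu>\<close> be an infinite small cardinal above all the given ones.  Its successor is at most \<open>2\<^sup>\<mu>\<close>, hence below
  \<open>\<U>\<close> by strong inaccessibility, and it is regular, so that no set of size at most \<open>\<mu>\<close> is cofinal in it.
\<close>

lemma ex_filtered_ordinal:
  fixes \<kappa> :: "'s \<Rightarrow> 'u rel"
  assumes "small \<U> S" and "\<And>s. s \<in> S \<Longrightarrow> Card_order (\<kappa> s) \<and> \<kappa> s <o \<U>"
  shows "\<exists>\<Lambda> \<in> Field \<U>. (\<forall>s \<in> S. filtered_ordinal (\<kappa> s) (Restr \<U> (underS \<U> \<Lambda>)))"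
proof -
  have "small \<U> (Field (\<kappa> s))" if "s \<in> S" for s
    unfolding small_def using assms(2)[OF that] card_of_Field_ordIso ordIso_ordLess_trans by blast
  then have "small \<U> (SIGMA s : S. Field (\<kappa> s))"
    by (intro small_Sigma assms(1))
  moreover have "small \<U> (UNIV :: nat set)"
    using universe unfolding universe_def small_def
    by (meson card_of_nat ordIso_ordLess_trans)
  ultimately have "small \<U> (Inl ` (SIGMA s : S. Field (\<kappa> s)) \<union> Inr ` (UNIV :: nat set))" (is "small \<U> ?T")
    by (intro small_Un small_image)
  \<comment> \<open>The strong limit property speaks of subsets of \<open>'u\<close>, so the cardinal has to be realized there.\<close>
  then obtain enc :: "_ \<Rightarrow> 'u" where enc: "inj_on enc ?T" and "small \<U> (enc ` ?T)"
    using small_encoding small_image by blast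
  define \<mu> where "\<mu> = |enc ` ?T|"
  have T\<mu>: "|?T| \<le>o \<mu>"
    unfolding \<mu>_def using enc card_of_ordLeq by blast
  have \<mu>: "Card_order \<mu>" "infinite (Field \<mu>)"
    using card_of_Card_order finite_image_iff[OF enc]
    unfolding \<mu>_def by (blast, simp add: Field_card_of finite_image_iff)
  have "cardSuc \<mu> \<le>o |Pow (enc ` ?T)|"
    using cardSuc_least[OF \<mu>(1) card_of_Card_order] card_of_Pow unfolding \<mu>_def by blast
  moreover have "|Pow (enc ` ?T)| <o \<U>"
    using universe \<open>small \<U> (enc ` ?T)\<close> unfolding universe_def small_def by blast
  ultimately have "cardSuc \<mu> <o \<U>"
    using ordLeq_ordLess_trans by blast
  then obtain \<Lambda> where \<Lambda>: "\<Lambda> \<in> Field \<U>" "cardSuc \<mu> =o Restr \<U> (underS \<U> \<Lambda>)"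
    using ordLess_iff_ordIso_Restr[OF Well_order card_order_on_well_order_on[OF cardSuc_Card_order[OF \<mu>(1)]]]
    by blast
  define r where "r = Restr \<U> (underS \<U> \<Lambda>)"
  have r: "cardSuc \<mu> =o r" "r =o cardSuc \<mu>"
    using \<Lambda>(2) ordIso_symmetric unfolding r_def by blast+
  have cs: "Cinfinite \<mu>"
    using \<mu> by (simp add: cinfinite_def)
  have r_card: "Card_order r"
    using Card_order_ordIso2[OF cardSuc_Card_order[OF \<mu>(1)] r(1)] .
  have r_inf: "infinite (Field r)"
    using Cinfinite_cong[OF r(1) Cinfinite_cardSuc[OF cs]] by (simp add: cinfinite_def)
  have r_reg: "regularCard r"
    using regularCard_ordIso[OF r(1) Cinfinite_cardSuc[OF cs] regularCard_cardSuc[OF cs]] .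
  have lin: "(\<alpha>, \<beta>) \<in> r \<or> (\<beta>, \<alpha>) \<in> r" if "\<alpha> \<in> Field r" "\<beta> \<in> Field r" for \<alpha> \<beta>
    using that le_total unfolding r_def by (auto simp: Field_def)
  have "filtered_ordinal (\<kappa> s) r" if s: "s \<in> S" for s
    unfolding filtered_ordinal_def
  proof (intro conjI allI impI ballI)
    show "Field r \<noteq> {}"
      using r_inf by auto
    show "\<exists>\<gamma>. \<beta> \<in> underS r \<gamma>" if "\<beta> \<in> Field r" for \<beta>
      using infinite_Card_order_limit[OF r_card r_inf that] by (auto simp: underS_def)
    fix B assume B: "B \<subseteq> Field r \<and> |B| \<le>o \<kappa> s"
    have "|Field (\<kappa> s)| \<le>o |?T|"
      using s card_of_ordLeq[of "Field (\<kappa> s)" ?T]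
      by (force intro!: exI[of _ "\<lambda>x. Inl (s, x)"] inj_onI)
    then have "\<kappa> s \<le>o |?T|"
      using card_of_Field_ordIso[of "\<kappa> s"] assms(2)[OF s] ordIso_ordLeq_trans ordIso_symmetric by blast
    then have "\<kappa> s \<le>o \<mu>"
      using T\<mu> by (rule ordLeq_transitive)
    then have "|B| \<le>o \<mu>"
      using B ordLeq_transitive by blast
    then have "|B| <o r"
      using cardSuc_greater[OF \<mu>(1)] r(1) ordLeq_ordLess_trans ordLess_ordIso_trans by blast
    then have "\<not> cofinal B r"
      using r_reg B not_ordLess_ordIso unfolding regularCard_def by blast
    then obtain \<gamma> where \<gamma>: "\<gamma> \<in> Field r" "\<And>\<beta>. \<beta> \<in> B \<Longrightarrow> \<gamma> = \<beta> \<or> (\<gamma>, \<beta>) \<notin> r"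
      unfolding cofinal_def by blast
    have "\<forall>\<beta> \<in> B. (\<beta>, \<gamma>) \<in> r"
      using \<gamma> B lin by (metis subsetD)
    then show "\<exists>\<gamma> \<in> Field r. \<forall>\<beta> \<in> B. (\<beta>, \<gamma>) \<in> r"
      using \<gamma>(1) by blast
  qed
  then show ?thesis
    using \<Lambda>(1) unfolding r_def by blast
qed

end


section \<open>Colimits from generators and relations\<close>

lemma (in category) hom_Obj: "f \<in> hom C x y \<Longrightarrow> x \<in> Obj C" "f \<in> hom C x y \<Longrightarrow> y \<in> Obj C"
  using Dom_Obj Cod_Obj by (auto simp: hom_def)

lemma Arr_hom: "f \<in> Arr C \<Longrightarrow> f \<in> hom C (Dom C f) (Cod C f)"
  by (simp add: hom_def)

lemma homD: "f \<in> hom C x y \<Longrightarrow> f \<in> Arr C" "f \<in> hom C x y \<Longrightarrow> Dom C f = x" "f \<in> hom C x y \<Longrightarrow> Cod C f = y"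
  by (auto simp: hom_def)

text \<open>
  A presentation of an object consists of generators \<open>g\<close>, each standing for a map from an object \<open>ob g\<close>, and
  relations \<open>(g, k, g', k')\<close>, each demanding that \<open>x g \<cdot> k = x g' \<cdot> k'\<close>.  The object presented is the colimit of an
  evident diagram, but stating its universal property directly in terms of generators keeps the shape
  category out of all later arguments.
\<close>

definition presentation ::
  "('o, 'a) cat \<Rightarrow> 'g set \<Rightarrow> ('g \<times> 'a \<times> 'g \<times> 'a) set \<Rightarrow> ('g \<Rightarrow> 'o) \<Rightarrow> bool" where
  "presentation C G R ob \<longleftrightarrow> (\<forall>g \<in> G. ob g \<in> Obj C) \<and>
     (\<forall>(g, k, g', k') \<in> R. g \<in> G \<and> g' \<in> G \<and> k \<in> Arr C \<and> k' \<in> Arr C \<and> Dom C k = Dom C k' \<and>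
        Cod C k = ob g \<and> Cod C k' = ob g')"

definition presentation_cocone ::
  "('o, 'a) cat \<Rightarrow> 'g set \<Rightarrow> ('g \<times> 'a \<times> 'g \<times> 'a) set \<Rightarrow> ('g \<Rightarrow> 'o) \<Rightarrow> 'o \<Rightarrow> ('g \<Rightarrow> 'a) \<Rightarrow> bool" where
  "presentation_cocone C G R ob z x \<longleftrightarrow> z \<in> Obj C \<and> (\<forall>g \<in> G. x g \<in> hom C (ob g) z) \<and>
     (\<forall>(g, k, g', k') \<in> R. x g \<cdot>\<^bsub>C\<^esub> k = x g' \<cdot>\<^bsub>C\<^esub> k')"

definition presents ::
  "('o, 'a) cat \<Rightarrow> 'g set \<Rightarrow> ('g \<times> 'a \<times> 'g \<times> 'a) set \<Rightarrow> ('g \<Rightarrow> 'o) \<Rightarrow> 'o \<Rightarrow> ('g \<Rightarrow> 'a) \<Rightarrow> bool" where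
  "presents C G R ob z x \<longleftrightarrow> presentation_cocone C G R ob z x \<and>
     (\<forall>z' x'. presentation_cocone C G R ob z' x' \<longrightarrow>
        (\<exists>!h. h \<in> hom C z z' \<and> (\<forall>g \<in> G. h \<cdot>\<^bsub>C\<^esub> x g = x' g)))"

lemma presents_cocone: "presents C G R ob z x \<Longrightarrow> presentation_cocone C G R ob z x"
  by (simp add: presents_def)

lemma presents_Obj: "presents C G R ob z x \<Longrightarrow> z \<in> Obj C"
  and presents_hom: "presents C G R ob z x \<Longrightarrow> g \<in> G \<Longrightarrow> x g \<in> hom C (ob g) z"
  and presents_rel: "presents C G R ob z x \<Longrightarrow> (g, k, g', k') \<in> R \<Longrightarrow> x g \<cdot>\<^bsub>C\<^esub> k = x g' \<cdot>\<^bsub>C\<^esub> k'"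
  by (auto simp: presents_def presentation_cocone_def)

lemma presents_ex:
  assumes "presents C G R ob z x" "presentation_cocone C G R ob z' x'"
  obtains h where "h \<in> hom C z z'" "\<And>g. g \<in> G \<Longrightarrow> h \<cdot>\<^bsub>C\<^esub> x g = x' g"
  using assms unfolding presents_def by blast

context category begin

lemma presentation_cocone_comp:
  assumes "presentation C G R ob" "presentation_cocone C G R ob z x" "h \<in> hom C z z'"
  shows "presentation_cocone C G R ob z' (\<lambda>g. h \<cdot> x g)"
  unfolding presentation_cocone_def
proof (intro conjI ballI; clarify?)
  show "z' \<in> Obj C"
    using assms(3) hom_Obj by blast
  show "h \<cdot> x g \<in> hom C (ob g) z'" if "g \<in> G" for g
    using that assms Comp_hom unfolding presentation_cocone_def by blast
  fix g k g' k' assume R: "(g, k, g', k') \<in> R"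
  then have "k \<in> hom C (Dom C k) (ob g)" "k' \<in> hom C (Dom C k) (ob g')" "g \<in> G" "g' \<in> G"
    using assms(1) unfolding presentation_def hom_def by fastforce+
  moreover have "x g \<cdot> k = x g' \<cdot> k'" and "\<And>g. g \<in> G \<Longrightarrow> x g \<in> hom C (ob g) z"
    using R assms(2) unfolding presentation_cocone_def by auto
  ultimately show "(h \<cdot> x g) \<cdot> k = (h \<cdot> x g') \<cdot> k'"
    using Comp_assoc[OF _ _ assms(3)] by simp
qed

lemma presents_eqI:
  assumes "presentation C G R ob" "presents C G R ob z x" "h \<in> hom C z z'" "h' \<in> hom C z z'"
    and "\<And>g. g \<in> G \<Longrightarrow> h \<cdot> x g = h' \<cdot> x g"
  shows "h = h'"
proof -
  have "presentation_cocone C G R ob z' (\<lambda>g. h' \<cdot> x g)"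
    by (rule presentation_cocone_comp[OF assms(1) presents_cocone[OF assms(2)] assms(4)])
  then have "\<exists>!k. k \<in> hom C z z' \<and> (\<forall>g \<in> G. k \<cdot> x g = h' \<cdot> x g)"
    using assms(2) unfolding presents_def by (elim conjE allE impE)
  then show ?thesis
    using assms(3,4,5) by blast
qed

end

locale bicomplete_category = size_universe \<U> + category C
  for \<U> :: "'u rel" and C :: "('o, 'a) cat" (structure) +
  assumes bicomplete: "bicomplete \<U> C"
begin

lemma small_hom: "small \<U> (hom C x y)"
proof (cases "x \<in> Obj C \<and> y \<in> Obj C")
  case True
  then show ?thesis
    using bicomplete unfolding bicomplete_def locally_small_def by blast
next
  case False
  then have "hom C x y = {}"
    using hom_Obj by blast
  then show ?thesis
    by (simp add: small_finite)
qed

text \<open>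
  Bicompleteness speaks of shapes whose objects and arrows are elements of \<open>'u\<close>.  A small shape of any
  other type is relabelled along injections of its objects and arrows into \<open>'u\<close>.
\<close>

lemma ex_small_colimit:
  fixes D :: "('i, 'j) cat"
  assumes D: "small_category \<U> D" and X: "is_functor D C X"
  shows "\<exists>c \<iota>. is_colimit D C X c \<iota>"
proof -
  interpret X: is_functor D C X by (rule X)
  obtain eo :: "'i \<Rightarrow> 'u" where eo: "inj_on eo (Obj D)"
    using D small_encoding unfolding small_category_def by blast
  obtain ea :: "'j \<Rightarrow> 'u" where ea: "inj_on ea (Arr D)"
    using D small_encoding unfolding small_category_def by blast
  define doo where "doo = inv_into (Obj D) eo"
  define da where "da = inv_into (Arr D) ea"
  have doo [simp]: "doo (eo i) = i" if "i \<in> Obj D" for i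
    using eo that unfolding doo_def by simp
  have da [simp]: "da (ea d) = d" if "d \<in> Arr D" for d
    using ea that unfolding da_def by simp
  define D' :: "('u, 'u) cat" where "D' = \<lparr>Obj = eo ` Obj D, Arr = ea ` Arr D, Dom = (\<lambda>a. eo (Dom D (da a))),
    Cod = (\<lambda>a. eo (Cod D (da a))), Ident = (\<lambda>x. ea (Ident D (doo x))), Comp = (\<lambda>g f. ea (da g \<cdot>\<^bsub>D\<^esub> da f))\<rparr>"
  define X' where "X' = \<lparr>OMap = OMap X \<circ> doo, AMap = AMap X \<circ> da\<rparr>"
  have D'_sel [simp]: "Obj D' = eo ` Obj D" "Arr D' = ea ` Arr D" "Dom D' a = eo (Dom D (da a))"
    "Cod D' a = eo (Cod D (da a))" "Ident D' x = ea (Ident D (doo x))" "Comp D' g f = ea (da g \<cdot>\<^bsub>D\<^esub> da f)"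
    for a x g f
    by (auto simp: D'_def)
  have hom': "\<exists>i j d. x = eo i \<and> y = eo j \<and> f = ea d \<and> d \<in> hom D i j \<and> i \<in> Obj D \<and> j \<in> Obj D" if "f \<in> hom D' x y" for f x y
  proof -
    obtain d where "d \<in> Arr D" "f = ea d" "x = eo (Dom D d)" "y = eo (Cod D d)"
      using \<open>f \<in> hom D' x y\<close> by (auto simp: hom_def)
    then show ?thesis
      using X.A.Dom_Obj[of d] X.A.Cod_Obj[of d] Arr_hom[of d D] by auto
  qed
  have hom'I: "ea d \<in> hom D' (eo i) (eo j)" if "d \<in> hom D i j" for d i j
    using that by (auto simp: hom_def)
  have eo_eq: "eo i = eo j \<longleftrightarrow> i = j" if "i \<in> Obj D" "j \<in> Obj D" for i j
    using eo that by (auto dest: inj_onD)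
  have compD: "k \<cdot>\<^bsub>D\<^esub> d \<in> Arr D" if "d \<in> hom D i j" "k \<in> hom D j l" for d k i j l
    using X.A.Comp_hom[OF that] by (simp add: hom_def)
  have idD: "Ident D i \<in> Arr D" if "i \<in> Obj D" for i
    using X.A.Ident_hom[OF that] by (simp add: hom_def)
  have "category D'"
  proof
    fix f assume "f \<in> Arr D'"
    then show "Dom D' f \<in> Obj D'" "Cod D' f \<in> Obj D'"
      by (auto intro: X.A.Dom_Obj X.A.Cod_Obj)
  next
    fix x assume "x \<in> Obj D'"
    then show "Ident D' x \<in> hom D' x x"
      using X.A.Ident_hom hom'I by auto
  next
    fix f x y g z assume "f \<in> hom D' x y" "g \<in> hom D' y z"
    then obtain i j j' k d e where *: "x = eo i" "y = eo j" "f = ea d" "d \<in> hom D i j" "i \<in> Obj D" "j \<in> Obj D"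
      "eo j = eo j'" "z = eo k" "g = ea e" "e \<in> hom D j' k" "j' \<in> Obj D" "k \<in> Obj D"
      using hom' by metis
    then have "e \<in> hom D j k"
      using eo_eq by metis
    then show "g \<cdot>\<^bsub>D'\<^esub> f \<in> hom D' x z"
      using * hom'I[OF X.A.Comp_hom[OF *(4) \<open>e \<in> hom D j k\<close>]] homD(1)[OF *(4)] homD(1)[OF \<open>e \<in> hom D j k\<close>]
      by simp
  next
    fix f x y assume "f \<in> hom D' x y"
    then obtain i j d where *: "x = eo i" "y = eo j" "f = ea d" "d \<in> hom D i j" "i \<in> Obj D" "j \<in> Obj D"
      using hom' by metis
    then show "f \<cdot>\<^bsub>D'\<^esub> Ident D' x = f" "Ident D' y \<cdot>\<^bsub>D'\<^esub> f = f"
      using homD(1)[OF *(4)] idD by (auto simp: X.A.Comp_Ident X.A.Ident_Comp)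
  next
    fix f w x g y h z assume fgh: "f \<in> hom D' w x" "g \<in> hom D' x y" "h \<in> hom D' y z"
    obtain i j d where 1: "x = eo j" "f = ea d" "d \<in> hom D i j" "j \<in> Obj D"
      using hom'[OF fgh(1)] by blast
    obtain j' k e where 2: "x = eo j'" "y = eo k" "g = ea e" "e \<in> hom D j' k" "j' \<in> Obj D" "k \<in> Obj D"
      using hom'[OF fgh(2)] by blast
    obtain k' l m where 3: "y = eo k'" "h = ea m" "m \<in> hom D k' l" "k' \<in> Obj D"
      using hom'[OF fgh(3)] by blast
    note * = 1(2,3) 2(3) 3(2)
    have e: "e \<in> hom D j k" and m: "m \<in> hom D k l"
      using 1 2 3 eo_eq by metis+
    show "(h \<cdot>\<^bsub>D'\<^esub> g) \<cdot>\<^bsub>D'\<^esub> f = h \<cdot>\<^bsub>D'\<^esub> (g \<cdot>\<^bsub>D'\<^esub> f)"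
      using * homD(1)[OF *(2)] homD(1)[OF e] homD(1)[OF m] compD[OF *(2) e] compD[OF e m]
        X.A.Comp_assoc[OF *(2) e m] by simp
  qed
  then have D': "small_category \<U> D'"
    using D unfolding small_category_def by (simp add: small_image)
  have "is_functor D' C X'"
  proof (intro is_functor.intro is_functor_axioms.intro \<open>category D'\<close> category_axioms)
    fix x assume "x \<in> Obj D'"
    then show "OMap X' x \<in> Obj C"
      using X.OMap_Obj by (auto simp: X'_def)
  next
    fix f x y assume "f \<in> hom D' x y"
    then obtain i j d where "x = eo i" "y = eo j" "f = ea d" "d \<in> hom D i j" "i \<in> Obj D" "j \<in> Obj D"
      using hom' by metis
    then show "AMap X' f \<in> hom C (OMap X' x) (OMap X' y)"
      using X.AMap_hom homD(1)[of d D] by (auto simp: X'_def)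
  next
    fix x assume "x \<in> Obj D'"
    then show "AMap X' (Ident D' x) = Ident C (OMap X' x)"
      using idD X.AMap_Ident by (auto simp: X'_def)
  next
    fix f x y g z assume "f \<in> hom D' x y" "g \<in> hom D' y z"
    then obtain i j j' k d e where *: "x = eo i" "y = eo j" "f = ea d" "d \<in> hom D i j" "i \<in> Obj D" "j \<in> Obj D"
      "eo j = eo j'" "z = eo k" "g = ea e" "e \<in> hom D j' k" "j' \<in> Obj D" "k \<in> Obj D"
      using hom' by metis
    then have e: "e \<in> hom D j k"
      using eo_eq by metis
    show "AMap X' (g \<cdot>\<^bsub>D'\<^esub> f) = AMap X' g \<cdot> AMap X' f"
      using * compD[OF *(4) e] homD(1)[OF e] homD(1)[OF *(4)] X.AMap_Comp[OF *(4) e] by (simp add: X'_def)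
  qed
  then obtain c \<iota> where col: "is_colimit D' C X' c \<iota>"
    using bicomplete D' unfolding bicomplete_def by blast
  have cocone: "is_cocone D' C X' c' \<iota>' \<longleftrightarrow> is_cocone D C X c' (\<lambda>i. \<iota>' (eo i))" for c' \<iota>'
    using X.A.Dom_Obj X.A.Cod_Obj by (auto simp: is_cocone_def X'_def)
  have cocone2: "is_cocone D' C X' c' (\<lambda>x. \<iota>' (doo x)) \<longleftrightarrow> is_cocone D C X c' \<iota>'" for c' \<iota>'
    unfolding cocone using X.A.Dom_Obj X.A.Cod_Obj by (auto simp: is_cocone_def)
  have "is_colimit D C X c (\<lambda>i. \<iota> (eo i))"
    unfolding is_colimit_def
  proof (intro conjI allI impI)
    show "is_cocone D C X c (\<lambda>i. \<iota> (eo i))"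
      using col cocone unfolding is_colimit_def by blast
    fix c' \<iota>' assume "is_cocone D C X c' \<iota>'"
    then have "\<exists>!h. h \<in> hom C c c' \<and> (\<forall>x \<in> Obj D'. h \<cdot> \<iota> x = \<iota>' (doo x))"
      using col cocone2 unfolding is_colimit_def by blast
    then show "\<exists>!h. h \<in> hom C c c' \<and> (\<forall>i \<in> Obj D. h \<cdot> \<iota> (eo i) = \<iota>' i)"
      by simp
  qed
  then show ?thesis
    by blast
qed

text \<open>
  A presentation is a diagram whose shape is bipartite: one node for each generator, one for each
  relation, and two arrows out of each relation.  No two non-identity arrows of it compose.
\<close>

lemma ex_presents:
  fixes G :: "'g set"
  assumes P: "presentation C G R ob" and "small \<U> G" "small \<U> R"
  shows "\<exists>z x. presents C G R ob z x"
proof -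
  define nodes :: "('g + ('g \<times> 'a \<times> 'g \<times> 'a)) set" where "nodes = Inl ` G \<union> Inr ` R"
  define src where "src e = (case e of Inl v \<Rightarrow> v | Inr (r, b) \<Rightarrow> Inr r)"
    for e :: "('g + ('g \<times> 'a \<times> 'g \<times> 'a)) + ('g \<times> 'a \<times> 'g \<times> 'a) \<times> bool"
  define tgt :: "_ \<Rightarrow> 'g + ('g \<times> 'a \<times> 'g \<times> 'a)" where
    "tgt e = (case e of Inl v \<Rightarrow> v | Inr ((g, k, g', k'), b) \<Rightarrow> Inl (if b then g else g'))"
    for e :: "('g + ('g \<times> 'a \<times> 'g \<times> 'a)) + ('g \<times> 'a \<times> 'g \<times> 'a) \<times> bool"
  define D where "D = \<lparr>Obj = nodes, Arr = Inl ` nodes \<union> Inr ` (R \<times> UNIV), Dom = src, Cod = tgt,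
    Ident = Inl, Comp = (\<lambda>e d. case e of Inl _ \<Rightarrow> d | _ \<Rightarrow> e)\<rparr>"
  define obj where "obj v = (case v of Inl g \<Rightarrow> ob g | Inr (g, k, g', k') \<Rightarrow> Dom C k)"
    for v :: "'g + ('g \<times> 'a \<times> 'g \<times> 'a)"
  define X where "X = \<lparr>OMap = obj, AMap = (\<lambda>e :: ('g + ('g \<times> 'a \<times> 'g \<times> 'a)) + ('g \<times> 'a \<times> 'g \<times> 'a) \<times> bool.
    case e of Inl v \<Rightarrow> Ident C (obj v) | Inr ((g, k, g', k'), b) \<Rightarrow> if b then k else k')\<rparr>"
  have rel: "g \<in> G" "g' \<in> G" "k \<in> hom C (Dom C k) (ob g)" "k' \<in> hom C (Dom C k) (ob g')" "Dom C k \<in> Obj C"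
    if "(g, k, g', k') \<in> R" for g k g' k'
    using P that Dom_Obj unfolding presentation_def hom_def by fastforce+
  have gen: "ob g \<in> Obj C" if "g \<in> G" for g
    using P that unfolding presentation_def by blast
  have obj: "obj v \<in> Obj C" if "v \<in> nodes" for v
    using that gen rel(5) by (auto simp: nodes_def obj_def)
  have id_hom: "Inl v \<in> hom D v v" if "v \<in> nodes" for v
    using that by (simp add: hom_def D_def src_def tgt_def)
  have hom_cases: "(v = w \<and> e = Inl v \<and> v \<in> nodes) \<or> (\<exists>g k g' k' b. (g, k, g', k') \<in> R \<and> v = Inr (g, k, g', k') \<and>
      w = Inl (if b then g else g') \<and> e = Inr ((g, k, g', k'), b))" if "e \<in> hom D v w" for e v w
    using that by (auto simp: hom_def D_def src_def tgt_def split: sum.splits)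
  have D: "category D"
  proof
    fix f assume "f \<in> Arr D"
    then show "Dom D f \<in> Obj D" "Cod D f \<in> Obj D"
      using rel(1,2) by (auto simp: D_def src_def tgt_def nodes_def)
  next
    fix f x y g z assume "f \<in> hom D x y" "g \<in> hom D y z"
    then show "g \<cdot>\<^bsub>D\<^esub> f \<in> hom D x z"
      using hom_cases[of f x y] hom_cases[of g y z] by (auto simp: D_def)
  next
    fix f w x g y h z assume "f \<in> hom D w x" "g \<in> hom D x y" "h \<in> hom D y z"
    then show "(h \<cdot>\<^bsub>D\<^esub> g) \<cdot>\<^bsub>D\<^esub> f = h \<cdot>\<^bsub>D\<^esub> (g \<cdot>\<^bsub>D\<^esub> f)"
      using hom_cases[of f w x] hom_cases[of g x y] hom_cases[of h y z] by (auto simp: D_def)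
  next
    fix f x y assume "f \<in> hom D x y"
    then show "f \<cdot>\<^bsub>D\<^esub> Ident D x = f" "Ident D y \<cdot>\<^bsub>D\<^esub> f = f"
      using hom_cases[of f x y] by (auto simp: D_def)
  qed (use id_hom in \<open>auto simp: D_def\<close>)
  have "small \<U> nodes"
    unfolding nodes_def by (intro small_Un small_image assms)
  moreover have "small \<U> (R \<times> (UNIV :: bool set))"
    by (intro small_Sigma assms small_finite) simp
  ultimately have "small_category \<U> D"
    using D unfolding small_category_def by (simp add: D_def small_Un small_image)
  moreover have "is_functor D C X"
  proof (intro is_functor.intro is_functor_axioms.intro D category_axioms)
    fix x assume "x \<in> Obj D"
    then show "OMap X x \<in> Obj C" "AMap X (Ident D x) = Ident C (OMap X x)"
      using obj by (auto simp: X_def D_def)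
  next
    fix f x y assume "f \<in> hom D x y"
    then show "AMap X f \<in> hom C (OMap X x) (OMap X y)"
      using hom_cases[of f x y] obj[of x] Ident_hom rel(3,4) by (auto simp: X_def obj_def)
  next
    fix f x y g z assume "f \<in> hom D x y" "g \<in> hom D y z"
    then show "AMap X (g \<cdot>\<^bsub>D\<^esub> f) = AMap X g \<cdot> AMap X f"
      using hom_cases[of f x y] hom_cases[of g y z] Ident_Comp[OF Ident_hom[OF obj[of x]]]
        Ident_Comp[OF rel(3)] Ident_Comp[OF rel(4)] Comp_Ident[OF rel(3)] Comp_Ident[OF rel(4)]
      by (auto simp: X_def D_def) (auto simp: obj_def)
  qed
  ultimately obtain z \<iota> where col: "is_colimit D C X z \<iota>"
    using ex_small_colimit by blast
  have to_cocone: "is_cocone D C X z' (\<lambda>v. case v of Inl g \<Rightarrow> x' g | Inr (g, k, g', k') \<Rightarrow> x' g \<cdot> k)"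
    if "presentation_cocone C G R ob z' x'" for z' x'
    unfolding is_cocone_def
  proof (intro conjI ballI)
    have x': "x' g \<in> hom C (ob g) z'" if "g \<in> G" for g
      using that \<open>presentation_cocone C G R ob z' x'\<close> unfolding presentation_cocone_def by blast
    have x'_rel: "x' g \<cdot> k = x' g' \<cdot> k'" if "(g, k, g', k') \<in> R" for g k g' k'
      using that \<open>presentation_cocone C G R ob z' x'\<close> unfolding presentation_cocone_def by blast
    show "z' \<in> Obj C"
      using that unfolding presentation_cocone_def by blast
    let ?\<iota> = "\<lambda>v. case v of Inl g \<Rightarrow> x' g | Inr (g, k, g', k') \<Rightarrow> x' g \<cdot> k"
    show hom: "?\<iota> v \<in> hom C (OMap X v) z'" if "v \<in> Obj D" for v
      using that x' rel Comp_hom[OF rel(3) x'[OF rel(1)]] by (auto simp: D_def X_def nodes_def obj_def)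
    show "?\<iota> (Cod D d) \<cdot> AMap X d = ?\<iota> (Dom D d)" if "d \<in> Arr D" for d
    proof (cases d)
      case (Inl v)
      then have "v \<in> Obj D" "Dom D d = v" "Cod D d = v" "AMap X d = Ident C (OMap X v)"
        using that by (auto simp: D_def src_def tgt_def X_def)
      then show ?thesis
        using Comp_Ident[OF hom] by simp
    next
      case (Inr rb)
      obtain g k g' k' b where rb: "rb = ((g, k, g', k'), b)"
        by (metis surj_pair)
      then have "(g, k, g', k') \<in> R"
        using that Inr by (auto simp: D_def)
      then show ?thesis
        using x'_rel Inr rb by (auto simp: D_def src_def tgt_def X_def)
    qed
  qed
  have of_cocone: "\<iota>' (Inr (g, k, g', k')) = \<iota>' (Inl g) \<cdot> k" "\<iota>' (Inr (g, k, g', k')) = \<iota>' (Inl g') \<cdot> k'"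
    if "is_cocone D C X z' \<iota>'" "(g, k, g', k') \<in> R" for z' \<iota>' g k g' k'
  proof -
    have "Inr ((g, k, g', k'), b) \<in> Arr D" for b
      using that(2) by (simp add: D_def)
    then have "\<iota>' (Cod D (Inr ((g, k, g', k'), b))) \<cdot> AMap X (Inr ((g, k, g', k'), b)) = \<iota>' (Dom D (Inr ((g, k, g', k'), b)))" for b
      using that(1) unfolding is_cocone_def by blast
    from this[of True] this[of False] show "\<iota>' (Inr (g, k, g', k')) = \<iota>' (Inl g) \<cdot> k" "\<iota>' (Inr (g, k, g', k')) = \<iota>' (Inl g') \<cdot> k'"
      by (simp_all add: D_def src_def tgt_def X_def)
  qed
  have \<iota>: "is_cocone D C X z \<iota>"
    using col unfolding is_colimit_def by blast
  have \<iota>_hom: "\<iota> v \<in> hom C (obj v) z" if "v \<in> nodes" for v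
    using that \<iota> unfolding is_cocone_def by (simp add: D_def X_def)
  have "presents C G R ob z (\<lambda>g. \<iota> (Inl g))"
    unfolding presents_def
  proof (intro conjI allI impI)
    show "presentation_cocone C G R ob z (\<lambda>g. \<iota> (Inl g))"
      unfolding presentation_cocone_def
    proof (intro conjI ballI; clarify?)
      show "z \<in> Obj C"
        using \<iota> unfolding is_cocone_def by blast
      show "\<iota> (Inl g) \<in> hom C (ob g) z" if "g \<in> G" for g
        using \<iota>_hom[of "Inl g"] that by (simp add: nodes_def obj_def)
      show "\<iota> (Inl g) \<cdot> k = \<iota> (Inl g') \<cdot> k'" if "(g, k, g', k') \<in> R" for g k g' k'
        using of_cocone[OF \<iota> that] by metis
    qed
    fix z' x' assume "presentation_cocone C G R ob z' x'"
    from to_cocone[OF this] have "\<exists>!h. h \<in> hom C z z' \<and>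
        (\<forall>v \<in> nodes. h \<cdot> \<iota> v = (case v of Inl g \<Rightarrow> x' g | Inr (g, k, g', k') \<Rightarrow> x' g \<cdot> k))"
      using col unfolding is_colimit_def by (simp add: D_def)
    then obtain h where h: "h \<in> hom C z z'"
      "\<And>v. v \<in> nodes \<Longrightarrow> h \<cdot> \<iota> v = (case v of Inl g \<Rightarrow> x' g | Inr (g, k, g', k') \<Rightarrow> x' g \<cdot> k)"
      and uniq: "\<And>h'. h' \<in> hom C z z' \<Longrightarrow>
        (\<And>v. v \<in> nodes \<Longrightarrow> h' \<cdot> \<iota> v = (case v of Inl g \<Rightarrow> x' g | Inr (g, k, g', k') \<Rightarrow> x' g \<cdot> k)) \<Longrightarrow> h' = h"
      by (elim ex1E) blast
    show "\<exists>!h. h \<in> hom C z z' \<and> (\<forall>g \<in> G. h \<cdot> \<iota> (Inl g) = x' g)"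
    proof (rule ex1I[of _ h])
      show "h \<in> hom C z z' \<and> (\<forall>g \<in> G. h \<cdot> \<iota> (Inl g) = x' g)"
        using h by (auto simp: nodes_def)
      fix h' assume h': "h' \<in> hom C z z' \<and> (\<forall>g \<in> G. h' \<cdot> \<iota> (Inl g) = x' g)"
      show "h' = h"
      proof (rule uniq)
        fix v assume v: "v \<in> nodes"
        show "h' \<cdot> \<iota> v = (case v of Inl g \<Rightarrow> x' g | Inr (g, k, g', k') \<Rightarrow> x' g \<cdot> k)"
        proof (cases v)
          case (Inr r)
          obtain g k g' k' where r: "r = (g, k, g', k')"
            by (metis surj_pair)
          have R: "(g, k, g', k') \<in> R"
            using v Inr r by (auto simp: nodes_def)
          have "\<iota> (Inl g) \<in> hom C (ob g) z"
            using \<iota>_hom[of "Inl g"] rel(1)[OF R] by (simp add: nodes_def obj_def)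
          then have "(h' \<cdot> \<iota> (Inl g)) \<cdot> k = h' \<cdot> \<iota> v"
            using Comp_assoc[OF rel(3)[OF R] _ conjunct1[OF h']] of_cocone(1)[OF \<iota> R] Inr r by simp
          then show ?thesis
            using h' rel(1)[OF R] Inr r by simp
        qed (use v h' in \<open>auto simp: nodes_def\<close>)
      qed (use h' in blast)
    qed
  qed
  then show ?thesis
    by blast
qed

end


section \<open>Sequences of presented objects\<close>

context size_universe begin

text \<open>
  Being a limit is expressed within \<open>\<U>\<close>: successors and limits of an initial segment of \<open>\<U>\<close>, seen as an
  ordinal, are successors and limits of \<open>\<U>\<close>, so that one sequence indexed by elements of \<open>\<U>\<close> can be cut off at different lengths.
\<close>

definition limit :: "'u \<Rightarrow> bool" where
  "limit \<gamma> \<longleftrightarrow> underS \<U> \<gamma> \<noteq> {} \<and> (\<forall>\<delta> \<in> underS \<U> \<gamma>. \<exists>\<delta>' \<in> underS \<U> \<gamma>. \<delta> \<in> underS \<U> \<delta>')"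

lemma is_succ_Restr:
  assumes S: "initial_segment S"
    and succ: "is_succ (Restr \<U> S) \<beta> \<beta>'"
  shows "\<beta> \<in> S" "\<beta>' \<in> S" "underS \<U> \<beta>' = insert \<beta> (underS \<U> \<beta>)"
proof -
  have *: "\<beta> \<in> underS \<U> \<beta>'" "\<beta> \<in> S" "\<beta>' \<in> S"
    using succ by (auto simp: is_succ_def underS_def)
  have "\<gamma> \<in> insert \<beta> (underS \<U> \<beta>)" if "\<gamma> \<in> underS \<U> \<beta>'" for \<gamma>
  proof (rule ccontr)
    assume "\<gamma> \<notin> insert \<beta> (underS \<U> \<beta>)"
    then have "\<beta> \<in> underS \<U> \<gamma>"
      using underS_or_ge[of \<gamma> \<beta>] underS_FieldI[OF that] underS_FieldI[OF *(1)] by (auto simp: underS_def)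
    then show False
      using succ that underS_Restr[OF S] S * unfolding is_succ_def initial_segment_def by blast
  qed
  then show "\<beta> \<in> S" "\<beta>' \<in> S" "underS \<U> \<beta>' = insert \<beta> (underS \<U> \<beta>)"
    using * underS_trans by blast+
qed

lemma is_lim_Restr:
  assumes S: "initial_segment S"
    and lim: "is_lim (Restr \<U> S) \<gamma>"
  shows "\<gamma> \<in> S" "limit \<gamma>"
proof -
  show \<gamma>: "\<gamma> \<in> S"
    using lim Field_Restr[of S] S by (simp add: is_lim_def initial_segment_def)
  note under = underS_Restr[OF S]
  have "underS \<U> \<gamma> \<noteq> {}"
    using lim \<gamma> under unfolding is_lim_def is_zero_def by blast
  moreover have "\<exists>\<delta>' \<in> underS \<U> \<gamma>. \<delta> \<in> underS \<U> \<delta>'" if "\<delta> \<in> underS \<U> \<gamma>" for \<delta>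
  proof (rule ccontr)
    assume no: "\<not> (\<exists>\<delta>' \<in> underS \<U> \<gamma>. \<delta> \<in> underS \<U> \<delta>')"
    have "is_succ (Restr \<U> S) \<delta> \<gamma>"
      unfolding is_succ_def
    proof (intro conjI notI)
      show "\<delta> \<in> underS (Restr \<U> S) \<gamma>"
        using that under[OF \<gamma>] by auto
      assume "\<exists>\<delta>'. \<delta> \<in> underS (Restr \<U> S) \<delta>' \<and> \<delta>' \<in> underS (Restr \<U> S) \<gamma>"
      then show False
        using no by (auto simp: underS_def)
    qed
    then show False
      using lim unfolding is_lim_def by blast
  qed
  ultimately show "limit \<gamma>"
    unfolding limit_def by blast
qed

end

text \<open>
  A presentation that grows along the ordinals in \<open>S\<close>, continuously at limits.  The objects \<open>X \<beta>\<close> presented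
  by its parts then form a sequence, with the transition maps induced by inclusion of generators.
\<close>

locale filtered_presentation = size_universe \<U> + category C
  for \<U> :: "'u rel" and C :: "('o, 'a) cat" (structure) +
  fixes S :: "'u set" and G :: "'u \<Rightarrow> 'g set" and R :: "'u \<Rightarrow> ('g \<times> 'a \<times> 'g \<times> 'a) set"
    and ob :: "'g \<Rightarrow> 'o" and X :: "'u \<Rightarrow> 'o" and x :: "'u \<Rightarrow> 'g \<Rightarrow> 'a"
  assumes S_Field: "S \<subseteq> Field \<U>"
    and presentation: "\<beta> \<in> S \<Longrightarrow> presentation C (G \<beta>) (R \<beta>) ob"
    and presents: "\<beta> \<in> S \<Longrightarrow> presents C (G \<beta>) (R \<beta>) ob (X \<beta>) (x \<beta>)"
    and G_mono: "\<gamma> \<in> underS \<U> \<beta> \<Longrightarrow> G \<gamma> \<subseteq> G \<beta>"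
    and R_mono: "\<gamma> \<in> underS \<U> \<beta> \<Longrightarrow> R \<gamma> \<subseteq> R \<beta>"
    and G_continuous: "limit \<gamma> \<Longrightarrow> G \<gamma> \<subseteq> (\<Union>\<beta> \<in> underS \<U> \<gamma>. G \<beta>)"
    and R_continuous: "limit \<gamma> \<Longrightarrow> R \<gamma> \<subseteq> (\<Union>\<beta> \<in> underS \<U> \<gamma>. R \<beta>)"
begin

definition induced :: "'u \<Rightarrow> 'o \<Rightarrow> ('g \<Rightarrow> 'a) \<Rightarrow> 'a" where
  "induced \<beta> z y = (THE h. h \<in> hom C (X \<beta>) z \<and> (\<forall>g \<in> G \<beta>. h \<cdot> x \<beta> g = y g))"

definition sequence :: "('u, 'u \<times> 'u, 'o, 'a) func" where
  "sequence = \<lparr>OMap = X, AMap = (\<lambda>(\<gamma>, \<beta>). induced \<gamma> (X \<beta>) (x \<beta>))\<rparr>"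

lemma G_le: "(\<gamma>, \<beta>) \<in> \<U> \<Longrightarrow> G \<gamma> \<subseteq> G \<beta>" and R_le: "(\<gamma>, \<beta>) \<in> \<U> \<Longrightarrow> R \<gamma> \<subseteq> R \<beta>"
  using G_mono R_mono unfolding le_iff[of \<gamma>] by blast+

lemma induced:
  assumes "\<beta> \<in> S" "presentation_cocone C (G \<beta>) (R \<beta>) ob z y"
  shows "induced \<beta> z y \<in> hom C (X \<beta>) z" "g \<in> G \<beta> \<Longrightarrow> induced \<beta> z y \<cdot> x \<beta> g = y g"
proof -
  have "\<exists>!h. h \<in> hom C (X \<beta>) z \<and> (\<forall>g \<in> G \<beta>. h \<cdot> x \<beta> g = y g)"
    using presents[OF assms(1)] assms(2) unfolding presents_def by blast
  from theI'[OF this] show "induced \<beta> z y \<in> hom C (X \<beta>) z" "g \<in> G \<beta> \<Longrightarrow> induced \<beta> z y \<cdot> x \<beta> g = y g"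
    unfolding induced_def by blast+
qed

lemma eqI:
  assumes "\<beta> \<in> S" "h \<in> hom C (X \<beta>) z" "h' \<in> hom C (X \<beta>) z" "\<And>g. g \<in> G \<beta> \<Longrightarrow> h \<cdot> x \<beta> g = h' \<cdot> x \<beta> g"
  shows "h = h'"
  by (rule presents_eqI[OF presentation[OF assms(1)] presents[OF assms(1)] assms(2,3,4)])

lemma induced_eqI:
  assumes "\<beta> \<in> S" "presentation_cocone C (G \<beta>) (R \<beta>) ob z y"
    and "h \<in> hom C (X \<beta>) z" "\<And>g. g \<in> G \<beta> \<Longrightarrow> h \<cdot> x \<beta> g = y g"
  shows "induced \<beta> z y = h"
  by (rule eqI[OF assms(1) induced(1)[OF assms(1,2)] assms(3)]) (simp add: induced(2)[OF assms(1,2)] assms(4))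

lemma leg_hom: "\<beta> \<in> S \<Longrightarrow> g \<in> G \<beta> \<Longrightarrow> x \<beta> g \<in> hom C (ob g) (X \<beta>)"
  using presents_hom[OF presents] .

lemma cocone_subset:
  assumes "presentation_cocone C G' R' ob z y" "G \<beta> \<subseteq> G'" "R \<beta> \<subseteq> R'"
  shows "presentation_cocone C (G \<beta>) (R \<beta>) ob z y"
  using assms unfolding presentation_cocone_def by blast

lemma cocone_le:
  assumes "\<beta> \<in> S" "(\<gamma>, \<beta>) \<in> \<U>"
  shows "presentation_cocone C (G \<gamma>) (R \<gamma>) ob (X \<beta>) (x \<beta>)"
  by (rule cocone_subset[OF presents_cocone[OF presents[OF assms(1)]] G_le[OF assms(2)] R_le[OF assms(2)]])

lemma transition:
  assumes "\<gamma> \<in> S" "\<beta> \<in> S" "(\<gamma>, \<beta>) \<in> \<U>"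
  shows "induced \<gamma> (X \<beta>) (x \<beta>) \<in> hom C (X \<gamma>) (X \<beta>)"
    and "g \<in> G \<gamma> \<Longrightarrow> induced \<gamma> (X \<beta>) (x \<beta>) \<cdot> x \<gamma> g = x \<beta> g"
  using induced[OF assms(1) cocone_le[OF assms(2,3)]] by auto

lemma transition_refl: "\<beta> \<in> S \<Longrightarrow> induced \<beta> (X \<beta>) (x \<beta>) = Ident C (X \<beta>)"
  using induced_eqI[OF _ presents_cocone[OF presents]] Ident_hom[OF presents_Obj[OF presents]]
    Ident_Comp[OF leg_hom] by blast

lemma induced_transition:
  assumes \<gamma>\<beta>: "\<gamma> \<in> S" "\<beta> \<in> S" "(\<gamma>, \<beta>) \<in> \<U>" and y: "presentation_cocone C (G \<beta>) (R \<beta>) ob z y"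
  shows "induced \<beta> z y \<cdot> induced \<gamma> (X \<beta>) (x \<beta>) = induced \<gamma> z y"
proof (rule sym[OF induced_eqI[OF \<gamma>\<beta>(1)]])
  show "presentation_cocone C (G \<gamma>) (R \<gamma>) ob z y"
    by (rule cocone_subset[OF y G_le[OF \<gamma>\<beta>(3)] R_le[OF \<gamma>\<beta>(3)]])
  note h = transition(1)[OF \<gamma>\<beta>] and k = induced(1)[OF \<gamma>\<beta>(2) y]
  show "induced \<beta> z y \<cdot> induced \<gamma> (X \<beta>) (x \<beta>) \<in> hom C (X \<gamma>) z"
    by (rule Comp_hom[OF h k])
  fix g assume g: "g \<in> G \<gamma>"
  then have "g \<in> G \<beta>"
    using G_le[OF \<gamma>\<beta>(3)] by blast
  then show "(induced \<beta> z y \<cdot> induced \<gamma> (X \<beta>) (x \<beta>)) \<cdot> x \<gamma> g = y g"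
    using Comp_assoc[OF leg_hom[OF \<gamma>\<beta>(1) g] h k] transition(2)[OF \<gamma>\<beta> g] induced(2)[OF \<gamma>\<beta>(2) y] by simp
qed

lemma ord_cat_category:
  assumes "S' \<subseteq> Field \<U>"
  shows "category (ord_cat (Restr \<U> S'))"
  using Field_Restr[OF assms] le_refl[OF subsetD[OF assms]] le_trans
  by unfold_locales (auto simp: ord_cat_def hom_def)

lemma sequence_functor:
  assumes "S' \<subseteq> S"
  shows "is_functor (ord_cat (Restr \<U> S')) C sequence"
proof (intro is_functor.intro is_functor_axioms.intro category_axioms)
  have S': "S' \<subseteq> Field \<U>"
    using assms S_Field by blast
  show "category (ord_cat (Restr \<U> S'))"
    by (rule ord_cat_category[OF S'])
  show "OMap sequence \<beta> \<in> Obj C" "AMap sequence (Ident (ord_cat (Restr \<U> S')) \<beta>) = Ident C (OMap sequence \<beta>)"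
    if "\<beta> \<in> Obj (ord_cat (Restr \<U> S'))" for \<beta>
    using that assms Field_Restr[OF S'] presents_Obj[OF presents] transition_refl
    by (auto simp: ord_cat_def sequence_def)
  show "AMap sequence d \<in> hom C (OMap sequence \<gamma>) (OMap sequence \<beta>)"
    if "d \<in> hom (ord_cat (Restr \<U> S')) \<gamma> \<beta>" for d \<gamma> \<beta>
  proof -
    have "d = (\<gamma>, \<beta>)" "(\<gamma>, \<beta>) \<in> \<U>" "\<gamma> \<in> S" "\<beta> \<in> S"
      using that assms by (auto simp: ord_cat_def hom_def)
    then show ?thesis
      using transition(1) by (simp add: sequence_def)
  qed
  show "AMap sequence (e \<cdot>\<^bsub>ord_cat (Restr \<U> S')\<^esub> d) = AMap sequence e \<cdot> AMap sequence d"
    if "d \<in> hom (ord_cat (Restr \<U> S')) \<alpha> \<beta>" "e \<in> hom (ord_cat (Restr \<U> S')) \<beta> \<gamma>" for d e \<alpha> \<beta> \<gamma>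
  proof -
    have "d = (\<alpha>, \<beta>)" "e = (\<beta>, \<gamma>)" "(\<alpha>, \<beta>) \<in> \<U>" "(\<beta>, \<gamma>) \<in> \<U>" "\<alpha> \<in> S" "\<beta> \<in> S" "\<gamma> \<in> S"
      using that assms by (auto simp: ord_cat_def hom_def)
    then show ?thesis
      using induced_transition[of \<alpha> \<beta> "X \<gamma>" "x \<gamma>"] cocone_le[of \<gamma> \<beta>] by (auto simp: ord_cat_def sequence_def)
  qed
qed

text \<open>
  Colimits commute with colimits: as the presentations grow along a chain, the colimit of the objects
  they present is the object presented by their union.
\<close>

lemma sequence_colimit:
  assumes S': "S' \<subseteq> S" "S' \<noteq> {}"
    and Z: "presents C (\<Union>\<beta> \<in> S'. G \<beta>) (\<Union>\<beta> \<in> S'. R \<beta>) ob z y"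
  shows "is_colimit (ord_cat (Restr \<U> S')) C sequence z (\<lambda>\<beta>. induced \<beta> z y)"
proof -
  have Obj: "Obj (ord_cat (Restr \<U> S')) = S'"
    using Field_Restr[of S'] S' S_Field by (auto simp: ord_cat_def)
  have y\<beta>: "presentation_cocone C (G \<beta>) (R \<beta>) ob z y" if "\<beta> \<in> S'" for \<beta>
    using cocone_subset[OF presents_cocone[OF Z]] that by blast
  have union: "presentation C (\<Union>\<beta> \<in> S'. G \<beta>) (\<Union>\<beta> \<in> S'. R \<beta>) ob"
    using presentation S'(1) unfolding presentation_def by fast
  have "is_cocone (ord_cat (Restr \<U> S')) C sequence z (\<lambda>\<beta>. induced \<beta> z y)"
    unfolding is_cocone_def Obj
  proof (intro conjI ballI)
    show "z \<in> Obj C"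
      using presents_Obj[OF Z] .
    show "induced \<beta> z y \<in> hom C (OMap sequence \<beta>) z" if "\<beta> \<in> S'" for \<beta>
      using induced(1)[OF _ y\<beta>] that S' by (auto simp: sequence_def)
    fix d assume "d \<in> Arr (ord_cat (Restr \<U> S'))"
    then obtain \<gamma> \<beta> where "d = (\<gamma>, \<beta>)" "(\<gamma>, \<beta>) \<in> \<U>" "\<gamma> \<in> S'" "\<beta> \<in> S'"
      by (auto simp: ord_cat_def)
    then show "induced (Cod (ord_cat (Restr \<U> S')) d) z y \<cdot> AMap sequence d = induced (Dom (ord_cat (Restr \<U> S')) d) z y"
      using induced_transition[of \<gamma> \<beta> z y] y\<beta> S'(1) by (auto simp: ord_cat_def sequence_def)
  qed
  moreover have "\<exists>!h. h \<in> hom C z c \<and> (\<forall>\<beta> \<in> S'. h \<cdot> induced \<beta> z y = \<iota> \<beta>)"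
    if cocone: "is_cocone (ord_cat (Restr \<U> S')) C sequence c \<iota>" for c \<iota>
  proof -
    have c: "c \<in> Obj C"
      using cocone by (simp add: is_cocone_def)
    have \<iota>: "\<iota> \<beta> \<in> hom C (X \<beta>) c" if "\<beta> \<in> S'" for \<beta>
      using cocone that unfolding is_cocone_def Obj by (simp add: sequence_def)
    have \<iota>_trans: "\<iota> \<beta> \<cdot> induced \<gamma> (X \<beta>) (x \<beta>) = \<iota> \<gamma>" if "(\<gamma>, \<beta>) \<in> \<U>" "\<gamma> \<in> S'" "\<beta> \<in> S'" for \<gamma> \<beta>
    proof -
      have "(\<gamma>, \<beta>) \<in> Arr (ord_cat (Restr \<U> S'))"
        using that by (simp add: ord_cat_def)
      then have "\<iota> (Cod (ord_cat (Restr \<U> S')) (\<gamma>, \<beta>)) \<cdot> AMap sequence (\<gamma>, \<beta>) = \<iota> (Dom (ord_cat (Restr \<U> S')) (\<gamma>, \<beta>))"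
        using cocone unfolding is_cocone_def by blast
      then show ?thesis
        by (simp add: ord_cat_def sequence_def)
    qed
    have \<iota>_le: "\<iota> \<gamma> \<cdot> x \<gamma> g = \<iota> \<beta> \<cdot> x \<beta> g" if "(\<gamma>, \<beta>) \<in> \<U>" "\<gamma> \<in> S'" "\<beta> \<in> S'" "g \<in> G \<gamma>" for \<gamma> \<beta> g
    proof -
      have S: "\<gamma> \<in> S" "\<beta> \<in> S"
        using that S' by auto
      show ?thesis
        using Comp_assoc[OF leg_hom[OF S(1) that(4)] transition(1)[OF S that(1)] \<iota>[OF that(3)]]
          transition(2)[OF S that(1,4)] \<iota>_trans[OF that(1,2,3)] by simp
    qed
    have \<iota>_eq: "\<iota> \<gamma> \<cdot> x \<gamma> g = \<iota> \<beta> \<cdot> x \<beta> g" if "\<gamma> \<in> S'" "\<beta> \<in> S'" "g \<in> G \<gamma>" "g \<in> G \<beta>" for \<gamma> \<beta> g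
      using \<iota>_le[of \<gamma> \<beta>] \<iota>_le[of \<beta> \<gamma>] le_total[of \<gamma> \<beta>] that S' S_Field by (metis subsetD)
    \<comment> \<open>A generator occurs in many stages, and all of them give it the same image in \<open>c\<close>.\<close>
    define k where "k g = (let \<beta> = (SOME \<beta>. \<beta> \<in> S' \<and> g \<in> G \<beta>) in \<iota> \<beta> \<cdot> x \<beta> g)" for g
    have k: "k g = \<iota> \<beta> \<cdot> x \<beta> g" if "\<beta> \<in> S'" "g \<in> G \<beta>" for \<beta> g
      unfolding k_def Let_def
      using someI[of "\<lambda>\<beta>. \<beta> \<in> S' \<and> g \<in> G \<beta>" \<beta>] that \<iota>_eq by blast
    have k_cocone: "presentation_cocone C (\<Union>\<beta> \<in> S'. G \<beta>) (\<Union>\<beta> \<in> S'. R \<beta>) ob c k"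
      unfolding presentation_cocone_def
    proof (intro conjI c ballI; clarify?)
      show "k g \<in> hom C (ob g) c" if "\<beta> \<in> S'" "g \<in> G \<beta>" for g \<beta>
        using k[OF that] Comp_hom[OF leg_hom \<iota>] that S'(1) by auto
      fix g e g' e' \<beta> assume R: "\<beta> \<in> S'" "(g, e, g', e') \<in> R \<beta>"
      have \<beta>: "\<beta> \<in> S"
        using R S'(1) by blast
      have "presentation_cocone C (G \<beta>) (R \<beta>) ob c (\<lambda>g. \<iota> \<beta> \<cdot> x \<beta> g)"
        by (rule presentation_cocone_comp[OF presentation[OF \<beta>] presents_cocone[OF presents[OF \<beta>]] \<iota>[OF R(1)]])
      moreover have "g \<in> G \<beta>" "g' \<in> G \<beta>"
        using presentation[OF \<beta>] R(2) unfolding presentation_def by auto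
      ultimately show "k g \<cdot> e = k g' \<cdot> e'"
        using R k unfolding presentation_cocone_def by auto
    qed
    obtain h where h: "h \<in> hom C z c" "\<And>g. g \<in> (\<Union>\<beta> \<in> S'. G \<beta>) \<Longrightarrow> h \<cdot> y g = k g"
      using presents_ex[OF Z k_cocone] by blast
    have ind: "induced \<beta> z y \<in> hom C (X \<beta>) z" if "\<beta> \<in> S'" for \<beta>
      using induced(1)[OF _ y\<beta>] that S' by auto
    have comp: "(h' \<cdot> induced \<beta> z y) \<cdot> x \<beta> g = h' \<cdot> y g" if "h' \<in> hom C z c" "\<beta> \<in> S'" "g \<in> G \<beta>" for h' \<beta> g
      using Comp_assoc[OF leg_hom ind that(1)] induced(2)[OF _ y\<beta>] that(2,3) S'(1) by auto
    show ?thesis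
    proof (rule ex1I[of _ h]; (elim conjE)?)
      have "h \<cdot> induced \<beta> z y = \<iota> \<beta>" if \<beta>: "\<beta> \<in> S'" for \<beta>
      proof (rule eqI)
        show "\<beta> \<in> S"
          using \<beta> S' by blast
        show "h \<cdot> induced \<beta> z y \<in> hom C (X \<beta>) c" "\<iota> \<beta> \<in> hom C (X \<beta>) c"
          using Comp_hom[OF ind h(1)] \<iota> \<beta> by blast+
        show "(h \<cdot> induced \<beta> z y) \<cdot> x \<beta> g = \<iota> \<beta> \<cdot> x \<beta> g" if "g \<in> G \<beta>" for g
          using comp[OF h(1) \<beta> that] h(2)[of g] k[OF \<beta> that] that \<beta> by auto
      qed
      then show "h \<in> hom C z c \<and> (\<forall>\<beta> \<in> S'. h \<cdot> induced \<beta> z y = \<iota> \<beta>)"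
        using h(1) by blast
      fix h' assume h': "h' \<in> hom C z c" "\<forall>\<beta> \<in> S'. h' \<cdot> induced \<beta> z y = \<iota> \<beta>"
      show "h' = h"
      proof (rule presents_eqI[OF union Z h'(1) h(1)])
        fix g assume g: "g \<in> (\<Union>\<beta> \<in> S'. G \<beta>)"
        then obtain \<beta> where \<beta>: "\<beta> \<in> S'" "g \<in> G \<beta>"
          by blast
        then show "h' \<cdot> y g = h \<cdot> y g"
          using comp[OF h'(1) \<beta>] h'(2) k[OF \<beta>] h(2)[OF g] by simp
      qed
    qed
  qed
  ultimately show ?thesis
    unfolding is_colimit_def Obj by blast
qed

lemma sequence_limit:
  assumes "\<gamma> \<in> S" "underS \<U> \<gamma> \<subseteq> S" "limit \<gamma>"
  shows "is_colimit (ord_cat (Restr \<U> (underS \<U> \<gamma>))) C sequence (X \<gamma>) (\<lambda>\<beta>. induced \<beta> (X \<gamma>) (x \<gamma>))"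
proof (rule sequence_colimit)
  have "(\<Union>\<beta> \<in> underS \<U> \<gamma>. G \<beta>) = G \<gamma>" "(\<Union>\<beta> \<in> underS \<U> \<gamma>. R \<beta>) = R \<gamma>"
    using G_continuous[OF assms(3)] R_continuous[OF assms(3)] G_mono R_mono by blast+
  then show "presents C (\<Union>\<beta> \<in> underS \<U> \<gamma>. G \<beta>) (\<Union>\<beta> \<in> underS \<U> \<gamma>. R \<beta>) ob (X \<gamma>) (x \<gamma>)"
    using presents[OF assms(1)] by simp
  show "underS \<U> \<gamma> \<noteq> {}"
    using assms(3) unfolding limit_def by blast
qed (rule assms(2))

lemma sequence_ord_sequence:
  assumes S': "S' \<subseteq> S" "initial_segment S'"
  shows "ord_sequence C (Restr \<U> S') sequence"
  unfolding ord_sequence_def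
proof (intro conjI allI impI sequence_functor S'(1))
  fix \<gamma> assume "is_lim (Restr \<U> S') \<gamma>"
  then have \<gamma>: "\<gamma> \<in> S'" "limit \<gamma>"
    using is_lim_Restr[OF S'(2)] by blast+
  then have "underS \<U> \<gamma> \<subseteq> S'"
    using S'(2) unfolding initial_segment_def by blast
  then have "Restr (Restr \<U> S') (underS (Restr \<U> S') \<gamma>) = Restr \<U> (underS \<U> \<gamma>)"
    using underS_Restr[OF S'(2) \<gamma>(1)] by auto
  then show "is_colimit (ord_cat (Restr (Restr \<U> S') (underS (Restr \<U> S') \<gamma>))) C sequence (OMap sequence \<gamma>)
      (\<lambda>\<beta>. AMap sequence (\<beta>, \<gamma>))"
    using sequence_limit[OF _ _ \<gamma>(2)] \<gamma>(1) S'(1) \<open>underS \<U> \<gamma> \<subseteq> S'\<close> by (auto simp: sequence_def subset_eq)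
qed

end


section \<open>Wide pushouts as relative cell complexes\<close>

context bicomplete_category begin

text \<open>
  Attaching a small family of cells at once is attaching them one after the other along a
  well-ordering of the family: stage \<open>\<sigma>\<close> is presented by the base and the cells with index
  below \<open>\<sigma>\<close>.  The bottom stage has to be \<open>A\<close> itself with the identity as leg, since a transfinite
  composition starts at its bottom object.  The indices run up to and including \<open>\<tau>\<close>, so that the top
  stage has all cells.
\<close>

lemma wide_pushout_in_cell:
  assumes \<tau>: "\<tau> \<in> Field \<U>" and A: "A \<in> Obj C"
    and i: "\<And>\<rho>. \<rho> \<in> underS \<U> \<tau> \<Longrightarrow> i \<rho> \<in> K \<and> i \<rho> \<in> Arr C"
    and a: "\<And>\<rho>. \<rho> \<in> underS \<U> \<tau> \<Longrightarrow> a \<rho> \<in> hom C (Dom C (i \<rho>)) A"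
    and Z: "presents C (insert None (Some ` underS \<U> \<tau>)) ((\<lambda>\<rho>. (Some \<rho>, i \<rho>, None, a \<rho>)) ` underS \<U> \<tau>)
      (case_option A (\<lambda>\<rho>. Cod C (i \<rho>))) Z z"
  shows "z None \<in> cell \<U> C K"
proof -
  define S where "S = under \<U> \<tau>"
  define G where "G \<sigma> = insert None (Some ` underS \<U> \<sigma>)" for \<sigma>
  define R where "R \<sigma> = (\<lambda>\<rho>. (Some \<rho>, i \<rho>, None :: 'u option, a \<rho>)) ` underS \<U> \<sigma>" for \<sigma>
  define ob where "ob = case_option A (\<lambda>\<rho>. Cod C (i \<rho>))"
  have S: "initial_segment S" "S \<subseteq> Field \<U>" "\<tau> \<in> S"
    using initial_segment_under le_refl[OF \<tau>] unfolding S_def initial_segment_def by (auto simp: under_def)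
  have S_le: "\<rho> \<in> underS \<U> \<tau>" if "\<rho> \<in> underS \<U> \<sigma>" "\<sigma> \<in> S" for \<rho> \<sigma>
    using that underS_le_trans unfolding S_def under_def by blast
  have i_hom: "i \<rho> \<in> hom C (Dom C (i \<rho>)) (Cod C (i \<rho>))" if "\<rho> \<in> underS \<U> \<tau>" for \<rho>
    using i[OF that] by (simp add: hom_def)
  have pres: "presentation C (G \<sigma>) (R \<sigma>) ob" if "\<sigma> \<in> S" for \<sigma>
    unfolding presentation_def
  proof (intro conjI ballI; clarify?)
    show "ob g \<in> Obj C" if "g \<in> G \<sigma>" for g
      using that A i Cod_Obj S_le[OF _ \<open>\<sigma> \<in> S\<close>] by (auto simp: G_def ob_def)
    fix g k g' k' assume "(g, k, g', k') \<in> R \<sigma>"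
    then obtain \<rho> where \<rho>: "\<rho> \<in> underS \<U> \<sigma>" "g = Some \<rho>" "k = i \<rho>" "g' = None" "k' = a \<rho>"
      by (auto simp: R_def)
    then show "g \<in> G \<sigma> \<and> g' \<in> G \<sigma> \<and> k \<in> Arr C \<and> k' \<in> Arr C \<and> Dom C k = Dom C k' \<and> Cod C k = ob g \<and> Cod C k' = ob g'"
      using i[OF S_le[OF _ that]] a[OF S_le[OF _ that]] by (auto simp: G_def ob_def hom_def)
  qed
  have "\<exists>p. presents C (G \<sigma>) (R \<sigma>) ob (fst p) (snd p) \<and> (underS \<U> \<sigma> = {} \<longrightarrow> fst p = A \<and> snd p None = Ident C A)"
    if \<sigma>: "\<sigma> \<in> S" for \<sigma>
  proof (cases "underS \<U> \<sigma> = {}")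
    case True
    have "presents C (G \<sigma>) (R \<sigma>) ob A (\<lambda>_. Ident C A)"
      unfolding presents_def
    proof (intro conjI allI impI)
      show "presentation_cocone C (G \<sigma>) (R \<sigma>) ob A (\<lambda>_. Ident C A)"
        using True A Ident_hom by (simp add: presentation_cocone_def G_def R_def ob_def)
      fix z' x' assume "presentation_cocone C (G \<sigma>) (R \<sigma>) ob z' x'"
      then have "x' None \<in> hom C A z'"
        by (simp add: presentation_cocone_def G_def ob_def)
      then show "\<exists>!h. h \<in> hom C A z' \<and> (\<forall>g \<in> G \<sigma>. h \<cdot> Ident C A = x' g)"
        using Comp_Ident True by (auto simp: G_def)
    qed
    then show ?thesis
      by (intro exI[of _ "(A, \<lambda>_. Ident C A)"]) simp
  next
    case False
    have "small \<U> (G \<sigma>)" "small \<U> (R \<sigma>)"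
      unfolding G_def R_def by (intro small_insert small_image small_underS)+
    then obtain x where "presents C (G \<sigma>) (R \<sigma>) ob (fst x) (snd x)"
      using ex_presents[OF pres[OF \<sigma>]] by auto
    then show ?thesis
      using False by blast
  qed
  then obtain p where p: "\<And>\<sigma>. \<sigma> \<in> S \<Longrightarrow> presents C (G \<sigma>) (R \<sigma>) ob (fst (p \<sigma>)) (snd (p \<sigma>))"
    "\<And>\<sigma>. \<sigma> \<in> S \<Longrightarrow> underS \<U> \<sigma> = {} \<Longrightarrow> fst (p \<sigma>) = A \<and> snd (p \<sigma>) None = Ident C A"
    by metis
  define X where "X \<sigma> = fst (p \<sigma>)" for \<sigma>
  define x where "x \<sigma> = snd (p \<sigma>)" for \<sigma>
  interpret filtered_presentation \<U> C S G R ob X x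
  proof unfold_locales
    show "S \<subseteq> Field \<U>" "\<beta> \<in> S \<Longrightarrow> presentation C (G \<beta>) (R \<beta>) ob"
      "\<beta> \<in> S \<Longrightarrow> presents C (G \<beta>) (R \<beta>) ob (X \<beta>) (x \<beta>)" for \<beta>
      using S pres p by (auto simp: X_def x_def)
    show "\<gamma> \<in> underS \<U> \<beta> \<Longrightarrow> G \<gamma> \<subseteq> G \<beta>" "\<gamma> \<in> underS \<U> \<beta> \<Longrightarrow> R \<gamma> \<subseteq> R \<beta>" for \<gamma> \<beta>
      using underS_trans unfolding G_def R_def by blast+
    show "limit \<gamma> \<Longrightarrow> G \<gamma> \<subseteq> (\<Union>\<beta> \<in> underS \<U> \<gamma>. G \<beta>)" "limit \<gamma> \<Longrightarrow> R \<gamma> \<subseteq> (\<Union>\<beta> \<in> underS \<U> \<gamma>. R \<beta>)" for \<gamma>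
      unfolding limit_def G_def R_def by blast+
  qed
  define r where "r = Restr \<U> S"
  obtain \<zeta> where \<zeta>: "\<zeta> \<in> Field \<U>" "\<forall>\<beta> \<in> Field \<U>. (\<zeta>, \<beta>) \<in> \<U>"
    using ex_zero by blast
  then have \<zeta>S: "\<zeta> \<in> S"
    using \<tau> by (simp add: S_def under_def)
  have \<zeta>_min: "underS \<U> \<zeta> = {}"
    using \<zeta> le_antisym unfolding underS_def by (blast intro: FieldI1)
  have "small \<U> S"
    unfolding S_def under_def
    by (rule small_mono[OF small_insert[OF small_underS[of \<tau>], of \<tau>]]) (use le_iff in auto)
  then have "ordinal \<U> r"
    unfolding r_def by (intro ordinal_Restr S)
  moreover have "ord_sequence C r sequence"
    unfolding r_def by (intro sequence_ord_sequence subset_refl S(1))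
  moreover have "is_zero r \<zeta>"
    using \<zeta>S \<zeta>_min underS_Restr[OF S(1) \<zeta>S] Field_Restr[OF S(2)] by (simp add: is_zero_def r_def)
  moreover have Z': "presents C (G \<tau>) (R \<tau>) ob Z z"
    using Z by (simp add: G_def R_def ob_def)
  have "is_colimit (ord_cat r) C sequence Z (\<lambda>\<beta>. induced \<beta> Z z)"
    unfolding r_def
  proof (rule sequence_colimit)
    have "(\<Union>\<beta> \<in> S. G \<beta>) = G \<tau>" "(\<Union>\<beta> \<in> S. R \<beta>) = R \<tau>"
      using S(3) G_le[of _ \<tau>] R_le[of _ \<tau>] unfolding S_def under_def by blast+
    then show "presents C (\<Union>\<beta> \<in> S. G \<beta>) (\<Union>\<beta> \<in> S. R \<beta>) ob Z z"
      using Z' by simp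
  qed (use S in auto)
  moreover have "sequence_steps_in r sequence (pushouts_of C K)"
    unfolding sequence_steps_in_def
  proof (intro allI impI)
    fix \<sigma> \<sigma>' assume "is_succ r \<sigma> \<sigma>'"
    then have \<sigma>: "\<sigma> \<in> S" "\<sigma>' \<in> S" "underS \<U> \<sigma>' = insert \<sigma> (underS \<U> \<sigma>)"
      using is_succ_Restr[OF S(1)] unfolding r_def by blast+
    then have le: "\<sigma> \<in> underS \<U> \<sigma>'" "(\<sigma>, \<sigma>') \<in> \<U>"
      by (auto simp: underS_def)
    have \<sigma>\<tau>: "\<sigma> \<in> underS \<U> \<tau>"
      using S_le[OF le(1) \<sigma>(2)] .
    have G\<sigma>: "None \<in> G \<sigma>" "G \<sigma>' = insert (Some \<sigma>) (G \<sigma>)" "R \<sigma>' = insert (Some \<sigma>, i \<sigma>, None, a \<sigma>) (R \<sigma>)"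
      by (auto simp: G_def R_def \<sigma>(3))
    define g where "g = induced \<sigma> (X \<sigma>') (x \<sigma>')"
    note g = transition[OF \<sigma>(1,2) le(2), folded g_def]
    have x0: "x \<sigma> None \<in> hom C A (X \<sigma>)"
      using leg_hom[OF \<sigma>(1) G\<sigma>(1)] by (simp add: ob_def)
    have v: "x \<sigma>' (Some \<sigma>) \<in> hom C (Cod C (i \<sigma>)) (X \<sigma>')"
      using leg_hom[OF \<sigma>(2), of "Some \<sigma>"] G\<sigma>(2) by (simp add: ob_def)
    note a\<sigma> = a[OF \<sigma>\<tau>]
    have "is_pushout C (i \<sigma>) (x \<sigma> None \<cdot> a \<sigma>) g (x \<sigma>' (Some \<sigma>))"
      unfolding is_pushout_def homD(2)[OF g(1)] homD(3)[OF g(1)]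
    proof (intro conjI allI ballI impI)
      show "i \<sigma> \<in> Arr C" "x \<sigma> None \<cdot> a \<sigma> \<in> hom C (Dom C (i \<sigma>)) (X \<sigma>)" "g \<in> Arr C"
        "x \<sigma>' (Some \<sigma>) \<in> hom C (Cod C (i \<sigma>)) (X \<sigma>')"
        using i[OF \<sigma>\<tau>] Comp_hom[OF a\<sigma> x0] homD(1)[OF g(1)] v by blast+
      have "x \<sigma>' (Some \<sigma>) \<cdot> i \<sigma> = x \<sigma>' None \<cdot> a \<sigma>"
        using presents_rel[OF presents[OF \<sigma>(2)]] G\<sigma>(3) by blast
      then show "g \<cdot> x \<sigma> None \<cdot> a \<sigma> = x \<sigma>' (Some \<sigma>) \<cdot> i \<sigma>"
        using Comp_assoc[OF a\<sigma> x0 g(1)] g(2)[OF G\<sigma>(1)] by simp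
      fix z' s t assume s: "s \<in> hom C (X \<sigma>) z'" and t: "t \<in> hom C (Cod C (i \<sigma>)) z'"
        and st: "s \<cdot> x \<sigma> None \<cdot> a \<sigma> = t \<cdot> i \<sigma>"
      define y where "y = (\<lambda>g. s \<cdot> x \<sigma> g) (Some \<sigma> := t)"
      have Some_notin: "Some \<sigma> \<notin> G \<sigma>"
        by (auto simp: G_def underS_def)
      have "presentation_cocone C (G \<sigma>) (R \<sigma>) ob z' (\<lambda>g. s \<cdot> x \<sigma> g)"
        by (rule presentation_cocone_comp[OF presentation[OF \<sigma>(1)] presents_cocone[OF presents[OF \<sigma>(1)]] s])
      moreover have "(Some \<sigma>, k, g', k') \<notin> R \<sigma>" for k g' k'
        by (auto simp: R_def underS_def)
      moreover have "(g', k', Some \<sigma>, k) \<notin> R \<sigma>" for k g' k'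
        by (auto simp: R_def)
      ultimately have "presentation_cocone C (G \<sigma>') (R \<sigma>') ob z' y"
        using t st Comp_assoc[OF a\<sigma> x0 s] unfolding presentation_cocone_def G\<sigma>(2,3) y_def ob_def by fastforce
      then obtain h where h: "h \<in> hom C (X \<sigma>') z'" "\<And>g. g \<in> G \<sigma>' \<Longrightarrow> h \<cdot> x \<sigma>' g = y g"
        using presents_ex[OF presents[OF \<sigma>(2)]] by blast
      have comp: "(h' \<cdot> g) \<cdot> x \<sigma> k = h' \<cdot> x \<sigma>' k" if "h' \<in> hom C (X \<sigma>') z'" "k \<in> G \<sigma>" for h' k
        using Comp_assoc[OF leg_hom[OF \<sigma>(1) that(2)] g(1) that(1)] g(2)[OF that(2)] by simp
      show "\<exists>!h. h \<in> hom C (X \<sigma>') z' \<and> h \<cdot> g = s \<and> h \<cdot> x \<sigma>' (Some \<sigma>) = t"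
      proof (rule ex1I[of _ h]; (elim conjE)?)
        have "h \<cdot> g = s"
        proof (rule eqI[OF \<sigma>(1) Comp_hom[OF g(1) h(1)] s])
          fix k assume "k \<in> G \<sigma>"
          then show "(h \<cdot> g) \<cdot> x \<sigma> k = s \<cdot> x \<sigma> k"
            using comp[OF h(1)] h(2)[of k] Some_notin G\<sigma>(2) by (auto simp: y_def)
        qed
        then show "h \<in> hom C (X \<sigma>') z' \<and> h \<cdot> g = s \<and> h \<cdot> x \<sigma>' (Some \<sigma>) = t"
          using h(1) h(2)[of "Some \<sigma>"] G\<sigma>(2) by (simp add: y_def)
        fix h' assume h': "h' \<in> hom C (X \<sigma>') z'" "h' \<cdot> g = s" "h' \<cdot> x \<sigma>' (Some \<sigma>) = t"
        show "h' = h"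
        proof (rule eqI[OF \<sigma>(2) h'(1) h(1)])
          fix k assume k: "k \<in> G \<sigma>'"
          show "h' \<cdot> x \<sigma>' k = h \<cdot> x \<sigma>' k"
            using comp[OF h'(1), of k] h(2)[OF k] k h'(2,3) G\<sigma>(2) by (auto simp: y_def)
        qed
      qed
    qed
    then show "AMap sequence (\<sigma>, \<sigma>') \<in> pushouts_of C K"
      using i[OF \<sigma>\<tau>] unfolding pushouts_of_def g_def sequence_def by auto
  qed
  ultimately have "induced \<zeta> Z z \<in> cell \<U> C K"
    unfolding cell_def transfinite_compositions_def
    by (intro CollectI exI[of _ r] exI[of _ sequence] exI[of _ Z] exI[of _ "\<lambda>\<beta>. induced \<beta> Z z"] exI[of _ \<zeta>]) simp
  moreover have "induced \<zeta> Z z = z None"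
  proof -
    have "presentation_cocone C (G \<zeta>) (R \<zeta>) ob Z z"
      using cocone_subset[OF presents_cocone[OF Z'] G_le R_le] \<zeta> \<tau> by blast
    note ind = induced[OF \<zeta>S this]
    have "X \<zeta> = A" "x \<zeta> None = Ident C A"
      using p(2)[OF \<zeta>S \<zeta>_min] by (auto simp: X_def x_def)
    then show ?thesis
      using ind(2)[of None] Comp_Ident[of _ A Z] ind(1) by (simp add: G_def)
  qed
  ultimately show ?thesis
    by simp
qed

end


section \<open>The tower of cell attachments\<close>

definition LLP :: "('o, 'a) cat \<Rightarrow> 'a set \<Rightarrow> 'a set" where
  "LLP C K = {i \<in> Arr C. \<forall>p \<in> K. has_lift C i p}"

text \<open>
  The generators of the stages of a tower over a map \<open>f : A \<rightarrow> B\<close>: the object \<open>A\<close>, the earlier stages, and, for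
  each square \<open>(i, a, b)\<close> from \<open>i \<in> K\<close> to the projection of an earlier stage \<open>\<gamma>\<close>, a copy of the codomain of \<open>i\<close>.
\<close>

datatype ('u, 'a) generator = Base | Stage 'u | Cell 'u 'a 'a 'a

text \<open>
  A stage of the tower over \<open>f : A \<rightarrow> B\<close> is an object \<open>Z\<close>, the legs of the generators into \<open>Z\<close>, and a
  projection \<open>Z \<rightarrow> B\<close>.
\<close>

type_synonym ('u, 'o, 'a) tower = "'u \<Rightarrow> 'o \<times> (('u, 'a) generator \<Rightarrow> 'a) \<times> 'a"

definition obj :: "('u, 'o, 'a) tower \<Rightarrow> 'u \<Rightarrow> 'o" where
  "obj st \<beta> = fst (st \<beta>)"

definition leg :: "('u, 'o, 'a) tower \<Rightarrow> 'u \<Rightarrow> ('u, 'a) generator \<Rightarrow> 'a" where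
  "leg st \<beta> = fst (snd (st \<beta>))"

definition prj :: "('u, 'o, 'a) tower \<Rightarrow> 'u \<Rightarrow> 'a" where
  "prj st \<beta> = snd (snd (st \<beta>))"

locale cellular_category = bicomplete_category \<U> C
  for \<U> :: "'u rel" and C :: "('o, 'a) cat" (structure) +
  fixes K :: "'a set"
  assumes K_Arr: "K \<subseteq> Arr C" and K_small: "small \<U> K"
begin

definition squares :: "'a \<Rightarrow> ('u, 'o, 'a) tower \<Rightarrow> 'u \<Rightarrow> ('a \<times> 'a \<times> 'a) set" where
  "squares f st \<gamma> = {(i, a, b). i \<in> K \<and> a \<in> hom C (Dom C i) (obj st \<gamma>) \<and> b \<in> hom C (Cod C i) (Cod C f) \<and>
     prj st \<gamma> \<cdot> a = b \<cdot> i}"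

text \<open>
  The generators and relations of stage \<open>\<beta>\<close>, and the objects and labels of these generators, refer to \<open>st\<close>
  at ordinals less than \<open>\<beta>\<close> only.  They make sense for a partially constructed tower, and so the
  predicate \<open>is_stage\<close> is a recursion for \<open>st \<beta>\<close> (\<open>is_stage_cong\<close>).
\<close>

definition gens :: "'a \<Rightarrow> ('u, 'o, 'a) tower \<Rightarrow> 'u \<Rightarrow> ('u, 'a) generator set" where
  "gens f st \<beta> = insert Base (Stage ` underS \<U> \<beta> \<union>
     {Cell \<gamma> i a b | \<gamma> i a b. \<gamma> \<in> underS \<U> \<beta> \<and> (i, a, b) \<in> squares f st \<gamma>})"

definition rels :: "'a \<Rightarrow> ('u, 'o, 'a) tower \<Rightarrow> 'u \<Rightarrow>
    (('u, 'a) generator \<times> 'a \<times> ('u, 'a) generator \<times> 'a) set" where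
  "rels f st \<beta> =
     {(Stage \<gamma>, leg st \<gamma> g, g, Ident C (Dom C (leg st \<gamma> g))) | \<gamma> g. \<gamma> \<in> underS \<U> \<beta> \<and> g \<in> gens f st \<gamma>} \<union>
     {(Cell \<gamma> i a b, i, Stage \<gamma>, a) | \<gamma> i a b. \<gamma> \<in> underS \<U> \<beta> \<and> (i, a, b) \<in> squares f st \<gamma>}"

fun gen_obj :: "'a \<Rightarrow> ('u, 'o, 'a) tower \<Rightarrow> ('u, 'a) generator \<Rightarrow> 'o" where
  "gen_obj f st Base = Dom C f"
| "gen_obj f st (Stage \<gamma>) = obj st \<gamma>"
| "gen_obj f st (Cell \<gamma> i a b) = Cod C i"

text \<open>
  The projection of a stage to \<open>B\<close> is the map induced by the labels of its generators.
\<close>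

fun label :: "'a \<Rightarrow> ('u, 'o, 'a) tower \<Rightarrow> ('u, 'a) generator \<Rightarrow> 'a" where
  "label f st Base = f"
| "label f st (Stage \<gamma>) = prj st \<gamma>"
| "label f st (Cell \<gamma> i a b) = b"

definition is_stage :: "'a \<Rightarrow> ('u, 'o, 'a) tower \<Rightarrow> 'u \<Rightarrow> 'o \<times> (('u, 'a) generator \<Rightarrow> 'a) \<times> 'a \<Rightarrow> bool" where
  "is_stage f st \<beta> s \<longleftrightarrow> presents C (gens f st \<beta>) (rels f st \<beta>) (gen_obj f st) (fst s) (fst (snd s)) \<and>
     snd (snd s) \<in> hom C (fst s) (Cod C f) \<and> (\<forall>g \<in> gens f st \<beta>. snd (snd s) \<cdot> fst (snd s) g = label f st g)"

definition tower :: "'a \<Rightarrow> ('u, 'o, 'a) tower \<Rightarrow> bool" where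
  "tower f st \<longleftrightarrow> (\<forall>\<beta>. is_stage f st \<beta> (st \<beta>))"

lemma gens_simps [simp]:
  "Base \<in> gens f st \<beta>"
  "Stage \<gamma> \<in> gens f st \<beta> \<longleftrightarrow> \<gamma> \<in> underS \<U> \<beta>"
  "Cell \<gamma> i a b \<in> gens f st \<beta> \<longleftrightarrow> \<gamma> \<in> underS \<U> \<beta> \<and> (i, a, b) \<in> squares f st \<gamma>"
  by (auto simp: gens_def)

lemma gens_cases:
  assumes "g \<in> gens f st \<beta>"
  obtains "g = Base" | \<gamma> where "g = Stage \<gamma>" "\<gamma> \<in> underS \<U> \<beta>"
  | \<gamma> i a b where "g = Cell \<gamma> i a b" "\<gamma> \<in> underS \<U> \<beta>" "(i, a, b) \<in> squares f st \<gamma>"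
  using assms by (auto simp: gens_def)

lemma gens_mono: "\<gamma> \<in> underS \<U> \<beta> \<Longrightarrow> gens f st \<gamma> \<subseteq> gens f st \<beta>"
  unfolding gens_def using underS_trans by blast

lemma rels_mono: "\<gamma> \<in> underS \<U> \<beta> \<Longrightarrow> rels f st \<gamma> \<subseteq> rels f st \<beta>"
  unfolding rels_def using underS_trans by blast

lemma squares_cong: "st \<gamma> = st' \<gamma> \<Longrightarrow> squares f st \<gamma> = squares f st' \<gamma>"
  by (simp add: squares_def obj_def prj_def)

lemma gens_cong:
  assumes "\<And>\<gamma>. \<gamma> \<in> underS \<U> \<beta> \<Longrightarrow> st \<gamma> = st' \<gamma>"
  shows "gens f st \<beta> = gens f st' \<beta>"
proof -
  have "squares f st \<gamma> = squares f st' \<gamma>" if "\<gamma> \<in> underS \<U> \<beta>" for \<gamma>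
    by (rule squares_cong[of st \<gamma> st', OF assms[OF that]])
  then show ?thesis
    by (auto simp: gens_def)
qed

lemma is_stage_cong:
  assumes eq: "\<And>\<gamma>. \<gamma> \<in> underS \<U> \<beta> \<Longrightarrow> st \<gamma> = st' \<gamma>"
  shows "is_stage f st \<beta> s = is_stage f st' \<beta> s"
proof -
  have gens: "gens f st \<gamma> = gens f st' \<gamma>" if "\<gamma> = \<beta> \<or> \<gamma> \<in> underS \<U> \<beta>" for \<gamma>
    using that eq underS_trans by (intro gens_cong) blast
  have "squares f st \<gamma> = squares f st' \<gamma>" "leg st \<gamma> = leg st' \<gamma>" "gens f st \<gamma> = gens f st' \<gamma>"
    if "\<gamma> \<in> underS \<U> \<beta>" for \<gamma>
    using squares_cong[of st \<gamma> st', OF eq[OF that]] eq[OF that] gens[of \<gamma>] that by (auto simp: leg_def)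
  then have "rels f st \<beta> = rels f st' \<beta>"
    unfolding rels_def by (intro arg_cong2[where f = "(\<union>)"] Collect_cong) metis+
  moreover have "gen_obj f st g = gen_obj f st' g" "label f st g = label f st' g" if "g \<in> gens f st \<beta>" for g
    using that eq by (auto elim!: gens_cases simp: obj_def prj_def)
  ultimately show ?thesis
    using gens[of \<beta>] unfolding is_stage_def presents_def presentation_cocone_def
    by (simp cong: ball_cong)
qed

lemma squares_hom:
  assumes "(i, a, b) \<in> squares f st \<gamma>"
  shows "i \<in> hom C (Dom C i) (Cod C i)" "a \<in> hom C (Dom C i) (obj st \<gamma>)" "b \<in> hom C (Cod C i) (Cod C f)"
    "prj st \<gamma> \<cdot> a = b \<cdot> i" "i \<in> K"
  using assms K_Arr by (auto simp: squares_def intro: Arr_hom)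

lemma small_squares: "small \<U> (squares f st \<gamma>)"
proof (rule small_mono)
  show "small \<U> (SIGMA i : K. hom C (Dom C i) (obj st \<gamma>) \<times> hom C (Cod C i) (Cod C f))"
    by (intro small_Sigma K_small small_hom)
qed (auto simp: squares_def)

lemma small_gens: "small \<U> (gens f st \<beta>)"
proof (rule small_mono)
  show "small \<U> (insert Base (Stage ` underS \<U> \<beta> \<union>
      (\<lambda>(\<gamma>, i, a, b). Cell \<gamma> i a b) ` (SIGMA \<gamma> : underS \<U> \<beta>. squares f st \<gamma>)))"
    by (intro small_insert small_Un small_image small_Sigma small_underS small_squares)
qed (force simp: gens_def)

lemma small_rels: "small \<U> (rels f st \<beta>)"
proof (rule small_mono)
  show "small \<U> ((\<lambda>(\<gamma>, g). (Stage \<gamma>, leg st \<gamma> g, g, Ident C (Dom C (leg st \<gamma> g)))) ` (SIGMA \<gamma> : underS \<U> \<beta>. gens f st \<gamma>) \<union>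
      (\<lambda>(\<gamma>, i, a, b). (Cell \<gamma> i a b, i, Stage \<gamma>, a)) ` (SIGMA \<gamma> : underS \<U> \<beta>. squares f st \<gamma>))"
    by (intro small_Un small_image small_Sigma small_underS small_squares small_gens)
qed (force simp: rels_def)

lemma is_stageD:
  assumes "is_stage f st \<beta> (st \<beta>)"
  shows "presents C (gens f st \<beta>) (rels f st \<beta>) (gen_obj f st) (obj st \<beta>) (leg st \<beta>)"
    and "obj st \<beta> \<in> Obj C" and "prj st \<beta> \<in> hom C (obj st \<beta>) (Cod C f)"
    and "g \<in> gens f st \<beta> \<Longrightarrow> leg st \<beta> g \<in> hom C (gen_obj f st g) (obj st \<beta>)"
    and "g \<in> gens f st \<beta> \<Longrightarrow> prj st \<beta> \<cdot> leg st \<beta> g = label f st g"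
proof -
  show 1: "presents C (gens f st \<beta>) (rels f st \<beta>) (gen_obj f st) (obj st \<beta>) (leg st \<beta>)"
    "prj st \<beta> \<in> hom C (obj st \<beta>) (Cod C f)" "g \<in> gens f st \<beta> \<Longrightarrow> prj st \<beta> \<cdot> leg st \<beta> g = label f st g"
    using assms by (auto simp: is_stage_def obj_def leg_def prj_def)
  show "obj st \<beta> \<in> Obj C" "g \<in> gens f st \<beta> \<Longrightarrow> leg st \<beta> g \<in> hom C (gen_obj f st g) (obj st \<beta>)"
    using presents_Obj[OF 1(1)] presents_hom[OF 1(1)] by blast+
qed

lemma stage_presentation:
  assumes f: "f \<in> Arr C" and below: "\<And>\<gamma>. \<gamma> \<in> underS \<U> \<beta> \<Longrightarrow> is_stage f st \<gamma> (st \<gamma>)"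
  shows "presentation C (gens f st \<beta>) (rels f st \<beta>) (gen_obj f st)"
  unfolding presentation_def
proof (intro conjI ballI; clarify?)
  have gen_obj: "gen_obj f st g \<in> Obj C" if "g \<in> gens f st \<beta>" for g
    using that is_stageD(2)[OF below] hom_Obj(2)[OF squares_hom(1)] Dom_Obj[OF f] by (cases g) auto
  then show "gen_obj f st g \<in> Obj C" if "g \<in> gens f st \<beta>" for g
    using that .
  fix g k g' k' assume "(g, k, g', k') \<in> rels f st \<beta>"
  then consider \<gamma> where "g = Stage \<gamma>" "k = leg st \<gamma> g'" "k' = Ident C (Dom C k)" "\<gamma> \<in> underS \<U> \<beta>" "g' \<in> gens f st \<gamma>"
    | \<gamma> i a b where "g = Cell \<gamma> i a b" "k = i" "g' = Stage \<gamma>" "k' = a" "\<gamma> \<in> underS \<U> \<beta>" "(i, a, b) \<in> squares f st \<gamma>"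
    unfolding rels_def by blast
  then show "g \<in> gens f st \<beta> \<and> g' \<in> gens f st \<beta> \<and> k \<in> Arr C \<and> k' \<in> Arr C \<and> Dom C k = Dom C k' \<and>
      Cod C k = gen_obj f st g \<and> Cod C k' = gen_obj f st g'"
  proof cases
    case 1
    have "g' \<in> gens f st \<beta>"
      using gens_mono[OF 1(4)] 1(5) by blast
    moreover have "k \<in> hom C (gen_obj f st g') (obj st \<gamma>)"
      using is_stageD(4)[OF below] 1 by blast
    ultimately show ?thesis
      using Ident_hom[OF gen_obj] 1 by (auto simp: hom_def)
  next
    case 2
    then show ?thesis
      using squares_hom(1,2)[OF 2(6)] by (auto simp: hom_def)
  qed
qed

text \<open>
  A cocone on stage \<open>\<beta>\<close> may be checked through the meaning of the two kinds of relations: \<open>y\<close> is compatible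
  with the legs of the earlier stages, and it is attached correctly on every cell.
\<close>

lemma stage_coconeI:
  assumes below: "\<And>\<gamma>. \<gamma> \<in> underS \<U> \<beta> \<Longrightarrow> is_stage f st \<gamma> (st \<gamma>)"
    and z: "z \<in> Obj C" and y: "\<And>g. g \<in> gens f st \<beta> \<Longrightarrow> y g \<in> hom C (gen_obj f st g) z"
    and extend: "\<And>\<gamma> g. \<gamma> \<in> underS \<U> \<beta> \<Longrightarrow> g \<in> gens f st \<gamma> \<Longrightarrow> y (Stage \<gamma>) \<cdot> leg st \<gamma> g = y g"
    and attach: "\<And>\<gamma> i a b. \<gamma> \<in> underS \<U> \<beta> \<Longrightarrow> (i, a, b) \<in> squares f st \<gamma> \<Longrightarrow>
      y (Cell \<gamma> i a b) \<cdot> i = y (Stage \<gamma>) \<cdot> a"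
  shows "presentation_cocone C (gens f st \<beta>) (rels f st \<beta>) (gen_obj f st) z y"
  unfolding presentation_cocone_def
proof (intro conjI ballI z y; clarify?)
  fix g k g' k' assume "(g, k, g', k') \<in> rels f st \<beta>"
  then consider \<gamma> where "g = Stage \<gamma>" "k = leg st \<gamma> g'" "k' = Ident C (Dom C k)" "\<gamma> \<in> underS \<U> \<beta>" "g' \<in> gens f st \<gamma>"
    | \<gamma> i a b where "g = Cell \<gamma> i a b" "k = i" "g' = Stage \<gamma>" "k' = a" "\<gamma> \<in> underS \<U> \<beta>" "(i, a, b) \<in> squares f st \<gamma>"
    unfolding rels_def by blast
  then show "y g \<cdot> k = y g' \<cdot> k'"
  proof cases
    case 1
    then have "Dom C k = gen_obj f st g'" "g' \<in> gens f st \<beta>"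
      using homD(2)[OF is_stageD(4)[OF below]] gens_mono by blast+
    then show ?thesis
      using extend[OF 1(4,5)] Comp_Ident[OF y] 1 by simp
  next
    case 2
    then show ?thesis
      using attach by blast
  qed
qed

text \<open>
  The labels of the generators are compatible with the relations precisely because the attaching squares
  commute and the earlier stages are objects over \<open>B\<close>.
\<close>

lemma ex_tower:
  assumes f: "f \<in> Arr C"
  shows "\<exists>st. tower f st"
  unfolding tower_def
proof (rule dependent_wf_choice[OF underS_wf])
  show "is_stage f st \<beta> s = is_stage f st' \<beta> s"
    if "\<And>\<gamma>. (\<gamma>, \<beta>) \<in> {(\<gamma>, \<beta>). \<gamma> \<in> underS \<U> \<beta>} \<Longrightarrow> st \<gamma> = st' \<gamma>" for st st' \<beta> s
    using that by (intro is_stage_cong) simp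
  fix \<beta> st assume "\<And>\<gamma>. (\<gamma>, \<beta>) \<in> {(\<gamma>, \<beta>). \<gamma> \<in> underS \<U> \<beta>} \<Longrightarrow> is_stage f st \<gamma> (st \<gamma>)"
  then have below: "is_stage f st \<gamma> (st \<gamma>)" if "\<gamma> \<in> underS \<U> \<beta>" for \<gamma>
    using that by simp
  obtain z x where zx: "presents C (gens f st \<beta>) (rels f st \<beta>) (gen_obj f st) z x"
    using ex_presents[OF stage_presentation[OF f below] small_gens small_rels] by blast
  have label: "label f st g \<in> hom C (gen_obj f st g) (Cod C f)" if "g \<in> gens f st \<beta>" for g
    using that Arr_hom[OF f] is_stageD(3)[OF below] squares_hom(3) by (cases g) auto
  have "presentation_cocone C (gens f st \<beta>) (rels f st \<beta>) (gen_obj f st) (Cod C f) (label f st)"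
    using is_stageD(5)[OF below] squares_hom(4) by (intro stage_coconeI[OF below] Cod_Obj f label) auto
  then obtain p where "p \<in> hom C z (Cod C f)" "\<And>g. g \<in> gens f st \<beta> \<Longrightarrow> p \<cdot> x g = label f st g"
    using presents_ex[OF zx] by blast
  then show "\<exists>s. is_stage f st \<beta> s"
    using zx by (intro exI[of _ "(z, x, p)"]) (simp add: is_stage_def)
qed

context
  fixes f st
  assumes f: "f \<in> Arr C" and tower: "tower f st"
begin

lemma stage: "is_stage f st \<beta> (st \<beta>)"
  using tower by (simp add: tower_def)

lemmas tower_presents = is_stageD(1)[OF stage]
  and obj_Obj = is_stageD(2)[OF stage]
  and prj_hom = is_stageD(3)[OF stage]
  and leg_hom = is_stageD(4)[OF stage]
  and prj_leg = is_stageD(5)[OF stage]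

lemma leg_Base: "leg st \<beta> Base \<in> hom C (Dom C f) (obj st \<beta>)"
  and leg_Stage: "\<gamma> \<in> underS \<U> \<beta> \<Longrightarrow> leg st \<beta> (Stage \<gamma>) \<in> hom C (obj st \<gamma>) (obj st \<beta>)"
  and leg_Cell: "\<gamma> \<in> underS \<U> \<beta> \<Longrightarrow> (i, a, b) \<in> squares f st \<gamma> \<Longrightarrow> leg st \<beta> (Cell \<gamma> i a b) \<in> hom C (Cod C i) (obj st \<beta>)"
  using leg_hom[of Base \<beta>] leg_hom[of "Stage \<gamma>" \<beta>] leg_hom[of "Cell \<gamma> i a b" \<beta>] by simp_all

lemma tower_presentation: "presentation C (gens f st \<beta>) (rels f st \<beta>) (gen_obj f st)"
  using stage_presentation[OF f stage] .

lemma leg_extend: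
  assumes "\<gamma> \<in> underS \<U> \<beta>" "g \<in> gens f st \<gamma>"
  shows "leg st \<beta> (Stage \<gamma>) \<cdot> leg st \<gamma> g = leg st \<beta> g"
proof -
  have g: "g \<in> gens f st \<beta>"
    using assms gens_mono by blast
  have "(Stage \<gamma>, leg st \<gamma> g, g, Ident C (Dom C (leg st \<gamma> g))) \<in> rels f st \<beta>"
    unfolding rels_def using assms by blast
  from presents_rel[OF tower_presents this] show ?thesis
    using homD(2)[OF leg_hom[OF assms(2)]] Comp_Ident[OF leg_hom[OF g]] by simp
qed

lemma leg_attach:
  assumes "\<gamma> \<in> underS \<U> \<beta>" "(i, a, b) \<in> squares f st \<gamma>"
  shows "leg st \<beta> (Cell \<gamma> i a b) \<cdot> i = leg st \<beta> (Stage \<gamma>) \<cdot> a"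
proof -
  have "(Cell \<gamma> i a b, i, Stage \<gamma>, a) \<in> rels f st \<beta>"
    unfolding rels_def using assms by blast
  then show ?thesis
    by (rule presents_rel[OF tower_presents])
qed

lemma tower_eqI:
  assumes "h \<in> hom C (obj st \<beta>) z" "h' \<in> hom C (obj st \<beta>) z"
    and "\<And>g. g \<in> gens f st \<beta> \<Longrightarrow> h \<cdot> leg st \<beta> g = h' \<cdot> leg st \<beta> g"
  shows "h = h'"
  by (rule presents_eqI[OF tower_presentation tower_presents]) (fact assms)+

lemma tower_filtered_presentation:
  "filtered_presentation \<U> C (Field \<U>) (gens f st) (rels f st) (gen_obj f st) (obj st) (leg st)"
proof unfold_locales
  show "gens f st \<gamma> \<subseteq> (\<Union>\<beta> \<in> underS \<U> \<gamma>. gens f st \<beta>)" if "limit \<gamma>" for \<gamma>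
  proof
    fix g assume "g \<in> gens f st \<gamma>"
    then have "\<exists>\<beta> \<in> underS \<U> \<gamma>. g \<in> gens f st \<beta>"
      using that unfolding limit_def by (cases g) auto
    then show "g \<in> (\<Union>\<beta> \<in> underS \<U> \<gamma>. gens f st \<beta>)"
      by blast
  qed
  show "rels f st \<gamma> \<subseteq> (\<Union>\<beta> \<in> underS \<U> \<gamma>. rels f st \<beta>)" if "limit \<gamma>" for \<gamma>
  proof
    fix q assume "q \<in> rels f st \<gamma>"
    then obtain \<delta> where "\<delta> \<in> underS \<U> \<gamma>" and q: "\<And>\<beta>. \<delta> \<in> underS \<U> \<beta> \<Longrightarrow> q \<in> rels f st \<beta>"
      unfolding rels_def by blast
    then show "q \<in> (\<Union>\<beta> \<in> underS \<U> \<gamma>. rels f st \<beta>)"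
      using that unfolding limit_def by blast
  qed
qed (rule subset_refl tower_presentation tower_presents gens_mono rels_mono; assumption?)+

interpretation seq: filtered_presentation \<U> C "Field \<U>" "gens f st" "rels f st" "gen_obj f st" "obj st" "leg st"
  by (rule tower_filtered_presentation)

lemma transition_leg:
  assumes "\<gamma> \<in> underS \<U> \<beta>"
  shows "seq.induced \<gamma> (obj st \<beta>) (leg st \<beta>) = leg st \<beta> (Stage \<gamma>)"
  by (rule seq.induced_eqI[OF underS_FieldI(1)[OF assms] seq.cocone_le[OF underS_FieldI(2)[OF assms] underS_le[OF assms]]
        leg_Stage[OF assms] leg_extend[OF assms]])

text \<open>
  At the successor \<open>\<beta>'\<close> of \<open>\<beta>\<close> the only generators which are not yet generators of stage \<open>\<beta>\<close> are stage \<open>\<beta>\<close> and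
  the cells over it, and stage \<open>\<beta>\<close> determines all the others.  Hence stage \<open>\<beta>'\<close> is the wide pushout of
  the maps \<open>i\<close> along the squares into stage \<open>\<beta>\<close>.
\<close>

lemma leg_Stage_in_cell:
  assumes \<beta>: "underS \<U> \<beta>' = insert \<beta> (underS \<U> \<beta>)"
  shows "leg st \<beta>' (Stage \<beta>) \<in> cell \<U> C K"
proof -
  have \<beta>\<beta>': "\<beta> \<in> underS \<U> \<beta>'"
    using \<beta> by blast
  obtain \<tau> e where \<tau>: "\<tau> \<in> Field \<U>" "bij_betw e (underS \<U> \<tau>) (squares f st \<beta>)"
    using small_enumeration[OF small_squares] by blast
  define i where "i \<rho> = fst (e \<rho>)" for \<rho>
  define a where "a \<rho> = fst (snd (e \<rho>))" for \<rho>
  define b where "b \<rho> = snd (snd (e \<rho>))" for \<rho>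
  have sq: "(i \<rho>, a \<rho>, b \<rho>) \<in> squares f st \<beta>" if "\<rho> \<in> underS \<U> \<tau>" for \<rho>
    using that \<tau>(2) unfolding bij_betw_def i_def a_def b_def by auto
  define ix where "ix = inv_into (underS \<U> \<tau>) e"
  have ix: "ix s \<in> underS \<U> \<tau>" "e (ix s) = s" if "s \<in> squares f st \<beta>" for s
    using that \<tau>(2) unfolding ix_def bij_betw_def by (auto simp: f_inv_into_f inv_into_into)
  have ix_e: "ix (i \<rho>, a \<rho>, b \<rho>) = \<rho>" if "\<rho> \<in> underS \<U> \<tau>" for \<rho>
    using that \<tau>(2) unfolding ix_def bij_betw_def i_def a_def b_def by (simp add: inv_into_f_f)
  define z where "z = case_option (leg st \<beta>' (Stage \<beta>)) (\<lambda>\<rho>. leg st \<beta>' (Cell \<beta> (i \<rho>) (a \<rho>) (b \<rho>)))"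
  define G where "G = insert None (Some ` underS \<U> \<tau>)"
  define R where "R = (\<lambda>\<rho>. (Some \<rho>, i \<rho>, None :: 'u option, a \<rho>)) ` underS \<U> \<tau>"
  define ob where "ob = case_option (obj st \<beta>) (\<lambda>\<rho>. Cod C (i \<rho>))"
  have "presents C G R ob (obj st \<beta>') z"
    unfolding presents_def
  proof (intro conjI allI impI)
    show "presentation_cocone C G R ob (obj st \<beta>') z"
      unfolding presentation_cocone_def
      using obj_Obj leg_Stage[OF \<beta>\<beta>'] leg_Cell[OF \<beta>\<beta>' sq] leg_attach[OF \<beta>\<beta>' sq]
      by (auto simp: G_def R_def z_def ob_def)
    fix z' y assume y: "presentation_cocone C G R ob z' y"
    then have z': "z' \<in> Obj C" and y0: "y None \<in> hom C (obj st \<beta>) z'"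
      and y1: "\<And>\<rho>. \<rho> \<in> underS \<U> \<tau> \<Longrightarrow> y (Some \<rho>) \<in> hom C (Cod C (i \<rho>)) z'"
      and y2: "\<And>\<rho>. \<rho> \<in> underS \<U> \<tau> \<Longrightarrow> y (Some \<rho>) \<cdot> i \<rho> = y None \<cdot> a \<rho>"
      unfolding presentation_cocone_def G_def R_def ob_def by auto
    \<comment> \<open>Old generators reach \<open>z'\<close> through stage \<open>\<beta>\<close>; the new ones are prescribed by \<open>y\<close>.\<close>
    define y' where "y' g = (if g \<in> gens f st \<beta> then y None \<cdot> leg st \<beta> g else
      case g of Cell \<gamma> i a b \<Rightarrow> y (Some (ix (i, a, b))) | _ \<Rightarrow> y None)" for g
    have y'_old: "y' g = y None \<cdot> leg st \<beta> g" if "g \<in> gens f st \<beta>" for g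
      using that by (simp add: y'_def)
    have y'_Stage: "y' (Stage \<beta>) = y None"
      by (simp add: y'_def underS_def)
    have y'_Cell: "y' (Cell \<beta> k c d) = y (Some (ix (k, c, d)))" for k c d
      by (simp add: y'_def underS_def)
    have y1': "y (Some (ix (k, c, d))) \<in> hom C (Cod C k) z'"
      and y2': "y (Some (ix (k, c, d))) \<cdot> k = y None \<cdot> c" if "(k, c, d) \<in> squares f st \<beta>" for k c d
      using y1[OF ix(1)[OF that]] y2[OF ix(1)[OF that]] ix(2)[OF that] by (auto simp: i_def a_def)
    have new: "g \<in> gens f st \<beta> \<or> g = Stage \<beta> \<or> (\<exists>k c d. g = Cell \<beta> k c d \<and> (k, c, d) \<in> squares f st \<beta>)"
      if "g \<in> gens f st \<beta>'" for g
      using that by (auto simp: gens_def \<beta>)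
    have y'_hom: "y' g \<in> hom C (gen_obj f st g) z'" if "g \<in> gens f st \<beta>'" for g
      using new[OF that] y'_old Comp_hom[OF leg_hom y0] y'_Stage y'_Cell y0 y1' by auto
    have "presentation_cocone C (gens f st \<beta>') (rels f st \<beta>') (gen_obj f st) z' y'"
    proof (intro stage_coconeI stage z' y'_hom)
      fix \<gamma> g assume \<gamma>: "\<gamma> \<in> underS \<U> \<beta>'" "g \<in> gens f st \<gamma>"
      show "y' (Stage \<gamma>) \<cdot> leg st \<gamma> g = y' g"
      proof (cases "\<gamma> = \<beta>")
        case True
        then show ?thesis
          using y'_old[of g] y'_Stage \<gamma> by simp
      next
        case False
        then have \<gamma>\<beta>: "\<gamma> \<in> underS \<U> \<beta>"
          using \<gamma> \<beta> by blast
        have "g \<in> gens f st \<beta>"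
          using gens_mono[OF \<gamma>\<beta>] \<gamma>(2) by blast
        then show ?thesis
          using Comp_assoc[OF leg_hom[OF \<gamma>(2)] leg_Stage[OF \<gamma>\<beta>] y0] y'_old[of g] y'_old[of "Stage \<gamma>"]
            \<gamma>\<beta> leg_extend[OF \<gamma>\<beta> \<gamma>(2)] by simp
      qed
    next
      fix \<gamma> k c d assume \<gamma>: "\<gamma> \<in> underS \<U> \<beta>'" "(k, c, d) \<in> squares f st \<gamma>"
      show "y' (Cell \<gamma> k c d) \<cdot> k = y' (Stage \<gamma>) \<cdot> c"
      proof (cases "\<gamma> = \<beta>")
        case True
        then show ?thesis
          using y'_Cell y'_Stage y2' \<gamma> by simp
      next
        case False
        then have \<gamma>\<beta>: "\<gamma> \<in> underS \<U> \<beta>"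
          using \<gamma> \<beta> by blast
        note sq = squares_hom[OF \<gamma>(2)]
        show ?thesis
          using Comp_assoc[OF sq(1) leg_Cell[OF \<gamma>\<beta> \<gamma>(2)] y0] Comp_assoc[OF sq(2) leg_Stage[OF \<gamma>\<beta>] y0]
            leg_attach[OF \<gamma>\<beta> \<gamma>(2)] \<gamma>\<beta> \<gamma>(2) y'_old[of "Stage \<gamma>"] y'_old[of "Cell \<gamma> k c d"] by simp
      qed
    qed
    then obtain h where h: "h \<in> hom C (obj st \<beta>') z'" "\<And>g. g \<in> gens f st \<beta>' \<Longrightarrow> h \<cdot> leg st \<beta>' g = y' g"
      using presents_ex[OF tower_presents] by blast
    show "\<exists>!h. h \<in> hom C (obj st \<beta>') z' \<and> (\<forall>g \<in> G. h \<cdot> z g = y g)"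
    proof (rule ex1I[of _ h]; (elim conjE)?)
      show "h \<in> hom C (obj st \<beta>') z' \<and> (\<forall>g \<in> G. h \<cdot> z g = y g)"
        using h(1) h(2)[of "Stage \<beta>"] h(2)[OF gens_simps(3)[THEN iffD2], OF conjI[OF \<beta>\<beta>' sq]] \<beta>\<beta>' y'_Stage y'_Cell ix_e
        by (auto simp: G_def z_def)
      fix h' assume h': "h' \<in> hom C (obj st \<beta>') z'" "\<forall>g \<in> G. h' \<cdot> z g = y g"
      show "h' = h"
      proof (rule tower_eqI[OF h'(1) h(1)])
        fix g assume g: "g \<in> gens f st \<beta>'"
        from new[OF g] consider "g \<in> gens f st \<beta>" | "g = Stage \<beta>"
          | k c d where "g = Cell \<beta> k c d" "(k, c, d) \<in> squares f st \<beta>"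
          by blast
        then have "h' \<cdot> leg st \<beta>' g = y' g"
        proof cases
          case 1
          have "h' \<cdot> leg st \<beta>' (Stage \<beta>) = y None"
            using h'(2) by (auto simp: G_def z_def)
          then show ?thesis
            using Comp_assoc[OF leg_hom[OF 1] leg_Stage[OF \<beta>\<beta>'] h'(1)] leg_extend[OF \<beta>\<beta>' 1] y'_old[OF 1] by simp
        next
          case 2
          then show ?thesis
            using h'(2) y'_Stage by (auto simp: G_def z_def)
        next
          case 3
          have "Some (ix (k, c, d)) \<in> G"
            using ix(1)[OF 3(2)] by (simp add: G_def)
          then have "h' \<cdot> z (Some (ix (k, c, d))) = y (Some (ix (k, c, d)))"
            using h'(2) by blast
          then show ?thesis
            using 3 y'_Cell ix(2)[OF 3(2)] by (simp add: z_def i_def a_def b_def)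
        qed
        then show "h' \<cdot> leg st \<beta>' g = h \<cdot> leg st \<beta>' g"
          using h(2)[OF g] by simp
      qed
    qed
  qed
  then have "z None \<in> cell \<U> C K"
    unfolding G_def R_def ob_def
    using squares_hom[OF sq] homD(1)[OF squares_hom(1)[OF sq]]
    by (intro wide_pushout_in_cell[OF \<tau>(1) obj_Obj, of i K a]) simp_all
  then show ?thesis
    by (simp add: z_def)
qed

end
end


section \<open>The two factors of the tower\<close>

text \<open>
  Surjectivity of the canonical map from the colimit of the sets \<open>C(d, X\<^sub>\<beta>)\<close> to \<open>C(d, c)\<close>.
\<close>

lemma (in category) small_factors_through_stage:
  assumes small: "cardinal_small_relative \<U> C \<kappa> d K" and r: "ordinal \<U> r" "filtered_ordinal \<kappa> r"
    and X: "ord_sequence C r X" "sequence_steps_in r X K" and c: "is_colimit (ord_cat r) C X c \<iota>"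
    and a: "a \<in> hom C d c"
  shows "\<exists>\<beta> \<in> Field r. \<exists>a' \<in> hom C d (OMap X \<beta>). \<iota> \<beta> \<cdot> a' = a"
proof -
  let ?rel = "(hom_rel C r X d \<union> (hom_rel C r X d)\<inverse>)\<^sup>*"
  have "bij_betw (hom_colim_map C \<iota>) (hom_colim C r X d) (hom C d c)"
    using small r X c unfolding cardinal_small_relative_def by blast
  then have "a \<in> hom_colim_map C \<iota> ` hom_colim C r X d"
    using a by (simp add: bij_betw_def)
  then obtain E where "E \<in> hom_colim C r X d" "hom_colim_map C \<iota> E = a"
    by blast
  then obtain \<beta> f where E: "E = ?rel `` {(\<beta>, f)}" and \<beta>: "\<beta> \<in> Field r" "f \<in> hom C d (OMap X \<beta>)"
    unfolding hom_colim_def quotient_def hom_sum_def by blast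
  interpret X: is_functor "ord_cat r" C X
    using X(1) by (simp add: ord_sequence_def)
  have step: "\<iota> (fst q) \<cdot> snd q = \<iota> (fst p) \<cdot> snd p" if pq: "(p, q) \<in> hom_rel C r X d" for p q
  proof -
    obtain \<beta> \<gamma> f where *: "p = (\<beta>, f)" "q = (\<gamma>, AMap X (\<beta>, \<gamma>) \<cdot> f)" "(\<beta>, \<gamma>) \<in> r" "f \<in> hom C d (OMap X \<beta>)"
      using pq unfolding hom_rel_def by blast
    have "(\<beta>, \<gamma>) \<in> hom (ord_cat r) \<beta> \<gamma>" "(\<beta>, \<gamma>) \<in> Arr (ord_cat r)" "\<gamma> \<in> Obj (ord_cat r)"
      using *(3) by (auto simp: ord_cat_def hom_def Field_def)
    moreover have "is_cocone (ord_cat r) C X c \<iota>"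
      using c by (simp add: is_colimit_def)
    ultimately have "\<iota> \<gamma> \<in> hom C (OMap X \<gamma>) c" "\<iota> (Cod (ord_cat r) (\<beta>, \<gamma>)) \<cdot> AMap X (\<beta>, \<gamma>) = \<iota> (Dom (ord_cat r) (\<beta>, \<gamma>))"
      "AMap X (\<beta>, \<gamma>) \<in> hom C (OMap X \<beta>) (OMap X \<gamma>)"
      using X.AMap_hom unfolding is_cocone_def by blast+
    then show ?thesis
      using Comp_assoc[OF *(4), of "AMap X (\<beta>, \<gamma>)" "OMap X \<gamma>" "\<iota> \<gamma>" c] *(1,2) by (simp add: ord_cat_def)
  qed
  have const: "\<iota> (fst q) \<cdot> snd q = \<iota> \<beta> \<cdot> f" if "((\<beta>, f), q) \<in> ?rel" for q
    using that
  proof (induction rule: rtrancl_induct)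
    case (step p q)
    then show ?case
      using \<open>\<And>p q. (p, q) \<in> hom_rel C r X d \<Longrightarrow> _\<close>[of p q] \<open>\<And>p q. (p, q) \<in> hom_rel C r X d \<Longrightarrow> _\<close>[of q p] by auto
  qed simp
  have "(\<beta>, f) \<in> E"
    unfolding E by blast
  have "(\<lambda>(\<gamma>, g). \<iota> \<gamma> \<cdot> g) ` E = (\<lambda>_. \<iota> \<beta> \<cdot> f) ` E"
  proof (rule image_cong[OF refl])
    show "(\<lambda>(\<gamma>, g). \<iota> \<gamma> \<cdot> g) q = \<iota> \<beta> \<cdot> f" if "q \<in> E" for q
      using const[of q] that unfolding E by (simp add: case_prod_beta)
  qed
  then have "(\<lambda>(\<gamma>, g). \<iota> \<gamma> \<cdot> g) ` E = {\<iota> \<beta> \<cdot> f}"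
    using \<open>(\<beta>, f) \<in> E\<close> by (auto simp: image_constant_conv)
  then have "\<iota> \<beta> \<cdot> f = a"
    using \<open>hom_colim_map C \<iota> E = a\<close> unfolding hom_colim_map_def by simp
  then show ?thesis
    using \<beta> by blast
qed

context cellular_category begin

context
  fixes f st
  assumes f: "f \<in> Arr C" and tower: "tower f st"
begin

text \<open>
  A square from \<open>i \<in> K\<close> to the projection of stage \<open>\<Lambda>\<close> factors, by smallness of the domain of \<open>i\<close>, through a
  stage \<open>\<beta> < \<Lambda>\<close>.  The resulting square was given a cell right after stage \<open>\<beta>\<close>, and the leg of this cell
  into stage \<open>\<Lambda>\<close> is the required lift.
\<close>

lemma prj_in_RLP:
  assumes \<Lambda>: "\<Lambda> \<in> Field \<U>"
    and small: "\<And>i. i \<in> K \<Longrightarrow> \<exists>\<kappa>. filtered_ordinal \<kappa> (Restr \<U> (underS \<U> \<Lambda>)) \<and>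
      cardinal_small_relative \<U> C \<kappa> (Dom C i) (cell \<U> C K)"
  shows "prj st \<Lambda> \<in> RLP C K"
proof -
  interpret seq: filtered_presentation \<U> C "Field \<U>" "gens f st" "rels f st" "gen_obj f st" "obj st" "leg st"
    by (rule tower_filtered_presentation[OF f tower])
  define r where "r = Restr \<U> (underS \<U> \<Lambda>)"
  note prj = prj_hom[OF f tower]
  have Field_r: "Field r = underS \<U> \<Lambda>"
    unfolding r_def by (rule Field_Restr[OF Order_Relation.underS_Field])
  have ordinal: "ordinal \<U> r"
    unfolding r_def by (intro ordinal_Restr Order_Relation.underS_Field small_underS)
  have sequence: "ord_sequence C r seq.sequence"
    unfolding r_def by (intro seq.sequence_ord_sequence Order_Relation.underS_Field initial_segment_underS)
  have steps: "sequence_steps_in r seq.sequence (cell \<U> C K)"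
    unfolding sequence_steps_in_def
  proof (intro allI impI)
    fix \<beta> \<beta>' assume "is_succ r \<beta> \<beta>'"
    then have \<beta>: "underS \<U> \<beta>' = insert \<beta> (underS \<U> \<beta>)"
      unfolding r_def by (rule is_succ_Restr[OF initial_segment_underS])
    then have "seq.induced \<beta> (obj st \<beta>') (leg st \<beta>') = leg st \<beta>' (Stage \<beta>)"
      by (intro transition_leg[OF f tower]) blast
    then show "AMap seq.sequence (\<beta>, \<beta>') \<in> cell \<U> C K"
      using leg_Stage_in_cell[OF f tower \<beta>] by (simp add: seq.sequence_def)
  qed
  have "has_lift C i (prj st \<Lambda>)" if i: "i \<in> K" for i
    unfolding has_lift_def homD(2)[OF prj] homD(3)[OF prj]
  proof (intro ballI impI)
    fix a b assume a: "a \<in> hom C (Dom C i) (obj st \<Lambda>)" and b: "b \<in> hom C (Cod C i) (Cod C f)"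
      and ab: "prj st \<Lambda> \<cdot> a = b \<cdot> i"
    obtain \<kappa> where \<kappa>: "filtered_ordinal \<kappa> r" "cardinal_small_relative \<U> C \<kappa> (Dom C i) (cell \<U> C K)"
      using small[OF i] unfolding r_def by blast
    have "limit \<Lambda>"
      unfolding limit_def
    proof (intro conjI ballI)
      show "underS \<U> \<Lambda> \<noteq> {}"
        using \<kappa>(1) Field_r by (simp add: filtered_ordinal_def)
      fix \<delta> assume "\<delta> \<in> underS \<U> \<Lambda>"
      then obtain \<gamma> where "\<delta> \<in> underS r \<gamma>"
        using \<kappa>(1) Field_r unfolding filtered_ordinal_def by blast
      then show "\<exists>\<delta>' \<in> underS \<U> \<Lambda>. \<delta> \<in> underS \<U> \<delta>'"
        unfolding r_def by (auto simp: underS_def)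
    qed
    then have "is_colimit (ord_cat r) C seq.sequence (obj st \<Lambda>) (\<lambda>\<beta>. seq.induced \<beta> (obj st \<Lambda>) (leg st \<Lambda>))"
      unfolding r_def by (intro seq.sequence_limit \<Lambda> Order_Relation.underS_Field)
    from small_factors_through_stage[OF \<kappa>(2) ordinal \<kappa>(1) sequence steps this a]
    obtain \<beta> a' where \<beta>: "\<beta> \<in> underS \<U> \<Lambda>" and a': "a' \<in> hom C (Dom C i) (obj st \<beta>)"
      and a_eq: "leg st \<Lambda> (Stage \<beta>) \<cdot> a' = a"
      using transition_leg[OF f tower] unfolding Field_r by (auto simp: seq.sequence_def)
    note \<beta>\<Lambda> = leg_Stage[OF f tower \<beta>]
    have "prj st \<beta> \<cdot> a' = b \<cdot> i"
      using Comp_assoc[OF a' \<beta>\<Lambda> prj] prj_leg[OF f tower, of "Stage \<beta>" \<Lambda>] \<beta> a_eq ab by simp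
    then have sq: "(i, a', b) \<in> squares f st \<beta>"
      using i a' b by (simp add: squares_def)
    have "prj st \<Lambda> \<cdot> leg st \<Lambda> (Cell \<beta> i a' b) = b"
      using prj_leg[OF f tower, of "Cell \<beta> i a' b" \<Lambda>] \<beta> sq by simp
    then show "\<exists>h \<in> hom C (Cod C i) (obj st \<Lambda>). h \<cdot> i = a \<and> prj st \<Lambda> \<cdot> h = b"
      using leg_Cell[OF f tower \<beta> sq] leg_attach[OF f tower \<beta> sq] a_eq by blast
  qed
  then show ?thesis
    unfolding RLP_def using homD(1)[OF prj] by blast
qed

text \<open>
  To lift the bottom map \<open>t\<close> of a square against \<open>q\<close>, one lifts its restrictions to the stages \<open>\<gamma> \<le> \<Lambda>\<close> by recursion
  on \<open>\<gamma>\<close>.  By the universal property of stage \<open>\<gamma>\<close> it suffices to lift on generators: \<open>A\<close> is given, earlier stages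
  are covered by recursion, and a cell is the codomain of a map in \<open>K\<close>, against which \<open>q\<close> lifts.
\<close>

lemma leg_Base_in_LLP:
  assumes \<Lambda>: "\<Lambda> \<in> Field \<U>"
  shows "leg st \<Lambda> Base \<in> LLP C (RLP C K)"
proof -
  interpret seq: filtered_presentation \<U> C "Field \<U>" "gens f st" "rels f st" "gen_obj f st" "obj st" "leg st"
    by (rule tower_filtered_presentation[OF f tower])
  note leg_hom = leg_hom[OF f tower]
  have "has_lift C (leg st \<Lambda> Base) q" if q: "q \<in> RLP C K" for q
    unfolding has_lift_def homD(2)[OF leg_Base[OF f tower]] homD(3)[OF leg_Base[OF f tower]]
  proof (intro ballI impI)
    fix s t assume s: "s \<in> hom C (Dom C f) (Dom C q)" and t: "t \<in> hom C (obj st \<Lambda>) (Cod C q)"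
      and st: "q \<cdot> s = t \<cdot> leg st \<Lambda> Base"
    have q_hom: "q \<in> hom C (Dom C q) (Cod C q)"
      using q by (simp add: RLP_def hom_def)
    define \<tau> where "\<tau> \<gamma> = seq.induced \<gamma> (obj st \<Lambda>) (leg st \<Lambda>)" for \<gamma>
    have \<tau>: "\<tau> \<gamma> \<in> hom C (obj st \<gamma>) (obj st \<Lambda>)" "\<And>g. g \<in> gens f st \<gamma> \<Longrightarrow> \<tau> \<gamma> \<cdot> leg st \<gamma> g = leg st \<Lambda> g"
      if "(\<gamma>, \<Lambda>) \<in> \<U>" for \<gamma>
      using seq.transition[OF le_FieldI(1)[OF that] \<Lambda> that] by (auto simp: \<tau>_def)
    \<comment> \<open>The lift of a cell is chosen by the lifting property of \<open>q\<close>; that of a stage is built by recursion.\<close>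
    define cell_lift where "cell_lift l \<gamma> i a b =
      (SOME h. h \<in> hom C (Cod C i) (Dom C q) \<and> h \<cdot> i = l \<gamma> \<cdot> a \<and> q \<cdot> h = t \<cdot> leg st \<Lambda> (Cell \<gamma> i a b))"
      for l \<gamma> i a b
    define y where "y l g = (case g of Base \<Rightarrow> s | Stage \<gamma> \<Rightarrow> l \<gamma> | Cell \<gamma> i a b \<Rightarrow> cell_lift l \<gamma> i a b)"
      for l g
    define good where "good l \<gamma> h \<longleftrightarrow> ((\<gamma>, \<Lambda>) \<in> \<U> \<longrightarrow> h \<in> hom C (obj st \<gamma>) (Dom C q) \<and> q \<cdot> h = t \<cdot> \<tau> \<gamma> \<and>
      (\<forall>g \<in> gens f st \<gamma>. h \<cdot> leg st \<gamma> g = y l g))" for l \<gamma> h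
    have y_cong: "y l g = y l' g" if "\<And>\<delta>. \<delta> \<in> underS \<U> \<gamma> \<Longrightarrow> l \<delta> = l' \<delta>" "g \<in> gens f st \<gamma>" for l l' g \<gamma>
      using that by (cases g) (auto simp: y_def cell_lift_def)
    have "\<exists>l. \<forall>\<gamma>. good l \<gamma> (l \<gamma>)"
    proof (rule dependent_wf_choice[OF underS_wf])
      show "good l \<gamma> h = good l' \<gamma> h" if "\<And>\<delta>. (\<delta>, \<gamma>) \<in> {(\<gamma>, \<beta>). \<gamma> \<in> underS \<U> \<beta>} \<Longrightarrow> l \<delta> = l' \<delta>" for l l' \<gamma> h
        using y_cong[of \<gamma> l l'] that unfolding good_def by simp
      fix \<gamma> l assume IH: "\<And>\<delta>. (\<delta>, \<gamma>) \<in> {(\<gamma>, \<beta>). \<gamma> \<in> underS \<U> \<beta>} \<Longrightarrow> good l \<delta> (l \<delta>)"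
      show "\<exists>h. good l \<gamma> h"
      proof (cases "(\<gamma>, \<Lambda>) \<in> \<U>")
        case False
        then show ?thesis
          by (simp add: good_def)
      next
        case True
        have below: "l \<delta> \<in> hom C (obj st \<delta>) (Dom C q)" "q \<cdot> l \<delta> = t \<cdot> leg st \<Lambda> (Stage \<delta>)"
          "\<And>g. g \<in> gens f st \<delta> \<Longrightarrow> l \<delta> \<cdot> leg st \<delta> g = y l g" "\<delta> \<in> underS \<U> \<Lambda>" if "\<delta> \<in> underS \<U> \<gamma>" for \<delta>
        proof -
          show "\<delta> \<in> underS \<U> \<Lambda>"
            using underS_le_trans[OF that True] .
          then have "\<tau> \<delta> = leg st \<Lambda> (Stage \<delta>)" "(\<delta>, \<Lambda>) \<in> \<U>"
            using transition_leg[OF f tower] underS_le unfolding \<tau>_def by blast+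
          then show "l \<delta> \<in> hom C (obj st \<delta>) (Dom C q)" "q \<cdot> l \<delta> = t \<cdot> leg st \<Lambda> (Stage \<delta>)"
            "\<And>g. g \<in> gens f st \<delta> \<Longrightarrow> l \<delta> \<cdot> leg st \<delta> g = y l g"
            using IH[of \<delta>] that unfolding good_def by auto
        qed
        have lift: "y l (Cell \<delta> i a b) \<in> hom C (Cod C i) (Dom C q) \<and> y l (Cell \<delta> i a b) \<cdot> i = y l (Stage \<delta>) \<cdot> a \<and>
            q \<cdot> y l (Cell \<delta> i a b) = t \<cdot> leg st \<Lambda> (Cell \<delta> i a b)"
          if \<delta>: "\<delta> \<in> underS \<U> \<gamma>" and sq: "(i, a, b) \<in> squares f st \<delta>" for \<delta> i a b
        proof -
          note sq' = squares_hom[OF sq] and \<delta>\<Lambda> = below(4)[OF \<delta>]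
          note c = leg_Cell[OF f tower \<delta>\<Lambda> sq] and S = leg_Stage[OF f tower \<delta>\<Lambda>]
          have "q \<cdot> (l \<delta> \<cdot> a) = (t \<cdot> leg st \<Lambda> (Cell \<delta> i a b)) \<cdot> i"
            using Comp_assoc[OF sq'(2) below(1)[OF \<delta>] q_hom] Comp_assoc[OF sq'(1) c t] Comp_assoc[OF sq'(2) S t]
              below(2)[OF \<delta>] leg_attach[OF f tower \<delta>\<Lambda> sq] by simp
          moreover have "has_lift C i q"
            using q sq'(5) by (simp add: RLP_def)
          ultimately have "\<exists>h. h \<in> hom C (Cod C i) (Dom C q) \<and> h \<cdot> i = l \<delta> \<cdot> a \<and> q \<cdot> h = t \<cdot> leg st \<Lambda> (Cell \<delta> i a b)"
            using Comp_hom[OF sq'(2) below(1)[OF \<delta>]] Comp_hom[OF c t] unfolding has_lift_def by blast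
          from someI_ex[OF this] show ?thesis
            by (simp add: y_def cell_lift_def)
        qed
        have y_hom: "y l g \<in> hom C (gen_obj f st g) (Dom C q)" if "g \<in> gens f st \<gamma>" for g
          using that s below(1) lift by (cases g) (auto simp: y_def)
        have "presentation_cocone C (gens f st \<gamma>) (rels f st \<gamma>) (gen_obj f st) (Dom C q) (y l)"
        proof (intro stage_coconeI stage[OF f tower] y_hom)
          show "Dom C q \<in> Obj C"
            using hom_Obj[OF q_hom] by blast
          show "y l (Stage \<delta>) \<cdot> leg st \<delta> g = y l g" if "\<delta> \<in> underS \<U> \<gamma>" "g \<in> gens f st \<delta>" for \<delta> g
            using below(3)[OF that] by (simp add: y_def)
          show "y l (Cell \<delta> i a b) \<cdot> i = y l (Stage \<delta>) \<cdot> a" if "\<delta> \<in> underS \<U> \<gamma>" "(i, a, b) \<in> squares f st \<delta>" for \<delta> i a b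
            using lift[OF that] by (elim conjE)
        qed
        then obtain h where h: "h \<in> hom C (obj st \<gamma>) (Dom C q)" "\<And>g. g \<in> gens f st \<gamma> \<Longrightarrow> h \<cdot> leg st \<gamma> g = y l g"
          using presents_ex[OF tower_presents[OF f tower]] by blast
        have "q \<cdot> h = t \<cdot> \<tau> \<gamma>"
        proof (rule tower_eqI[OF f tower Comp_hom[OF h(1) q_hom] Comp_hom[OF \<tau>(1)[OF True] t]])
          fix g assume g: "g \<in> gens f st \<gamma>"
          have "q \<cdot> y l g = t \<cdot> leg st \<Lambda> g"
            using g st below(2) lift by (cases g) (auto simp: y_def)
          then show "(q \<cdot> h) \<cdot> leg st \<gamma> g = (t \<cdot> \<tau> \<gamma>) \<cdot> leg st \<gamma> g"
            using Comp_assoc[OF leg_hom[OF g] h(1) q_hom] Comp_assoc[OF leg_hom[OF g] \<tau>(1)[OF True] t]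
              h(2)[OF g] \<tau>(2)[OF True g] by simp
        qed
        then show ?thesis
          using h unfolding good_def by blast
      qed
    qed
    then obtain l where "good l \<Lambda> (l \<Lambda>)"
      by blast
    moreover have "t \<cdot> \<tau> \<Lambda> = t"
      using seq.transition_refl[OF \<Lambda>] Comp_Ident[OF t] by (simp add: \<tau>_def)
    ultimately have "l \<Lambda> \<in> hom C (obj st \<Lambda>) (Dom C q)" "q \<cdot> l \<Lambda> = t" "l \<Lambda> \<cdot> leg st \<Lambda> Base = s"
      using le_refl[OF \<Lambda>] unfolding good_def by (auto simp: y_def)
    then show "\<exists>h \<in> hom C (obj st \<Lambda>) (Dom C q). h \<cdot> leg st \<Lambda> Base = s \<and> q \<cdot> h = t"
      by blast
  qed
  then show ?thesis
    unfolding LLP_def using homD(1)[OF leg_Base[OF f tower]] by blast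
qed

end

section \<open>Functoriality of the tower\<close>

text \<open>
  A square \<open>(u, v)\<close> from \<open>f\<close> to \<open>f'\<close> acts on towers without any choice: a cell goes to the cell of the composite
  square.  So the maps \<open>w \<gamma>\<close> between the stages are determined by recursion, whatever choices were made for
  the stages themselves, and this makes the factorization functorial.
\<close>

definition transfer :: "('u, 'o, 'a) tower \<Rightarrow> 'a \<Rightarrow> 'a \<Rightarrow> ('u \<Rightarrow> 'a) \<Rightarrow> 'u \<Rightarrow> ('u, 'a) generator \<Rightarrow> 'a" where
  "transfer st' u v w \<gamma> g = (case g of Base \<Rightarrow> leg st' \<gamma> Base \<cdot> u
     | Stage \<delta> \<Rightarrow> leg st' \<gamma> (Stage \<delta>) \<cdot> w \<delta>
     | Cell \<delta> i a b \<Rightarrow> leg st' \<gamma> (Cell \<delta> i (w \<delta> \<cdot> a) (v \<cdot> b)))"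

definition is_tower_map ::
  "'a \<Rightarrow> ('u, 'o, 'a) tower \<Rightarrow> ('u, 'o, 'a) tower \<Rightarrow> 'a \<Rightarrow> 'a \<Rightarrow> ('u \<Rightarrow> 'a) \<Rightarrow> 'u \<Rightarrow> 'a \<Rightarrow> bool" where
  "is_tower_map f st st' u v w \<gamma> h \<longleftrightarrow> h \<in> hom C (obj st \<gamma>) (obj st' \<gamma>) \<and> prj st' \<gamma> \<cdot> h = v \<cdot> prj st \<gamma> \<and>
     (\<forall>g \<in> gens f st \<gamma>. h \<cdot> leg st \<gamma> g = transfer st' u v w \<gamma> g)"

definition tower_map ::
  "'a \<Rightarrow> ('u, 'o, 'a) tower \<Rightarrow> ('u, 'o, 'a) tower \<Rightarrow> 'a \<Rightarrow> 'a \<Rightarrow> ('u \<Rightarrow> 'a) \<Rightarrow> bool" where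
  "tower_map f st st' u v w \<longleftrightarrow> (\<forall>\<gamma>. is_tower_map f st st' u v w \<gamma> (w \<gamma>))"

lemma transfer_cong:
  "(\<And>\<delta>. \<delta> \<in> underS \<U> \<gamma> \<Longrightarrow> w \<delta> = w' \<delta>) \<Longrightarrow> g \<in> gens f st \<gamma> \<Longrightarrow>
    transfer st' u v w \<gamma> g = transfer st' u v w' \<gamma> g"
  by (cases g) (auto simp: transfer_def)

lemma transferred_square:
  assumes f: "f \<in> Arr C" "tower f st" and f': "f' \<in> Arr C" "tower f' st'" and v: "v \<in> hom C (Cod C f) (Cod C f')"
    and w: "w \<in> hom C (obj st \<gamma>) (obj st' \<gamma>)" "prj st' \<gamma> \<cdot> w = v \<cdot> prj st \<gamma>"
    and sq: "(i, a, b) \<in> squares f st \<gamma>"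
  shows "(i, w \<cdot> a, v \<cdot> b) \<in> squares f' st' \<gamma>"
  using squares_hom[OF sq] Comp_hom[OF squares_hom(2)[OF sq] w(1)] Comp_hom[OF squares_hom(3)[OF sq] v]
    Comp_assoc[OF squares_hom(2)[OF sq] w(1) prj_hom[OF f']] Comp_assoc[OF squares_hom(2)[OF sq] prj_hom[OF f] v]
    Comp_assoc[OF squares_hom(1)[OF sq] squares_hom(3)[OF sq] v] w(2)
  by (simp add: squares_def)

lemma ex_tower_map:
  assumes f: "f \<in> Arr C" "tower f st" and f': "f' \<in> Arr C" "tower f' st'"
    and u: "u \<in> hom C (Dom C f) (Dom C f')" and v: "v \<in> hom C (Cod C f) (Cod C f')" and uv: "f' \<cdot> u = v \<cdot> f"
  shows "\<exists>w. tower_map f st st' u v w"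
  unfolding tower_map_def
proof (rule dependent_wf_choice[OF underS_wf])
  show "is_tower_map f st st' u v w \<gamma> h = is_tower_map f st st' u v w' \<gamma> h"
    if "\<And>\<delta>. (\<delta>, \<gamma>) \<in> {(\<gamma>, \<beta>). \<gamma> \<in> underS \<U> \<beta>} \<Longrightarrow> w \<delta> = w' \<delta>" for w w' \<gamma> h
    using transfer_cong[of \<gamma> w w'] that unfolding is_tower_map_def by simp
  fix \<gamma> w assume "\<And>\<delta>. (\<delta>, \<gamma>) \<in> {(\<gamma>, \<beta>). \<gamma> \<in> underS \<U> \<beta>} \<Longrightarrow> is_tower_map f st st' u v w \<delta> (w \<delta>)"
  then have IH: "w \<delta> \<in> hom C (obj st \<delta>) (obj st' \<delta>)" "prj st' \<delta> \<cdot> w \<delta> = v \<cdot> prj st \<delta>"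
    "\<And>g. g \<in> gens f st \<delta> \<Longrightarrow> w \<delta> \<cdot> leg st \<delta> g = transfer st' u v w \<delta> g" if "\<delta> \<in> underS \<U> \<gamma>" for \<delta>
    using that unfolding is_tower_map_def by auto
  note leg = leg_Base[OF f'] leg_Stage[OF f'] leg_Cell[OF f']
  note sq' = transferred_square[OF f f' v IH(1,2)]
  have hom: "transfer st' u v w \<gamma> g \<in> hom C (gen_obj f st g) (obj st' \<gamma>)" if "g \<in> gens f st \<gamma>" for g
    using that Comp_hom[OF u leg(1)] Comp_hom[OF IH(1) leg(2)] leg(3)[OF _ sq']
    by (cases g) (auto simp: transfer_def)
  have "presentation_cocone C (gens f st \<gamma>) (rels f st \<gamma>) (gen_obj f st) (obj st' \<gamma>) (transfer st' u v w \<gamma>)"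
  proof (intro stage_coconeI stage[OF f] obj_Obj[OF f'] hom)
    fix \<delta> g assume \<delta>: "\<delta> \<in> underS \<U> \<gamma>" and g: "g \<in> gens f st \<delta>"
    have below: "\<epsilon> \<in> underS \<U> \<delta> \<Longrightarrow> \<epsilon> \<in> underS \<U> \<gamma>" for \<epsilon>
      using underS_trans[OF _ \<delta>] .
    have "leg st' \<gamma> (Stage \<delta>) \<cdot> transfer st' u v w \<delta> g = transfer st' u v w \<gamma> g"
    proof (cases g)
      case Base
      then show ?thesis
        using Comp_assoc[OF u leg(1) leg(2)[OF \<delta>]] leg_extend[OF f' \<delta>, of Base] by (simp add: transfer_def)
    next
      case (Stage \<epsilon>)
      then have \<epsilon>: "\<epsilon> \<in> underS \<U> \<delta>"
        using g by simp
      then show ?thesis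
        using Comp_assoc[OF IH(1)[OF below[OF \<epsilon>]] leg(2)[OF \<epsilon>] leg(2)[OF \<delta>]] leg_extend[OF f' \<delta>, of "Stage \<epsilon>"] Stage
        by (simp add: transfer_def)
    next
      case (Cell \<epsilon> i a b)
      then show ?thesis
        using g leg_extend[OF f' \<delta>, of "Cell \<epsilon> i (w \<epsilon> \<cdot> a) (v \<cdot> b)"] sq'[OF below below] by (simp add: transfer_def)
    qed
    then show "transfer st' u v w \<gamma> (Stage \<delta>) \<cdot> leg st \<delta> g = transfer st' u v w \<gamma> g"
      using Comp_assoc[OF leg_hom[OF f g] IH(1)[OF \<delta>] leg(2)[OF \<delta>]] IH(3)[OF \<delta> g] by (simp add: transfer_def)
  next
    fix \<delta> i a b assume \<delta>: "\<delta> \<in> underS \<U> \<gamma>" and sq: "(i, a, b) \<in> squares f st \<delta>"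
    show "transfer st' u v w \<gamma> (Cell \<delta> i a b) \<cdot> i = transfer st' u v w \<gamma> (Stage \<delta>) \<cdot> a"
      using leg_attach[OF f' \<delta> sq'[OF \<delta> \<delta> sq]] Comp_assoc[OF squares_hom(2)[OF sq] IH(1)[OF \<delta>] leg(2)[OF \<delta>]]
      by (simp add: transfer_def)
  qed
  then obtain h where h: "h \<in> hom C (obj st \<gamma>) (obj st' \<gamma>)"
    "\<And>g. g \<in> gens f st \<gamma> \<Longrightarrow> h \<cdot> leg st \<gamma> g = transfer st' u v w \<gamma> g"
    using presents_ex[OF tower_presents[OF f]] by blast
  have "prj st' \<gamma> \<cdot> h = v \<cdot> prj st \<gamma>"
  proof (rule tower_eqI[OF f Comp_hom[OF h(1) prj_hom[OF f']] Comp_hom[OF prj_hom[OF f] v]])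
    fix g assume g: "g \<in> gens f st \<gamma>"
    have "prj st' \<gamma> \<cdot> transfer st' u v w \<gamma> g = v \<cdot> label f st g"
    proof (cases g)
      case Base
      then show ?thesis
        using Comp_assoc[OF u leg(1) prj_hom[OF f']] prj_leg[OF f', of Base] uv by (simp add: transfer_def)
    next
      case (Stage \<delta>)
      then have \<delta>: "\<delta> \<in> underS \<U> \<gamma>"
        using g by simp
      then show ?thesis
        using Comp_assoc[OF IH(1)[OF \<delta>] leg(2)[OF \<delta>] prj_hom[OF f']] prj_leg[OF f', of "Stage \<delta>"] IH(2)[OF \<delta>] Stage
        by (simp add: transfer_def)
    next
      case (Cell \<delta> i a b)
      then show ?thesis
        using g prj_leg[OF f', of "Cell \<delta> i (w \<delta> \<cdot> a) (v \<cdot> b)"] sq' by (simp add: transfer_def)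
    qed
    then show "(prj st' \<gamma> \<cdot> h) \<cdot> leg st \<gamma> g = (v \<cdot> prj st \<gamma>) \<cdot> leg st \<gamma> g"
      using Comp_assoc[OF leg_hom[OF f g] h(1) prj_hom[OF f']] Comp_assoc[OF leg_hom[OF f g] prj_hom[OF f] v]
        h(2)[OF g] prj_leg[OF f g] by simp
  qed
  then show "\<exists>h. is_tower_map f st st' u v w \<gamma> h"
    using h unfolding is_tower_map_def by blast
qed

lemma tower_mapD:
  assumes "tower_map f st st' u v w"
  shows "w \<gamma> \<in> hom C (obj st \<gamma>) (obj st' \<gamma>)" "prj st' \<gamma> \<cdot> w \<gamma> = v \<cdot> prj st \<gamma>"
    "g \<in> gens f st \<gamma> \<Longrightarrow> w \<gamma> \<cdot> leg st \<gamma> g = transfer st' u v w \<gamma> g"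
  using assms unfolding tower_map_def is_tower_map_def by blast+

lemma tower_map_unique:
  assumes f: "f \<in> Arr C" "tower f st" and w: "tower_map f st st' u v w" and w': "tower_map f st st' u v w'"
  shows "w \<gamma> = w' \<gamma>"
proof (induction \<gamma> rule: underS_induct)
  case (less \<gamma>)
  show ?case
  proof (rule tower_eqI[OF f tower_mapD(1)[OF w] tower_mapD(1)[OF w']])
    show "w \<gamma> \<cdot> leg st \<gamma> g = w' \<gamma> \<cdot> leg st \<gamma> g" if "g \<in> gens f st \<gamma>" for g
      using tower_mapD(3)[OF w that] tower_mapD(3)[OF w' that] transfer_cong[OF less that] by simp
  qed
qed

lemma tower_map_Ident:
  assumes f: "f \<in> Arr C" "tower f st"
  shows "tower_map f st st (Ident C (Dom C f)) (Ident C (Cod C f)) (\<lambda>\<gamma>. Ident C (obj st \<gamma>))"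
  unfolding tower_map_def is_tower_map_def
proof (intro allI conjI ballI)
  fix \<gamma>
  show "Ident C (obj st \<gamma>) \<in> hom C (obj st \<gamma>) (obj st \<gamma>)"
    by (rule Ident_hom[OF obj_Obj[OF f]])
  show "prj st \<gamma> \<cdot> Ident C (obj st \<gamma>) = Ident C (Cod C f) \<cdot> prj st \<gamma>"
    using Comp_Ident[OF prj_hom[OF f]] Ident_Comp[OF prj_hom[OF f]] by simp
  fix g assume g: "g \<in> gens f st \<gamma>"
  show "Ident C (obj st \<gamma>) \<cdot> leg st \<gamma> g =
      transfer st (Ident C (Dom C f)) (Ident C (Cod C f)) (\<lambda>\<gamma>. Ident C (obj st \<gamma>)) \<gamma> g"
    using g Ident_Comp[OF leg_hom[OF f g]] Comp_Ident[OF leg_hom[OF f g]]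
      Ident_Comp[OF squares_hom(2)] Ident_Comp[OF squares_hom(3)]
    by (cases g) (auto simp: transfer_def)
qed

lemma tower_map_Comp:
  assumes f: "f \<in> Arr C" "tower f st" and f': "f' \<in> Arr C" "tower f' st'" and f'': "f'' \<in> Arr C" "tower f'' st''"
    and u: "u \<in> hom C (Dom C f) (Dom C f')" and v: "v \<in> hom C (Cod C f) (Cod C f')"
    and u': "u' \<in> hom C (Dom C f') (Dom C f'')" and v': "v' \<in> hom C (Cod C f') (Cod C f'')"
    and w: "tower_map f st st' u v w" and w': "tower_map f' st' st'' u' v' w'"
  shows "tower_map f st st'' (u' \<cdot> u) (v' \<cdot> v) (\<lambda>\<gamma>. w' \<gamma> \<cdot> w \<gamma>)"
  unfolding tower_map_def is_tower_map_def
proof (intro allI conjI ballI)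
  fix \<gamma>
  note W = tower_mapD[OF w] and W' = tower_mapD[OF w']
  show "w' \<gamma> \<cdot> w \<gamma> \<in> hom C (obj st \<gamma>) (obj st'' \<gamma>)"
    by (rule Comp_hom[OF W(1) W'(1)])
  show "prj st'' \<gamma> \<cdot> w' \<gamma> \<cdot> w \<gamma> = (v' \<cdot> v) \<cdot> prj st \<gamma>"
    using Comp_assoc[OF W(1) W'(1) prj_hom[OF f'']] Comp_assoc[OF W(1) prj_hom[OF f'] v']
      Comp_assoc[OF prj_hom[OF f] v v'] W(2)[of \<gamma>] W'(2)[of \<gamma>] by metis
  fix g assume g: "g \<in> gens f st \<gamma>"
  have "w' \<gamma> \<cdot> transfer st' u v w \<gamma> g = transfer st'' (u' \<cdot> u) (v' \<cdot> v) (\<lambda>\<gamma>. w' \<gamma> \<cdot> w \<gamma>) \<gamma> g"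
  proof (cases g)
    case Base
    then show ?thesis
      using Comp_assoc[OF u leg_Base[OF f'] W'(1)] Comp_assoc[OF u u' leg_Base[OF f'']] W'(3)[of Base \<gamma>]
      by (simp add: transfer_def) metis
  next
    case (Stage \<delta>)
    then have \<delta>: "\<delta> \<in> underS \<U> \<gamma>"
      using g by simp
    then show ?thesis
      using Comp_assoc[OF W(1) leg_Stage[OF f' \<delta>] W'(1)] Comp_assoc[OF W(1) W'(1) leg_Stage[OF f'' \<delta>]]
        W'(3)[of "Stage \<delta>" \<gamma>] Stage by (simp add: transfer_def)
  next
    case (Cell \<delta> i a b)
    then have \<delta>: "\<delta> \<in> underS \<U> \<gamma>" and sq: "(i, a, b) \<in> squares f st \<delta>"
      using g by auto
    have "(i, w \<delta> \<cdot> a, v \<cdot> b) \<in> squares f' st' \<delta>"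
      by (rule transferred_square[OF f f' v W(1,2) sq])
    then show ?thesis
      using W'(3)[of "Cell \<delta> i (w \<delta> \<cdot> a) (v \<cdot> b)" \<gamma>] \<delta> Cell
        Comp_assoc[OF squares_hom(2)[OF sq] W(1) W'(1)] Comp_assoc[OF squares_hom(3)[OF sq] v v']
      by (simp add: transfer_def)
  qed
  then show "(w' \<gamma> \<cdot> w \<gamma>) \<cdot> leg st \<gamma> g = transfer st'' (u' \<cdot> u) (v' \<cdot> v) (\<lambda>\<gamma>. w' \<gamma> \<cdot> w \<gamma>) \<gamma> g"
    using Comp_assoc[OF leg_hom[OF f g] W(1) W'(1)] W(3)[OF g] by simp
qed

end

section \<open>Functorial factorizations and the small object argument\<close>

context category begin

definition is_square :: "'a \<Rightarrow> 'a \<Rightarrow> 'a \<Rightarrow> 'a \<Rightarrow> bool" where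
  "is_square f u v g \<longleftrightarrow> f \<in> Arr C \<and> g \<in> Arr C \<and> u \<in> hom C (Dom C f) (Dom C g) \<and>
     v \<in> hom C (Cod C f) (Cod C g) \<and> g \<cdot> u = v \<cdot> f"

lemma arrow_cat_hom: "e \<in> hom (arrow_cat C) f g \<longleftrightarrow> (\<exists>u v. e = (f, u, v, g) \<and> is_square f u v g)"
  by (auto simp: arrow_cat_def hom_def is_square_def)

lemma is_square_Ident: "f \<in> Arr C \<Longrightarrow> is_square f (Ident C (Dom C f)) (Ident C (Cod C f)) f"
  using Comp_Ident[OF Arr_hom] Ident_Comp[OF Arr_hom]
  by (simp add: is_square_def Ident_hom Dom_Obj Cod_Obj)

lemma is_square_Comp:
  assumes 1: "is_square f u v g" and 2: "is_square g u' v' h"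
  shows "is_square f (u' \<cdot> u) (v' \<cdot> v) h"
proof -
  have A: "f \<in> hom C (Dom C f) (Cod C f)" "u \<in> hom C (Dom C f) (Dom C g)" "v \<in> hom C (Cod C f) (Cod C g)" "g \<cdot> u = v \<cdot> f"
    "g \<in> hom C (Dom C g) (Cod C g)" "u' \<in> hom C (Dom C g) (Dom C h)" "v' \<in> hom C (Cod C g) (Cod C h)" "h \<cdot> u' = v' \<cdot> g"
    "h \<in> hom C (Dom C h) (Cod C h)"
    using 1 2 Arr_hom[of f C] Arr_hom[of g C] Arr_hom[of h C] by (simp_all add: is_square_def)
  have "h \<cdot> u' \<cdot> u = (v' \<cdot> v) \<cdot> f"
    using Comp_assoc[OF A(2,6,9)] Comp_assoc[OF A(2,5,7)] Comp_assoc[OF A(1,3,7)] A(4,8) by metis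
  then show ?thesis
    using 1 2 Comp_hom[OF A(2,6)] Comp_hom[OF A(3,7)] by (simp add: is_square_def)
qed

lemma arrow_cat_sel [simp]: "Obj (arrow_cat C) = Arr C" "Dom (arrow_cat C) (f, u, v, g) = f"
  "Cod (arrow_cat C) (f, u, v, g) = g" "Ident (arrow_cat C) f = (f, Ident C (Dom C f), Ident C (Cod C f), f)"
  "(f', u', v', g') \<cdot>\<^bsub>arrow_cat C\<^esub> (f, u, v, g) = (f, u' \<cdot> u, v' \<cdot> v, g')"
  "(f, u, v, g) \<in> Arr (arrow_cat C) \<longleftrightarrow> is_square f u v g"
  by (auto simp: arrow_cat_def is_square_def)

lemma category_arrow_cat: "category (arrow_cat C)"
proof
  fix e assume "e \<in> Arr (arrow_cat C)"
  then show "Dom (arrow_cat C) e \<in> Obj (arrow_cat C)" "Cod (arrow_cat C) e \<in> Obj (arrow_cat C)"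
    by (cases e; simp add: is_square_def)+
next
  show "f \<in> Obj (arrow_cat C) \<Longrightarrow> Ident (arrow_cat C) f \<in> hom (arrow_cat C) f f" for f
    using is_square_Ident by (auto simp: arrow_cat_hom)
next
  fix d e f g h assume "d \<in> hom (arrow_cat C) f g" "e \<in> hom (arrow_cat C) g h"
  then show "e \<cdot>\<^bsub>arrow_cat C\<^esub> d \<in> hom (arrow_cat C) f h"
    using is_square_Comp by (auto simp: arrow_cat_hom)
next
  fix d f g assume "d \<in> hom (arrow_cat C) f g"
  then show "d \<cdot>\<^bsub>arrow_cat C\<^esub> Ident (arrow_cat C) f = d" "Ident (arrow_cat C) g \<cdot>\<^bsub>arrow_cat C\<^esub> d = d"
    using Comp_Ident Ident_Comp by (auto simp: arrow_cat_hom is_square_def)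
next
  fix c d e f g h k assume cde: "c \<in> hom (arrow_cat C) f g" "d \<in> hom (arrow_cat C) g h" "e \<in> hom (arrow_cat C) h k"
  obtain u v where 1: "c = (f, u, v, g)" "u \<in> hom C (Dom C f) (Dom C g)" "v \<in> hom C (Cod C f) (Cod C g)"
    using cde(1) unfolding arrow_cat_hom is_square_def by blast
  obtain u' v' where 2: "d = (g, u', v', h)" "u' \<in> hom C (Dom C g) (Dom C h)" "v' \<in> hom C (Cod C g) (Cod C h)"
    using cde(2) unfolding arrow_cat_hom is_square_def by blast
  obtain u'' v'' where 3: "e = (h, u'', v'', k)" "u'' \<in> hom C (Dom C h) (Dom C k)" "v'' \<in> hom C (Cod C h) (Cod C k)"
    using cde(3) unfolding arrow_cat_hom is_square_def by blast
  show "(e \<cdot>\<^bsub>arrow_cat C\<^esub> d) \<cdot>\<^bsub>arrow_cat C\<^esub> c = e \<cdot>\<^bsub>arrow_cat C\<^esub> d \<cdot>\<^bsub>arrow_cat C\<^esub> c"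
    using Comp_assoc[OF 1(2) 2(2) 3(2)] Comp_assoc[OF 1(3) 2(3) 3(3)] 1(1) 2(1) 3(1) by simp
qed

text \<open>
  A functorial factorization from its middle objects \<open>E f\<close>, the two factors \<open>l f\<close> and \<open>p f\<close>, and the action
  \<open>w\<close> of squares on the middle objects.
\<close>

lemma functorial_factorizationI:
  fixes l p :: "'a \<Rightarrow> 'a" and w :: "'a \<Rightarrow> 'a \<Rightarrow> 'a \<Rightarrow> 'a \<Rightarrow> 'a"
  assumes l: "\<And>f. f \<in> Arr C \<Longrightarrow> l f \<in> hom C (Dom C f) (E f)"
    and p: "\<And>f. f \<in> Arr C \<Longrightarrow> p f \<in> hom C (E f) (Cod C f)"
    and pl: "\<And>f. f \<in> Arr C \<Longrightarrow> p f \<cdot> l f = f"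
    and w: "\<And>f u v g. is_square f u v g \<Longrightarrow> w f u v g \<in> hom C (E f) (E g)"
    and wl: "\<And>f u v g. is_square f u v g \<Longrightarrow> w f u v g \<cdot> l f = l g \<cdot> u"
    and pw: "\<And>f u v g. is_square f u v g \<Longrightarrow> p g \<cdot> w f u v g = v \<cdot> p f"
    and w_Ident: "\<And>f. f \<in> Arr C \<Longrightarrow> w f (Ident C (Dom C f)) (Ident C (Cod C f)) f = Ident C (E f)"
    and w_Comp: "\<And>f u v g u' v' h. is_square f u v g \<Longrightarrow> is_square g u' v' h \<Longrightarrow>
      w f (u' \<cdot> u) (v' \<cdot> v) h = w g u' v' h \<cdot> w f u v g"
  shows "functorial_factorization C
      \<lparr>OMap = l, AMap = (\<lambda>(f, u, v, g). (l f, u, w f u v g, l g))\<rparr>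
      \<lparr>OMap = p, AMap = (\<lambda>(f, u, v, g). (p f, w f u v g, v, p g))\<rparr>"
proof -
  have dom: "Dom C (l f) = Dom C f" "Cod C (l f) = E f" "Dom C (p f) = E f" "Cod C (p f) = Cod C f" "l f \<in> Arr C" "p f \<in> Arr C"
    if "f \<in> Arr C" for f
    using l[OF that] p[OF that] by (auto simp: hom_def)
  have sq: "is_square (l f) u (w f u v g) (l g)" "is_square (p f) (w f u v g) v (p g)" if "is_square f u v g" for f u v g
    using w[OF that] wl[OF that] pw[OF that] dom that by (auto simp: is_square_def)
  have Arr: "f \<in> Arr C" "g \<in> Arr C" if "is_square f u v g" for f u v g
    using that by (auto simp: is_square_def)
  have "is_functor (arrow_cat C) (arrow_cat C) \<lparr>OMap = l, AMap = (\<lambda>(f, u, v, g). (l f, u, w f u v g, l g))\<rparr>"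
    by (intro is_functor.intro is_functor_axioms.intro category_arrow_cat)
      (use dom sq w_Ident w_Comp in \<open>auto simp: arrow_cat_hom\<close>)
  moreover have "is_functor (arrow_cat C) (arrow_cat C) \<lparr>OMap = p, AMap = (\<lambda>(f, u, v, g). (p f, w f u v g, v, p g))\<rparr>"
    by (intro is_functor.intro is_functor_axioms.intro category_arrow_cat)
      (use dom sq w_Ident w_Comp in \<open>auto simp: arrow_cat_hom\<close>)
  ultimately show ?thesis
    unfolding functorial_factorization_def using dom pl by auto
qed

end

context cellular_category begin

text \<open>
  The tower is stopped at one ordinal \<open>\<Lambda>\<close> that is filtered enough for the domains of all maps in \<open>K\<close> at once and
  does not depend on \<open>f\<close>; otherwise maps of towers would not induce maps between the middle objects.
\<close>

theorem small_object_argument: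
  assumes small: "domains_small_relative \<U> C K (cell \<U> C K)"
  shows "\<exists>\<alpha> \<beta>. functorial_factorization C \<alpha> \<beta> \<and>
    (\<forall>f \<in> Arr C. OMap \<alpha> f \<in> LLP C (RLP C K) \<and> OMap \<beta> f \<in> RLP C K)"
proof -
  obtain \<kappa> :: "'a \<Rightarrow> 'u rel" where \<kappa>: "\<And>i. i \<in> K \<Longrightarrow> Card_order (\<kappa> i) \<and> \<kappa> i <o \<U>"
    "\<And>i. i \<in> K \<Longrightarrow> cardinal_small_relative \<U> C (\<kappa> i) (Dom C i) (cell \<U> C K)"
    using small unfolding domains_small_relative_def small_relative_def by metis
  obtain \<Lambda> where \<Lambda>: "\<Lambda> \<in> Field \<U>" "\<And>i. i \<in> K \<Longrightarrow> filtered_ordinal (\<kappa> i) (Restr \<U> (underS \<U> \<Lambda>))"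
    using ex_filtered_ordinal[OF K_small, of \<kappa>] \<kappa>(1) by blast
  obtain T where T: "\<And>f. f \<in> Arr C \<Longrightarrow> tower f (T f)"
    using ex_tower by metis
  define w where "w f u v g = (SOME w. tower_map f (T f) (T g) u v w)" for f u v g
  have w: "tower_map f (T f) (T g) u v (w f u v g)" if "is_square f u v g" for f u v g
    unfolding w_def
    by (rule someI_ex[OF ex_tower_map[OF _ T _ T]]) (use that in \<open>auto simp: is_square_def\<close>)
  let ?\<alpha> = "\<lparr>OMap = (\<lambda>f. leg (T f) \<Lambda> Base), AMap = (\<lambda>(f, u, v, g). (leg (T f) \<Lambda> Base, u, w f u v g \<Lambda>, leg (T g) \<Lambda> Base))\<rparr>"
  let ?\<beta> = "\<lparr>OMap = (\<lambda>f. prj (T f) \<Lambda>), AMap = (\<lambda>(f, u, v, g). (prj (T f) \<Lambda>, w f u v g \<Lambda>, v, prj (T g) \<Lambda>))\<rparr>"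
  have "functorial_factorization C ?\<alpha> ?\<beta>"
  proof (rule functorial_factorizationI[where E = "\<lambda>f. obj (T f) \<Lambda>" and w = "\<lambda>f u v g. w f u v g \<Lambda>"])
    fix f assume f: "f \<in> Arr C"
    show "leg (T f) \<Lambda> Base \<in> hom C (Dom C f) (obj (T f) \<Lambda>)"
      "prj (T f) \<Lambda> \<in> hom C (obj (T f) \<Lambda>) (Cod C f)"
      "prj (T f) \<Lambda> \<cdot> leg (T f) \<Lambda> Base = f"
      using leg_Base[OF f T[OF f]] prj_hom[OF f T[OF f]] prj_leg[OF f T[OF f], of Base] by simp_all
    show "w f (Ident C (Dom C f)) (Ident C (Cod C f)) f \<Lambda> = Ident C (obj (T f) \<Lambda>)"
      by (rule tower_map_unique[OF f T[OF f] w[OF is_square_Ident[OF f]] tower_map_Ident[OF f T[OF f]]])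
  next
    fix f u v g assume sq: "is_square f u v g"
    show "w f u v g \<Lambda> \<in> hom C (obj (T f) \<Lambda>) (obj (T g) \<Lambda>)" "prj (T g) \<Lambda> \<cdot> w f u v g \<Lambda> = v \<cdot> prj (T f) \<Lambda>"
      "w f u v g \<Lambda> \<cdot> leg (T f) \<Lambda> Base = leg (T g) \<Lambda> Base \<cdot> u"
      using tower_mapD[OF w[OF sq]] by (simp_all add: transfer_def)
    fix u' v' h assume sq': "is_square g u' v' h"
    have "tower_map f (T f) (T h) (u' \<cdot> u) (v' \<cdot> v) (\<lambda>\<gamma>. w g u' v' h \<gamma> \<cdot> w f u v g \<gamma>)"
      using sq sq' unfolding is_square_def
      by (intro tower_map_Comp[where f'' = h, OF _ _ _ _ _ _ _ _ _ _ w[OF sq] w[OF sq']] T) blast+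
    then show "w f (u' \<cdot> u) (v' \<cdot> v) h \<Lambda> = w g u' v' h \<Lambda> \<cdot> w f u v g \<Lambda>"
      using sq tower_map_unique[OF _ T w[OF is_square_Comp[OF sq sq']]] unfolding is_square_def by blast
  qed
  moreover have "leg (T f) \<Lambda> Base \<in> LLP C (RLP C K)" "prj (T f) \<Lambda> \<in> RLP C K" if f: "f \<in> Arr C" for f
    using leg_Base_in_LLP[OF f T[OF f] \<Lambda>(1)] prj_in_RLP[OF f T[OF f] \<Lambda>(1)] \<Lambda>(2) \<kappa>(2) by blast+
  ultimately show ?thesis
    by (intro exI[of _ ?\<alpha>] exI[of _ ?\<beta>]) simp
qed

end


section \<open>Lifting properties, retracts and adjunctions\<close>

lemma has_liftE:
  assumes "has_lift C i p" "u \<in> hom C (Dom C i) (Dom C p)" "v \<in> hom C (Cod C i) (Cod C p)" "p \<cdot>\<^bsub>C\<^esub> u = v \<cdot>\<^bsub>C\<^esub> i"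
  obtains h where "h \<in> hom C (Cod C i) (Dom C p)" "h \<cdot>\<^bsub>C\<^esub> i = u" "p \<cdot>\<^bsub>C\<^esub> h = v"
  using assms unfolding has_lift_def by blast

context category begin

lemma has_lift_Ident_left: "x \<in> Obj C \<Longrightarrow> p \<in> Arr C \<Longrightarrow> has_lift C (Ident C x) p"
  unfolding has_lift_def using homD(2,3)[OF Ident_hom] Comp_Ident by fastforce

lemma has_lift_Ident_right: "x \<in> Obj C \<Longrightarrow> i \<in> Arr C \<Longrightarrow> has_lift C i (Ident C x)"
  unfolding has_lift_def using homD(2,3)[OF Ident_hom] Ident_Comp by fastforce

lemma has_lift_Comp_left:
  assumes i: "i \<in> hom C x y" and j: "j \<in> hom C y z" and p: "p \<in> Arr C"
    and lift: "has_lift C i p" "has_lift C j p"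
  shows "has_lift C (j \<cdot> i) p"
  unfolding has_lift_def homD(2,3)[OF Comp_hom[OF i j]]
proof (intro ballI impI)
  fix u v assume u: "u \<in> hom C x (Dom C p)" and v: "v \<in> hom C z (Cod C p)" and uv: "p \<cdot> u = v \<cdot> j \<cdot> i"
  have "p \<cdot> u = (v \<cdot> j) \<cdot> i"
    using uv Comp_assoc[OF i j v] by simp
  then obtain k where k: "k \<in> hom C y (Dom C p)" "k \<cdot> i = u" "p \<cdot> k = v \<cdot> j"
    using has_liftE[OF lift(1)] u Comp_hom[OF j v] unfolding homD(2,3)[OF i] by metis
  then obtain h where h: "h \<in> hom C z (Dom C p)" "h \<cdot> j = k" "p \<cdot> h = v"
    using has_liftE[OF lift(2)] v unfolding homD(2,3)[OF j] by metis
  then show "\<exists>h \<in> hom C z (Dom C p). h \<cdot> j \<cdot> i = u \<and> p \<cdot> h = v"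
    using Comp_assoc[OF i j h(1)] k(2) by auto
qed

lemma has_lift_Comp_right:
  assumes p: "p \<in> hom C x y" and q: "q \<in> hom C y z" and i: "i \<in> Arr C"
    and lift: "has_lift C i p" "has_lift C i q"
  shows "has_lift C i (q \<cdot> p)"
  unfolding has_lift_def homD(2,3)[OF Comp_hom[OF p q]]
proof (intro ballI impI)
  fix u v assume u: "u \<in> hom C (Dom C i) x" and v: "v \<in> hom C (Cod C i) z" and uv: "(q \<cdot> p) \<cdot> u = v \<cdot> i"
  have "q \<cdot> (p \<cdot> u) = v \<cdot> i"
    using uv Comp_assoc[OF u p q] by simp
  then obtain k where k: "k \<in> hom C (Cod C i) y" "k \<cdot> i = p \<cdot> u" "q \<cdot> k = v"
    using has_liftE[OF lift(2)] v Comp_hom[OF u p] unfolding homD(2,3)[OF q] by metis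
  then obtain h where h: "h \<in> hom C (Cod C i) x" "h \<cdot> i = u" "p \<cdot> h = k"
    using has_liftE[OF lift(1)] u unfolding homD(2,3)[OF p] by metis
  then show "\<exists>h \<in> hom C (Cod C i) x. h \<cdot> i = u \<and> (q \<cdot> p) \<cdot> h = v"
    using Comp_assoc[OF h(1) p q] k(3) by auto
qed

lemma has_lift_retract_left:
  assumes ret: "is_retract C f g" and lift: "has_lift C g p" and p: "p \<in> Arr C"
  shows "has_lift C f p"
  unfolding has_lift_def
proof (intro ballI impI)
  fix u v assume u: "u \<in> hom C (Dom C f) (Dom C p)" and v: "v \<in> hom C (Cod C f) (Cod C p)" and uv: "p \<cdot> u = v \<cdot> f"
  obtain s r s' r' where f: "f \<in> hom C (Dom C f) (Cod C f)" and g: "g \<in> hom C (Dom C g) (Cod C g)"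
    and s: "s \<in> hom C (Dom C f) (Dom C g)" and r: "r \<in> hom C (Dom C g) (Dom C f)"
    and s': "s' \<in> hom C (Cod C f) (Cod C g)" and r': "r' \<in> hom C (Cod C g) (Cod C f)"
    and eq: "r \<cdot> s = Ident C (Dom C f)" "r' \<cdot> s' = Ident C (Cod C f)" "g \<cdot> s = s' \<cdot> f" "f \<cdot> r = r' \<cdot> g"
    using ret unfolding is_retract_def by (meson Arr_hom)
  have "p \<cdot> (u \<cdot> r) = (v \<cdot> r') \<cdot> g"
    using Comp_assoc[OF r u Arr_hom[OF p]] Comp_assoc[OF r f v] Comp_assoc[OF g r' v] uv eq(4) by metis
  then obtain h where h: "h \<in> hom C (Cod C g) (Dom C p)" "h \<cdot> g = u \<cdot> r" "p \<cdot> h = v \<cdot> r'"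
    using has_liftE[OF lift Comp_hom[OF r u] Comp_hom[OF r' v]] by blast
  show "\<exists>h \<in> hom C (Cod C f) (Dom C p). h \<cdot> f = u \<and> p \<cdot> h = v"
  proof (intro bexI conjI)
    show "h \<cdot> s' \<in> hom C (Cod C f) (Dom C p)"
      by (rule Comp_hom[OF s' h(1)])
    show "(h \<cdot> s') \<cdot> f = u"
      using Comp_assoc[OF f s' h(1)] Comp_assoc[OF s g h(1)] Comp_assoc[OF s r u] Comp_Ident[OF u] eq h(2) by metis
    show "p \<cdot> (h \<cdot> s') = v"
      using Comp_assoc[OF s' h(1) Arr_hom[OF p]] Comp_assoc[OF s' r' v] Comp_Ident[OF v] eq(2) h(3) by metis
  qed
qed

lemma has_lift_retract_right:
  assumes ret: "is_retract C f g" and lift: "has_lift C i g" and i: "i \<in> Arr C"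
  shows "has_lift C i f"
  unfolding has_lift_def
proof (intro ballI impI)
  fix u v assume u: "u \<in> hom C (Dom C i) (Dom C f)" and v: "v \<in> hom C (Cod C i) (Cod C f)" and uv: "f \<cdot> u = v \<cdot> i"
  obtain s r s' r' where f: "f \<in> hom C (Dom C f) (Cod C f)" and g: "g \<in> hom C (Dom C g) (Cod C g)"
    and s: "s \<in> hom C (Dom C f) (Dom C g)" and r: "r \<in> hom C (Dom C g) (Dom C f)"
    and s': "s' \<in> hom C (Cod C f) (Cod C g)" and r': "r' \<in> hom C (Cod C g) (Cod C f)"
    and eq: "r \<cdot> s = Ident C (Dom C f)" "r' \<cdot> s' = Ident C (Cod C f)" "g \<cdot> s = s' \<cdot> f" "f \<cdot> r = r' \<cdot> g"
    using ret unfolding is_retract_def by (meson Arr_hom)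
  have "g \<cdot> (s \<cdot> u) = (s' \<cdot> v) \<cdot> i"
    using Comp_assoc[OF u s g] Comp_assoc[OF u f s'] Comp_assoc[OF Arr_hom[OF i] v s'] uv eq(3) by metis
  then obtain h where h: "h \<in> hom C (Cod C i) (Dom C g)" "h \<cdot> i = s \<cdot> u" "g \<cdot> h = s' \<cdot> v"
    using has_liftE[OF lift Comp_hom[OF u s] Comp_hom[OF v s']] by blast
  show "\<exists>h \<in> hom C (Cod C i) (Dom C f). h \<cdot> i = u \<and> f \<cdot> h = v"
  proof (intro bexI conjI)
    show "r \<cdot> h \<in> hom C (Cod C i) (Dom C f)"
      by (rule Comp_hom[OF h(1) r])
    show "(r \<cdot> h) \<cdot> i = u"
      using Comp_assoc[OF Arr_hom[OF i] h(1) r] Comp_assoc[OF u s r] Ident_Comp[OF u] eq(1) h(2) by metis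
    show "f \<cdot> (r \<cdot> h) = v"
      using Comp_assoc[OF h(1) r f] Comp_assoc[OF h(1) g r'] Comp_assoc[OF v s' r'] Ident_Comp[OF v] eq h(3) by metis
  qed
qed

text \<open>
  The retract argument: a lift in the square from \<open>p \<cdot> i\<close> to \<open>p\<close> with \<open>i\<close> on the domains and an identity on the codomains is a
  section of \<open>p\<close> which exhibits \<open>p \<cdot> i\<close> as a retract of \<open>i\<close>.
\<close>

lemma retract_argument:
  assumes i: "i \<in> hom C x y" and p: "p \<in> hom C y z" and lift: "has_lift C (p \<cdot> i) p"
  shows "is_retract C (p \<cdot> i) i"
proof -
  note f = Comp_hom[OF i p]
  obtain h where h: "h \<in> hom C z y" "h \<cdot> p \<cdot> i = i" "p \<cdot> h = Ident C z"
    using has_liftE[OF lift, of i "Ident C z"] i Ident_hom[OF hom_Obj(2)[OF p]] Ident_Comp[OF f]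
    unfolding homD(2,3)[OF f] homD(2,3)[OF p] by metis
  have "Ident C x \<in> hom C x x"
    by (rule Ident_hom[OF hom_Obj(1)[OF i]])
  then show ?thesis
    unfolding is_retract_def homD(2,3)[OF f] homD(2,3)[OF i]
    using homD(1)[OF f] homD(1)[OF i] h p Comp_Ident[OF i] Comp_Ident[OF f] Comp_Ident[of "Ident C x" x x] by metis
qed

lemma subcategory_LLP:
  assumes "K \<subseteq> Arr C"
  shows "subcategory C (LLP C K)"
  unfolding subcategory_def LLP_def
proof (intro conjI ballI impI CollectI)
  show "Ident C x \<in> Arr C" if "x \<in> Obj C" for x
    using homD(1)[OF Ident_hom[OF that]] .
  show "has_lift C (Ident C x) p" if "x \<in> Obj C" "p \<in> K" for x p
    using has_lift_Ident_left that assms by blast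
  fix i j assume "i \<in> {i \<in> Arr C. \<forall>p \<in> K. has_lift C i p}" "j \<in> {i \<in> Arr C. \<forall>p \<in> K. has_lift C i p}" "Dom C j = Cod C i"
  then have i: "i \<in> hom C (Dom C i) (Cod C i)" and j: "j \<in> hom C (Cod C i) (Cod C j)"
    and lift: "\<And>p. p \<in> K \<Longrightarrow> has_lift C i p \<and> has_lift C j p"
    by (auto simp: hom_def)
  show "j \<cdot> i \<in> Arr C"
    using homD(1)[OF Comp_hom[OF i j]] .
  show "has_lift C (j \<cdot> i) p" if "p \<in> K" for p
    using has_lift_Comp_left[OF i j] lift[OF that] that assms by blast
qed auto

lemma subcategory_RLP:
  assumes "K \<subseteq> Arr C"
  shows "subcategory C (RLP C K)"
  unfolding subcategory_def RLP_def
proof (intro conjI ballI impI CollectI)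
  show "Ident C x \<in> Arr C" if "x \<in> Obj C" for x
    using homD(1)[OF Ident_hom[OF that]] .
  show "has_lift C i (Ident C x)" if "x \<in> Obj C" "i \<in> K" for x i
    using has_lift_Ident_right that assms by blast
  fix p q assume "p \<in> {p \<in> Arr C. \<forall>i \<in> K. has_lift C i p}" "q \<in> {p \<in> Arr C. \<forall>i \<in> K. has_lift C i p}" "Dom C q = Cod C p"
  then have p: "p \<in> hom C (Dom C p) (Cod C p)" and q: "q \<in> hom C (Cod C p) (Cod C q)"
    and lift: "\<And>i. i \<in> K \<Longrightarrow> has_lift C i p \<and> has_lift C i q"
    by (auto simp: hom_def)
  show "q \<cdot> p \<in> Arr C"
    using homD(1)[OF Comp_hom[OF p q]] .
  show "has_lift C i (q \<cdot> p)" if "i \<in> K" for i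
    using has_lift_Comp_right[OF p q] lift[OF that] that assms by blast
qed auto

lemma is_retract_Arr: "is_retract C f g \<Longrightarrow> f \<in> Arr C"
  by (simp add: is_retract_def)

lemma retract_closed_LLP: "K \<subseteq> Arr C \<Longrightarrow> retract_closed C (LLP C K)"
  unfolding retract_closed_def LLP_def using has_lift_retract_left is_retract_Arr by blast

lemma retract_closed_RLP: "K \<subseteq> Arr C \<Longrightarrow> retract_closed C (RLP C K)"
  unfolding retract_closed_def RLP_def using has_lift_retract_right is_retract_Arr by blast

end

lemma RLP_Arr: "RLP C K \<subseteq> Arr C"
  by (auto simp: RLP_def)

lemma LLP_antimono: "K \<subseteq> K' \<Longrightarrow> LLP C K' \<subseteq> LLP C K"
  by (auto simp: LLP_def)

lemma RLP_Un: "RLP C (K \<union> K') = RLP C K \<inter> RLP C K'"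
  by (auto simp: RLP_def)

lemma functorial_factorizationD:
  assumes "functorial_factorization C \<alpha> \<beta>" "f \<in> Arr C" "OMap \<alpha> f \<in> Arr C" "OMap \<beta> f \<in> Arr C"
  shows "OMap \<alpha> f \<in> hom C (Dom C f) (Cod C (OMap \<alpha> f))" "OMap \<beta> f \<in> hom C (Cod C (OMap \<alpha> f)) (Cod C f)"
    "OMap \<beta> f \<cdot>\<^bsub>C\<^esub> OMap \<alpha> f = f"
  using assms by (auto simp: functorial_factorization_def hom_def)

context adjunction begin

lemma transpose_Comp_left:
  assumes g: "g \<in> hom B (OMap F x) y" and k: "k \<in> hom B y y'" and x: "x \<in> Obj A"
  shows "\<phi> x y' (k \<cdot>\<^bsub>B\<^esub> g) = AMap R k \<cdot>\<^bsub>A\<^esub> \<phi> x y g"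
proof -
  have "\<phi> x y g \<in> hom A x (OMap R y)"
    using bij[OF x L.B.hom_Obj(2)[OF g]] g by (auto simp: bij_betw_def)
  then show ?thesis
    using natural[OF L.A.Ident_hom[OF x] g k] L.AMap_Ident[OF x] L.B.Comp_Ident[OF g] L.A.Comp_Ident by simp
qed

lemma transpose_Comp_right:
  assumes h: "h \<in> hom A x' x" and g: "g \<in> hom B (OMap F x) y"
  shows "\<phi> x' y (g \<cdot>\<^bsub>B\<^esub> AMap F h) = \<phi> x y g \<cdot>\<^bsub>A\<^esub> h"
proof -
  note y = L.B.hom_Obj(2)[OF g]
  have \<phi>: "\<phi> x y g \<in> hom A x (OMap R y)"
    using bij[OF L.A.hom_Obj(2)[OF h] y] g by (auto simp: bij_betw_def)
  show ?thesis
    using natural[OF h g L.B.Ident_hom[OF y]] R.AMap_Ident[OF y]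
      L.B.Ident_Comp[OF L.B.Comp_hom[OF L.AMap_hom[OF h] g]] L.A.Ident_Comp[OF L.A.Comp_hom[OF h \<phi>]] by simp
qed

text \<open>
  By naturality the bijection \<open>\<phi>\<close> sends both composites in a lifting problem, and both triangles of a solution,
  to those of the transposed problem; as it is injective, it also reflects the equations between them.
\<close>

lemma has_lift_transpose:
  assumes i: "i \<in> Arr A" and p: "p \<in> Arr B"
  shows "has_lift B (AMap F i) p \<longleftrightarrow> has_lift A i (AMap R p)"
proof -
  define x y z w where "x = Dom A i" "y = Cod A i" "z = Dom B p" "w = Cod B p"
  have i: "i \<in> hom A x y" and p: "p \<in> hom B z w"
    using assms by (auto simp: hom_def x_y_z_w_def)
  note Fi = L.AMap_hom[OF i] and Rp = R.AMap_hom[OF p]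
  have Ob: "x \<in> Obj A" "y \<in> Obj A" "z \<in> Obj B" "w \<in> Obj B"
    using L.A.hom_Obj[OF i] L.B.hom_Obj[OF p] by auto
  have \<phi>: "\<phi> a b g \<in> hom A a (OMap R b)" if "g \<in> hom B (OMap F a) b" "a \<in> Obj A" "b \<in> Obj B" for a b g
    using bij[OF that(2,3)] that(1) by (auto simp: bij_betw_def)
  have \<phi>_surj: "\<exists>g'. g' \<in> hom B (OMap F a) b \<and> \<phi> a b g' = g" if "g \<in> hom A a (OMap R b)" "a \<in> Obj A" "b \<in> Obj B" for a b g
  proof -
    have "g \<in> \<phi> a b ` hom B (OMap F a) b"
      using bij[OF that(2,3)] that(1) by (simp add: bij_betw_def)
    then show ?thesis
      by auto
  qed
  have \<phi>_inj: "g = g'" if "\<phi> a b g = \<phi> a b g'" "g \<in> hom B (OMap F a) b" "g' \<in> hom B (OMap F a) b" "a \<in> Obj A" "b \<in> Obj B"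
    for a b g g'
    by (rule inj_onD[OF bij_betw_imp_inj_on[OF bij[OF that(4,5)]] that(1,2,3)])
  have square: "p \<cdot>\<^bsub>B\<^esub> u = v \<cdot>\<^bsub>B\<^esub> AMap F i \<longleftrightarrow> AMap R p \<cdot>\<^bsub>A\<^esub> \<phi> x z u = \<phi> y w v \<cdot>\<^bsub>A\<^esub> i"
    if u: "u \<in> hom B (OMap F x) z" and v: "v \<in> hom B (OMap F y) w" for u v
    using transpose_Comp_left[OF u p Ob(1)] transpose_Comp_right[OF i v]
      \<phi>_inj[OF _ L.B.Comp_hom[OF u p] L.B.Comp_hom[OF Fi v] Ob(1,4)] by metis
  have lift: "(h \<cdot>\<^bsub>B\<^esub> AMap F i = u \<and> p \<cdot>\<^bsub>B\<^esub> h = v) \<longleftrightarrow> (\<phi> y z h \<cdot>\<^bsub>A\<^esub> i = \<phi> x z u \<and> AMap R p \<cdot>\<^bsub>A\<^esub> \<phi> y z h = \<phi> y w v)"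
    if u: "u \<in> hom B (OMap F x) z" and v: "v \<in> hom B (OMap F y) w" and h: "h \<in> hom B (OMap F y) z" for u v h
    using transpose_Comp_left[OF h p Ob(2)] transpose_Comp_right[OF i h]
      \<phi>_inj[OF _ L.B.Comp_hom[OF Fi h] u Ob(1,3)] \<phi>_inj[OF _ L.B.Comp_hom[OF h p] v Ob(2,4)] by metis
  show ?thesis
    unfolding has_lift_def homD(2,3)[OF i] homD(2,3)[OF p] homD(2,3)[OF Fi] homD(2,3)[OF Rp]
  proof (intro iffI ballI impI)
    fix u v assume *: "\<forall>u \<in> hom B (OMap F x) z. \<forall>v \<in> hom B (OMap F y) w. p \<cdot>\<^bsub>B\<^esub> u = v \<cdot>\<^bsub>B\<^esub> AMap F i \<longrightarrow>
        (\<exists>h \<in> hom B (OMap F y) z. h \<cdot>\<^bsub>B\<^esub> AMap F i = u \<and> p \<cdot>\<^bsub>B\<^esub> h = v)"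
      and u: "u \<in> hom A x (OMap R z)" and v: "v \<in> hom A y (OMap R w)" and uv: "AMap R p \<cdot>\<^bsub>A\<^esub> u = v \<cdot>\<^bsub>A\<^esub> i"
    obtain u' v' where u': "u' \<in> hom B (OMap F x) z" "\<phi> x z u' = u" and v': "v' \<in> hom B (OMap F y) w" "\<phi> y w v' = v"
      using \<phi>_surj[OF u Ob(1,3)] \<phi>_surj[OF v Ob(2,4)] by blast
    then obtain h where h: "h \<in> hom B (OMap F y) z" "h \<cdot>\<^bsub>B\<^esub> AMap F i = u' \<and> p \<cdot>\<^bsub>B\<^esub> h = v'"
      using * square[OF u'(1) v'(1)] uv by metis
    show "\<exists>h \<in> hom A y (OMap R z). h \<cdot>\<^bsub>A\<^esub> i = u \<and> AMap R p \<cdot>\<^bsub>A\<^esub> h = v"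
      using h(2) lift[OF u'(1) v'(1) h(1)] \<phi>[OF h(1) Ob(2,3)] u'(2) v'(2) by (intro bexI[of _ "\<phi> y z h"]) auto
  next
    fix u v assume *: "\<forall>u \<in> hom A x (OMap R z). \<forall>v \<in> hom A y (OMap R w). AMap R p \<cdot>\<^bsub>A\<^esub> u = v \<cdot>\<^bsub>A\<^esub> i \<longrightarrow>
        (\<exists>h \<in> hom A y (OMap R z). h \<cdot>\<^bsub>A\<^esub> i = u \<and> AMap R p \<cdot>\<^bsub>A\<^esub> h = v)"
      and u: "u \<in> hom B (OMap F x) z" and v: "v \<in> hom B (OMap F y) w" and uv: "p \<cdot>\<^bsub>B\<^esub> u = v \<cdot>\<^bsub>B\<^esub> AMap F i"
    obtain h where h: "h \<in> hom A y (OMap R z)" "h \<cdot>\<^bsub>A\<^esub> i = \<phi> x z u \<and> AMap R p \<cdot>\<^bsub>A\<^esub> h = \<phi> y w v"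
      using * square[OF u v] uv \<phi>[OF u Ob(1,3)] \<phi>[OF v Ob(2,4)] by metis
    then obtain h' where "h' \<in> hom B (OMap F y) z" "\<phi> y z h' = h"
      using \<phi>_surj Ob(2,3) by blast
    then show "\<exists>h \<in> hom B (OMap F y) z. h \<cdot>\<^bsub>B\<^esub> AMap F i = u \<and> p \<cdot>\<^bsub>B\<^esub> h = v"
      using h(2) lift[OF u v] by (intro bexI[of _ h']) auto
  qed
qed

lemma RLP_func_image:
  assumes "K \<subseteq> Arr A"
  shows "RLP B (func_image F K) = func_vimage B R (RLP A K)"
  using assms has_lift_transpose homD(1)[OF R.AMap_hom[OF Arr_hom]]
  unfolding RLP_def func_image_def func_vimage_def by blast

lemma AMap_LLP_RLP:
  assumes K: "K \<subseteq> Arr A" and j: "j \<in> LLP A (RLP A K)"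
  shows "AMap F j \<in> LLP B (RLP B (func_image F K))"
  using j has_lift_transpose[of j] homD(1)[OF L.AMap_hom[OF Arr_hom]]
  unfolding RLP_func_image[OF K] LLP_def func_vimage_def by blast

end

section \<open>Recognizing cofibrantly generated model structures\<close>

text \<open>
  A map in \<open>LLP (RLP J)\<close> lifts against the second factor of its factorization into an acyclic cofibration followed by
  a fibration, so by the retract argument it is a retract of the first factor, a weak equivalence.
\<close>

lemma LLP_RLP_weak_equivalences:
  assumes cg: "cofibrantly_generated \<U> C W I J"
  shows "LLP C (RLP C J) \<subseteq> W"
proof
  fix f assume f: "f \<in> LLP C (RLP C J)"
  obtain Cof where model: "model_structure C W Cof (RLP C J)"
    using cg unfolding cofibrantly_generated_def by blast
  interpret category C
    using cg unfolding cofibrantly_generated_def bicomplete_def by blast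
  obtain \<gamma> \<delta> where fac: "functorial_factorization C \<gamma> \<delta>"
    "\<And>f. f \<in> Arr C \<Longrightarrow> OMap \<gamma> f \<in> W \<inter> Cof \<and> OMap \<delta> f \<in> RLP C J"
    using model unfolding model_structure_def by blast
  have W: "W \<subseteq> Arr C" "retract_closed C W"
    using model unfolding model_structure_def subcategory_def by blast+
  have "f \<in> Arr C"
    using f by (simp add: LLP_def)
  note fac' = fac(2)[OF this] functorial_factorizationD[OF fac(1) this]
  have Arr: "OMap \<gamma> f \<in> Arr C" "OMap \<delta> f \<in> Arr C"
    using fac'(1) W(1) by (auto simp: RLP_def)
  have "has_lift C f (OMap \<delta> f)"
    using f fac'(1) by (simp add: LLP_def)
  then have "is_retract C f (OMap \<gamma> f)"
    using retract_argument[OF fac'(2,3)[OF Arr]] fac'(4)[OF Arr] by simp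
  then show "f \<in> W"
    using W(2) fac'(1) unfolding retract_closed_def by blast
qed

text \<open>
  Both factorizations come from the small object argument.  Lifting of cofibrations against acyclic
  fibrations holds by the choice of cofibrations as \<open>LLP (RLP I)\<close>.  For the other half, an acyclic cofibration \<open>i\<close>
  is factored as a map in \<open>LLP (RLP J)\<close> followed by one in \<open>RLP J\<close>.  The second factor is a weak equivalence by
  two out of three, hence in \<open>RLP I\<close>, so that \<open>i\<close> is a retract of the first factor and lifts against \<open>RLP J\<close> too.
\<close>

theorem cofibrantly_generatedI:
  assumes U: "universe \<U>" and C: "bicomplete \<U> C"
    and I: "I \<subseteq> Arr C" "small \<U> I" and J: "J \<subseteq> Arr C" "small \<U> J"
    and small: "domains_small_relative \<U> C I (cell \<U> C I)" "domains_small_relative \<U> C J (cell \<U> C J)"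
    and W: "subcategory C W" "two_out_of_three C W" "retract_closed C W"
    and RLP: "RLP C I = W \<inter> RLP C J" and LLP: "LLP C (RLP C J) \<subseteq> W"
  shows "cofibrantly_generated \<U> C W I J"
proof -
  interpret bicomplete_category \<U> C
    using U C by (auto simp: bicomplete_category_def size_universe_def bicomplete_category_axioms_def bicomplete_def)
  interpret I: cellular_category \<U> C I
    using I by unfold_locales
  interpret J: cellular_category \<U> C J
    using J by unfold_locales
  obtain \<alpha> \<beta> where 1: "functorial_factorization C \<alpha> \<beta>"
    "\<forall>f \<in> Arr C. OMap \<alpha> f \<in> LLP C (RLP C I) \<and> OMap \<beta> f \<in> RLP C I"
    using I.small_object_argument[OF small(1)] by blast
  obtain \<gamma> \<delta> where 2: "functorial_factorization C \<gamma> \<delta>"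
    "\<forall>f \<in> Arr C. OMap \<gamma> f \<in> LLP C (RLP C J) \<and> OMap \<delta> f \<in> RLP C J"
    using J.small_object_argument[OF small(2)] by blast
  have JI: "LLP C (RLP C J) \<subseteq> LLP C (RLP C I)"
    by (rule LLP_antimono) (simp add: RLP)
  have "has_lift C i p" if i: "i \<in> W" "i \<in> LLP C (RLP C I)" and p: "p \<in> RLP C J" for i p
  proof -
    have iA: "i \<in> Arr C"
      using i(2) by (simp add: LLP_def)
    have g: "OMap \<gamma> i \<in> LLP C (RLP C J)" and d: "OMap \<delta> i \<in> RLP C J"
      using 2(2) iA by blast+
    have Arr: "OMap \<gamma> i \<in> Arr C" "OMap \<delta> i \<in> Arr C"
      using g d by (auto simp: LLP_def RLP_def)
    note fac = functorial_factorizationD[OF 2(1) iA Arr]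
    have "OMap \<gamma> i \<in> W"
      using g LLP by blast
    then have "OMap \<delta> i \<in> W"
      using W(2) Arr i(1) fac(3) homD(2)[OF fac(2)] unfolding two_out_of_three_def by metis
    then have "has_lift C i (OMap \<delta> i)"
      using d i(2) RLP by (simp add: LLP_def)
    then have "is_retract C i (OMap \<gamma> i)"
      using retract_argument[OF fac(1,2)] fac(3) by simp
    moreover have "has_lift C (OMap \<gamma> i) p"
      using g p by (simp add: LLP_def)
    ultimately show ?thesis
      using has_lift_retract_left p by (simp add: RLP_def)
  qed
  moreover have "has_lift C i p" if "i \<in> LLP C (RLP C I)" "p \<in> W \<inter> RLP C J" for i p
    using that RLP by (simp add: LLP_def)
  moreover have "\<forall>f \<in> Arr C. OMap \<alpha> f \<in> LLP C (RLP C I) \<and> OMap \<beta> f \<in> W \<inter> RLP C J"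
    "\<forall>f \<in> Arr C. OMap \<gamma> f \<in> W \<inter> LLP C (RLP C I) \<and> OMap \<delta> f \<in> RLP C J"
    using 1(2) 2(2) JI LLP RLP by blast+
  ultimately have "model_structure C W (LLP C (RLP C I)) (RLP C J)"
    unfolding model_structure_def
    using W subcategory_LLP[OF RLP_Arr] subcategory_RLP[OF J(1)] retract_closed_LLP[OF RLP_Arr] retract_closed_RLP[OF J(1)]
      1(1) 2(1) by blast
  then show ?thesis
    unfolding cofibrantly_generated_def using C I J small RLP by blast
qed

section \<open>Transfer along a pair of adjunctions\<close>

theorem proposition1p5:
  fixes \<U> :: "'u rel"
    and M :: "('om, 'm) cat" and N :: "('on, 'n) cat" and P :: "('op, 'p) cat"
    and F1 :: "('om, 'm, 'on, 'n) func" and U1 :: "('on, 'n, 'om, 'm) func"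
    and F2 :: "('on, 'n, 'op, 'p) func" and U2 :: "('op, 'p, 'on, 'n) func"
    and F0 :: "('om, 'm, 'op, 'p) func" and U0 :: "('op, 'p, 'om, 'm) func"
    and \<phi>1 :: "'om \<Rightarrow> 'on \<Rightarrow> 'n \<Rightarrow> 'm" and \<phi>2 :: "'on \<Rightarrow> 'op \<Rightarrow> 'p \<Rightarrow> 'n"
    and L I J W_N :: "'n set" and I0 J0 W_M :: "'m set" and W_P :: "'p set"
  assumes "universe \<U>"
    and "bicomplete \<U> M" and "bicomplete \<U> N" and "bicomplete \<U> P"
    and "L \<subseteq> Arr N"
    and "I \<subseteq> Arr N" and "small \<U> I" and "J \<subseteq> Arr N" and "small \<U> J"
    and "adjunction M N F1 U1 \<phi>1" and "adjunction N P F2 U2 \<phi>2"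
    and F0: "F0 = F2 \<circ>\<^sub>F F1" and U0: "U0 = U1 \<circ>\<^sub>F U2"
    and W_N: "W_N = func_vimage N U1 W_M \<inter> L"
    and A: "cofibrantly_generated \<U> M W_M I0 J0"
    and B: "cofibrantly_generated \<U> P W_P
              (func_image F0 I0 \<union> func_image F2 I) (func_image F0 J0 \<union> func_image F2 J)"
    and C: "subcategory N W_N" "two_out_of_three N W_N" "retract_closed N W_N"
    and D: "domains_small_relative \<U> N (func_image F1 I0 \<union> I) (cell \<U> N (func_image F1 I0 \<union> I))"
    and E: "domains_small_relative \<U> N (func_image F1 J0 \<union> J) (cell \<U> N (func_image F1 J0 \<union> J))"
    and F: "RLP N I = L \<inter> RLP N J"
    and G: "func_vimage N F2 W_P \<subseteq> W_N"
  shows "cofibrantly_generated \<U> N W_N (func_image F1 I0 \<union> I) (func_image F1 J0 \<union> J)"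
proof -
  interpret adj1: adjunction M N F1 U1 \<phi>1 by fact
  interpret adj2: adjunction N P F2 U2 \<phi>2 by fact
  interpret size_universe \<U> by unfold_locales fact
  have M: "I0 \<subseteq> Arr M" "J0 \<subseteq> Arr M" "small \<U> I0" "small \<U> J0" "RLP M I0 = W_M \<inter> RLP M J0"
    using A unfolding cofibrantly_generated_def by blast+
  have image_Arr: "func_image F1 K \<subseteq> Arr N" if "K \<subseteq> Arr M" for K
    using that homD(1)[OF adj1.L.AMap_hom[OF Arr_hom]] by (auto simp: func_image_def)
  have Arr: "func_image F1 I0 \<union> I \<subseteq> Arr N" "func_image F1 J0 \<union> J \<subseteq> Arr N"
    using image_Arr M(1,2) \<open>I \<subseteq> Arr N\<close> \<open>J \<subseteq> Arr N\<close> by auto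
  show ?thesis
  proof (rule cofibrantly_generatedI)
    show "small \<U> (func_image F1 I0 \<union> I)" "small \<U> (func_image F1 J0 \<union> J)"
      using M(3,4) \<open>small \<U> I\<close> \<open>small \<U> J\<close> unfolding func_image_def by (simp_all add: small_Un small_image)
    show "RLP N (func_image F1 I0 \<union> I) = W_N \<inter> RLP N (func_image F1 J0 \<union> J)"
      unfolding RLP_Un adj1.RLP_func_image[OF M(1)] adj1.RLP_func_image[OF M(2)] M(5) F W_N
      by (auto simp: func_vimage_def)
    have image: "func_image F2 (func_image F1 J0 \<union> J) = func_image F0 J0 \<union> func_image F2 J"
      by (simp add: F0 func_image_def func_comp_def image_Un image_comp)
    show "LLP N (RLP N (func_image F1 J0 \<union> J)) \<subseteq> W_N"
    proof
      fix j assume j: "j \<in> LLP N (RLP N (func_image F1 J0 \<union> J))"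
      have "AMap F2 j \<in> W_P"
        using adj2.AMap_LLP_RLP[OF Arr(2) j] LLP_RLP_weak_equivalences[OF B] unfolding image by blast
      then show "j \<in> W_N"
        using G j by (auto simp: func_vimage_def LLP_def)
    qed
  qed (fact assms Arr)+
qed

end
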